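(* Let $\mathcal{F}=\{f_1,\dots,f_m\}$ consist of $m$ piecewise degree-$d$-polynomial probability densities, each consisting of $n$ pieces, given in the input format described in the context. There is a randomized algorithm which, given $\mathcal{F}$ and $\delta,\varepsilon>0$, obtains a $(\delta,\varepsilon)$-relative-error approximation of the $L_1$-distances between all pairs in $\mathcal{F}$, using $O\big(m(m+n)d^3\varepsilon^{-3}\ln(m/\delta)\big)$ arithmetic operations.
   Context: Input format: let $a_1<\dots<a_s$ be the sorted endpoints of all intervals occurring in the family ($s\le 2mn$). Each $f_j$ is specified by $n$ index pairs $(b_{j\ell},c_{j\ell})$, $\ell=1,\dots,n$, with $1\le b_{j1}<c_{j1}<\dots<b_{jn}<c_{jn}\le s$, and vectors $\alpha_{j\ell}\in\mathbb{R}^{d+1}$ such that $f_j(x)=(1,x,\dots,x^d)\cdot\alpha_{j\ell}$ on $[a_{b_{j\ell}},a_{c_{j\ell}})$ and $f_j=0$ elsewhere. A $(\delta,\varepsilon)$-relative-error approximation outputs $D_{jk}$, $j,k\in[m]$, such that with probability at least $1-\delta$, for all $j,k$: $(1-\varepsilon)D_{jk}\le\|f_j-f_k\|_1\le(1+\varepsilon)D_{jk}$. In the operation count, drawing a sample from a Cauchy distribution counts as one operation.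
   Formalization: In the operation bound the factors d^3, ε^{-3} and ln(m/δ) are each replaced by their maximum with 1, since the literal bound is 0 for d=0, tends to 0 as ε grows, and is not positive for δ≥m; for m≥2, d≥1, δ<1, ε≤1 it is the stated bound up to a constant. *)

theory Defs
  imports "HOL-Probability.Probability"
begin

section \<open>Families of piecewise polynomial densities\<close>

text \<open>
  All indices are 0-based: functions \<open>j < nfun\<close>, pieces \<open>l < npiece\<close>, endpoints
  \<open>i < nend\<close>, coefficients \<open>i \<le> deg\<close>.
\<close>

record family_input =
  nfun :: nat                             (* m *)
  npiece :: nat                           (* n *)
  deg :: nat                              (* d *)
  nend :: nat                             (* s *)
  endp :: "nat \<Rightarrow> real"                   (* a i *)
  lidx :: "nat \<Rightarrow> nat \<Rightarrow> nat"             (* b j l *)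
  ridx :: "nat \<Rightarrow> nat \<Rightarrow> nat"             (* c j l *)
  coef :: "nat \<Rightarrow> nat \<Rightarrow> nat \<Rightarrow> real"     (* alpha j l i *)

text \<open>
  The second conjunct says that the \<open>a i\<close> are exactly the endpoints that occur in the
  family (which implies \<open>s \<le> 2 m n\<close>).
\<close>

definition wf_input :: "family_input \<Rightarrow> bool" where
  "wf_input F \<longleftrightarrow>
     strict_mono_on {..<nend F} (endp F) \<and>
     {..<nend F} = (\<Union>j<nfun F. \<Union>l<npiece F. {lidx F j l, ridx F j l}) \<and>
     (\<forall>j<nfun F. \<forall>l<npiece F. lidx F j l < ridx F j l \<and> ridx F j l < nend F) \<and>
     (\<forall>j<nfun F. \<forall>l. Suc l < npiece F \<longrightarrow> ridx F j l < lidx F j (Suc l))"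

definition piece :: "family_input \<Rightarrow> nat \<Rightarrow> nat \<Rightarrow> real set" where
  "piece F j l = {endp F (lidx F j l) ..< endp F (ridx F j l)}"

definition represents :: "family_input \<Rightarrow> (nat \<Rightarrow> real \<Rightarrow> real) \<Rightarrow> bool" where
  "represents F f \<longleftrightarrow> wf_input F \<and>
     (\<forall>j<nfun F.
        (\<forall>l<npiece F. \<forall>x\<in>piece F j l. f j x = (\<Sum>i\<le>deg F. coef F j l i * x ^ i)) \<and>
        (\<forall>x. x \<notin> (\<Union>l<npiece F. piece F j l) \<longrightarrow> f j x = 0))"

definition prob_density :: "(real \<Rightarrow> real) \<Rightarrow> bool" where
  "prob_density f \<longleftrightarrow>
     (\<forall>x. 0 \<le> f x) \<and> integrable lborel f \<and> (LINT x|lborel. f x) = 1"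

definition L1_dist :: "(real \<Rightarrow> real) \<Rightarrow> (real \<Rightarrow> real) \<Rightarrow> real" where
  "L1_dist f g = (LINT x|lborel. \<bar>f x - g x\<bar>)"

definition rel_error_approx ::
    "real \<Rightarrow> nat \<Rightarrow> (nat \<Rightarrow> real \<Rightarrow> real) \<Rightarrow> (nat \<Rightarrow> nat \<Rightarrow> real) \<Rightarrow> bool" where
  "rel_error_approx \<epsilon> m f D \<longleftrightarrow>
     (\<forall>j<m. \<forall>k<m. (1 - \<epsilon>) * D j k \<le> L1_dist (f j) (f k) \<and>
                  L1_dist (f j) (f k) \<le> (1 + \<epsilon>) * D j k)"

section \<open>Randomized algorithms: a real RAM with Cauchy samples\<close>

text \<open>
  The standard real RAM as a small structured language. Memory consists of one-dimensional
  arrays of naturals and of reals; scalars live in cell 0. There is no conversion from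
  reals to naturals (no floor), and the only constants are naturals, so a program is a
  finite object that cannot hard-wire real numbers. Subtraction of naturals is truncated,
  and division by zero yields 0.
\<close>

datatype iexp =
    INum nat
  | IGet string iexp
  | IAdd iexp iexp
  | ISub iexp iexp
  | IMul iexp iexp

datatype rexp =
    RNat iexp
  | RGet string iexp
  | RAdd rexp rexp
  | RSub rexp rexp
  | RMul rexp rexp
  | RDiv rexp rexp

datatype bexp =
    ILess iexp iexp
  | RLess rexp rexp
  | BNot bexp
  | BAnd bexp bexp

datatype com =
    Skip
  | ISet string iexp iexp
  | RSet string iexp rexp
  | Draw string iexp
  | Seq com com
  | Cond bexp com com
  | Loop bexp com

text \<open>The field \<open>drawn\<close> counts the samples consumed so far.\<close>

record state =
  imem :: "string \<Rightarrow> nat \<Rightarrow> nat"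
  rmem :: "string \<Rightarrow> nat \<Rightarrow> real"
  drawn :: nat

primrec ival :: "iexp \<Rightarrow> state \<Rightarrow> nat" where
  "ival (INum n) s = n"
| "ival (IGet v i) s = imem s v (ival i s)"
| "ival (IAdd p q) s = ival p s + ival q s"
| "ival (ISub p q) s = ival p s - ival q s"
| "ival (IMul p q) s = ival p s * ival q s"

primrec rval :: "rexp \<Rightarrow> state \<Rightarrow> real" where
  "rval (RNat i) s = real (ival i s)"
| "rval (RGet v i) s = rmem s v (ival i s)"
| "rval (RAdd p q) s = rval p s + rval q s"
| "rval (RSub p q) s = rval p s - rval q s"
| "rval (RMul p q) s = rval p s * rval q s"
| "rval (RDiv p q) s = rval p s / rval q s"

primrec bval :: "bexp \<Rightarrow> state \<Rightarrow> bool" where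
  "bval (ILess p q) s \<longleftrightarrow> ival p s < ival q s"
| "bval (RLess p q) s \<longleftrightarrow> rval p s < rval q s"
| "bval (BNot b) s \<longleftrightarrow> \<not> bval b s"
| "bval (BAnd b c) s \<longleftrightarrow> bval b s \<and> bval c s"

text \<open>
  Unit cost for every node of an evaluated expression and for every executed command other
  than sequencing. The operation count thus includes index arithmetic, memory accesses and
  comparisons, and so bounds the number of arithmetic operations on reals.
\<close>

primrec icost :: "iexp \<Rightarrow> nat" where
  "icost (INum n) = 1"
| "icost (IGet v i) = 1 + icost i"
| "icost (IAdd p q) = 1 + icost p + icost q"
| "icost (ISub p q) = 1 + icost p + icost q"
| "icost (IMul p q) = 1 + icost p + icost q"

primrec rcost :: "rexp \<Rightarrow> nat" where
  "rcost (RNat i) = 1 + icost i"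
| "rcost (RGet v i) = 1 + icost i"
| "rcost (RAdd p q) = 1 + rcost p + rcost q"
| "rcost (RSub p q) = 1 + rcost p + rcost q"
| "rcost (RMul p q) = 1 + rcost p + rcost q"
| "rcost (RDiv p q) = 1 + rcost p + rcost q"

primrec bcost :: "bexp \<Rightarrow> nat" where
  "bcost (ILess p q) = 1 + icost p + icost q"
| "bcost (RLess p q) = 1 + rcost p + rcost q"
| "bcost (BNot b) = 1 + bcost b"
| "bcost (BAnd b c) = 1 + bcost b + bcost c"

text \<open>
  \<open>exec \<omega> P s t s'\<close>: started in state \<open>s\<close>, program \<open>P\<close> terminates in state \<open>s'\<close> after
  exactly \<open>t\<close> operations, where the \<open>i\<close>-th sample drawn is \<open>\<omega> i\<close>.
\<close>

inductive exec :: "(nat \<Rightarrow> real) \<Rightarrow> com \<Rightarrow> state \<Rightarrow> nat \<Rightarrow> state \<Rightarrow> bool"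
  for \<omega> :: "nat \<Rightarrow> real" where
  Skip: "exec \<omega> Skip s 1 s"
| ISet: "exec \<omega> (ISet v i e) s (1 + icost i + icost e)
    (s\<lparr>imem := (imem s)(v := (imem s v)(ival i s := ival e s))\<rparr>)"
| RSet: "exec \<omega> (RSet v i e) s (1 + icost i + rcost e)
    (s\<lparr>rmem := (rmem s)(v := (rmem s v)(ival i s := rval e s))\<rparr>)"
| Draw: "exec \<omega> (Draw v i) s (1 + icost i)
    (s\<lparr>rmem := (rmem s)(v := (rmem s v)(ival i s := \<omega> (drawn s))), drawn := Suc (drawn s)\<rparr>)"
| Seq: "exec \<omega> P s t s' \<Longrightarrow> exec \<omega> Q s' t' s'' \<Longrightarrow> exec \<omega> (Seq P Q) s (t + t') s''"
| CondT: "bval b s \<Longrightarrow> exec \<omega> P s t s' \<Longrightarrow> exec \<omega> (Cond b P Q) s (1 + bcost b + t) s'"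
| CondF: "\<not> bval b s \<Longrightarrow> exec \<omega> Q s t s' \<Longrightarrow> exec \<omega> (Cond b P Q) s (1 + bcost b + t) s'"
| LoopF: "\<not> bval b s \<Longrightarrow> exec \<omega> (Loop b P) s (1 + bcost b) s"
| LoopT: "bval b s \<Longrightarrow> exec \<omega> P s t s' \<Longrightarrow> exec \<omega> (Loop b P) s' t' s'' \<Longrightarrow>
    exec \<omega> (Loop b P) s (1 + bcost b + t + t') s''"

inductive_cases exec_SkipE: "exec \<omega> Skip s t s'"
inductive_cases exec_ISetE: "exec \<omega> (ISet v i e) s t s'"
inductive_cases exec_RSetE: "exec \<omega> (RSet v i e) s t s'"
inductive_cases exec_DrawE: "exec \<omega> (Draw v i) s t s'"
inductive_cases exec_SeqE: "exec \<omega> (Seq P Q) s t s'"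
inductive_cases exec_CondE: "exec \<omega> (Cond b P Q) s t s'"
inductive_cases exec_LoopE: "exec \<omega> (Loop b P) s t s'"

lemma exec_deterministic:
  "exec \<omega> P s t s' \<Longrightarrow> exec \<omega> P s u s'' \<Longrightarrow> u = t \<and> s'' = s'"
proof (induction arbitrary: u s'' rule: exec.induct)
  case (Skip s)
  then show ?case by (rule exec_SkipE) simp
next
  case (ISet v i e s)
  then show ?case by (rule exec_ISetE) simp
next
  case (RSet v i e s)
  then show ?case by (rule exec_RSetE) simp
next
  case (Draw v i s)
  then show ?case by (rule exec_DrawE) simp
next
  case (Seq P s t s' Q t' s2)
  from Seq.prems show ?case
  proof (rule exec_SeqE)
    fix t1 r1 t2
    assume *: "u = t1 + t2" "exec \<omega> P s t1 r1" "exec \<omega> Q r1 t2 s''"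
    from Seq.IH(1)[OF *(2)] have "t1 = t" "r1 = s'" by simp_all
    with Seq.IH(2)[of t2 s''] * show ?thesis by simp
  qed
next
  case (CondT b s P t s' Q)
  from CondT.prems show ?case
  proof (rule exec_CondE)
    fix t1
    assume "u = Suc (bcost b + t1)" "exec \<omega> P s t1 s''"
    with CondT.IH[of t1 s''] show ?thesis by simp
  qed (simp add: CondT.hyps)
next
  case (CondF b s Q t s' P)
  from CondF.prems show ?case
  proof (rule exec_CondE)
    fix t1
    assume "u = Suc (bcost b + t1)" "exec \<omega> Q s t1 s''"
    with CondF.IH[of t1 s''] show ?thesis by simp
  qed (simp add: CondF.hyps)
next
  case (LoopF b s P)
  from LoopF.prems show ?case
    by (rule exec_LoopE) (simp_all add: LoopF.hyps)
next
  case (LoopT b s P t s' t' s2)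
  from LoopT.prems show ?case
  proof (rule exec_LoopE)
    fix t1 r1 t2
    assume *: "u = Suc (bcost b + t1 + t2)" "exec \<omega> P s t1 r1" "exec \<omega> (Loop b P) r1 t2 s''"
    from LoopT.IH(1)[OF *(2)] have "t1 = t" "r1 = s'" by simp_all
    with LoopT.IH(2)[of t2 s''] * show ?thesis by simp
  qed (simp add: LoopT.hyps)
qed

text \<open>
  Two- and three-dimensional tables are stored in row-major order: \<open>b j l\<close> and \<open>c j l\<close> at
  address \<open>j * n + l\<close>, \<open>alpha j l i\<close> at address \<open>(j * n + l) * (d + 1) + i\<close>. All cells not
  holding input are 0.
\<close>

definition scalar :: "'a::zero \<Rightarrow> nat \<Rightarrow> 'a" where
  "scalar x = (\<lambda>_. 0)(0 := x)"

definition table :: "nat \<Rightarrow> (nat \<Rightarrow> 'a::zero) \<Rightarrow> nat \<Rightarrow> 'a" where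
  "table N g = (\<lambda>i. if i < N then g i else 0)"

definition init_state :: "family_input \<Rightarrow> real \<Rightarrow> real \<Rightarrow> state" where
  "init_state F \<delta> \<epsilon> = (let m = nfun F; n = npiece F; d = deg F in
     \<lparr>imem = (\<lambda>_ _. 0)
        (''m'' := scalar m, ''n'' := scalar n, ''d'' := scalar d, ''s'' := scalar (nend F),
         ''b'' := table (m * n) (\<lambda>i. lidx F (i div n) (i mod n)),
         ''c'' := table (m * n) (\<lambda>i. ridx F (i div n) (i mod n))),
      rmem = (\<lambda>_ _. 0)
        (''delta'' := scalar \<delta>, ''epsilon'' := scalar \<epsilon>,
         ''a'' := table (nend F) (endp F),
         ''alpha'' := table (m * n * (d + 1))
           (\<lambda>i. coef F (i div (d + 1) div n) (i div (d + 1) mod n) (i mod (d + 1)))),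
      drawn = 0\<rparr>)"

definition dist_estimate :: "nat \<Rightarrow> state \<Rightarrow> nat \<Rightarrow> nat \<Rightarrow> real" where
  "dist_estimate m s j k = rmem s ''D'' (j * m + k)"

definition cauchy :: "real measure" where
  "cauchy = density lborel (\<lambda>x. ennreal (1 / (pi * (1 + x\<^sup>2))))"

definition cauchy_samples :: "(nat \<Rightarrow> real) measure" where
  "cauchy_samples = (\<Pi>\<^sub>M i\<in>UNIV. cauchy)"

section \<open>The operation bound\<close>

text \<open>
  Each parameter-dependent factor of \<open>m (m + n) d^3 \<epsilon>^(-3) ln (m / \<delta>)\<close> that can fall
  below 1 is clamped at 1. Unclamped, the bound vanishes for \<open>d = 0\<close>, tends to 0 for
  \<open>\<epsilon> \<rightarrow> \<infinity>\<close> and is not positive for \<open>\<delta> \<ge> m\<close>, so that no algorithm can meet it there. In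
  the intended range the clamped bound is the original one up to a constant factor, by the
  lemma below.
\<close>

definition op_bound :: "nat \<Rightarrow> nat \<Rightarrow> nat \<Rightarrow> real \<Rightarrow> real \<Rightarrow> real" where
  "op_bound m n d \<delta> \<epsilon> =
     real m * (real m + real n) * max 1 (real d ^ 3) * max 1 (1 / \<epsilon> ^ 3) *
     max 1 (ln (real m / \<delta>))"

lemma op_bound_le:
  assumes "m \<ge> 2" "d \<ge> 1" "0 < \<delta>" "\<delta> < 1" "0 < \<epsilon>" "\<epsilon> \<le> 1"
  shows "op_bound m n d \<delta> \<epsilon> \<le>
    1 / ln 2 * (real m * (real m + real n) * real d ^ 3 * (1 / \<epsilon> ^ 3) * ln (real m / \<delta>))"
proof -
  have "2 * \<delta> \<le> real m"
    using assms by linarith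
  then have "2 \<le> real m / \<delta>"
    using assms by (simp add: field_simps)
  then have L: "ln 2 \<le> ln (real m / \<delta>)"
    by simp
  have l2: "0 < ln (2::real)" "ln (2::real) \<le> 1"
    using ln_2_less_1 by auto
  define L K where "L = ln (real m / \<delta>)" and "K = real m * (real m + real n) * real d ^ 3 * (1 / \<epsilon> ^ 3)"
  have "0 \<le> L"
    using L l2 unfolding L_def by linarith
  then have "ln 2 * L \<le> L"
    using mult_right_mono[OF l2(2)] by fastforce
  then have "L \<le> L / ln 2"
    using l2(1) by (subst pos_le_divide_eq) (simp_all only: mult.commute)
  moreover have "1 \<le> L / ln 2"
    using L l2(1) unfolding L_def by (subst pos_le_divide_eq) (simp_all only: mult_1)
  ultimately have M: "max 1 L \<le> L / ln 2"
    by simp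
  have "max 1 (real d ^ 3) = real d ^ 3"
    using assms(2) by (intro max_absorb2 one_le_power) simp
  moreover have "max 1 (1 / \<epsilon> ^ 3) = 1 / \<epsilon> ^ 3"
    using assms by (intro max_absorb2) (simp add: power_le_one)
  ultimately have "op_bound m n d \<delta> \<epsilon> = K * max 1 L"
    unfolding op_bound_def K_def L_def by (simp only:)
  also have "\<dots> \<le> K * (L / ln 2)"
    using assms by (intro mult_left_mono M) (auto simp: K_def)
  also have "\<dots> = 1 / ln 2 * (K * L)"
    by simp
  finally show ?thesis
    unfolding K_def L_def .
qed

end

theory Submission
  imports Defs "HOL-Complex_Analysis.Complex_Analysis" "HOL-Library.Real_Mod"
begin

text \<open>
  Every interval between consecutive endpoints is cut into \<open>q = O(d\<^sup>2 / \<epsilon>)\<close> cells of equal length, and a density is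
  replaced by its value at the left end of each cell. If independent Cauchy samples are attached to the cells,
  the sum of the samples weighted by cell length times density is a linear sketch; the difference of
  two sketches is a Cauchy variable whose scale is the quadrature sum of \<open>\<bar>f j - f k\<bar>\<close>. By Markov's inequality
  in \<open>L\<^sub>1\<close> this scale is \<open>(1 \<plusminus> \<epsilon>)\<close> times the distance. Prefix sums of the moments of the samples allow all \<open>m\<close> sketches
  to be formed from \<open>O(m n d)\<close> operations.

  The scale is recovered from \<open>N = O(\<epsilon>\<^sup>-\<^sup>2 ln (m / \<delta>))\<close> independent sketches as the geometric mean of their
  absolute values: the logarithm of a standard Cauchy variable is symmetric with exponential tails, so that
  the geometric mean is exponentially concentrated. Its \<open>N\<close>-th root is located by multiplying or
  dividing the first sample by \<open>1 + \<epsilon>\<close>; the tails also guarantee that \<open>N\<close> such steps suffice.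
\<close>

section \<open>The Cauchy distribution\<close>

text \<open>A Cauchy variable has no mean, so averaging the \<open>\<bar>x p\<bar>\<close> does not
  concentrate; and the machine has neither logarithms nor roots, so the mean of
  \<open>ln \<bar>x p\<bar>\<close> cannot be formed either. Products, quotients and comparisons
  suffice to compare powers of the geometric mean with powers of a guess. For the same reason the
  program finds \<open>q\<close> and \<open>N\<close> by counting. The quadrature must be accurate
  relative to the integral of \<open>\<bar>f j - f k\<bar>\<close>, which may be tiny although both
  densities are large. Markov's inequality provides this because it bounds the variation of a
  polynomial by its own integral, and it applies to the difference as it stands. The exponent 3 of
  \<open>d\<close> is 2 for the cells plus 1 for the moments, that of \<open>1 / \<epsilon>\<close>
  is 1 for the cells plus 2 for the projections. All functions share the same samples, so the
  estimates of different pairs are dependent; a union bound over the pairs tolerates this. Program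
  and probability meet only in the explicit function \<open>estimate\<close> of the sample
  sequence.\<close>

lemma has_integral_cauchy_density:
  "has_bochner_integral lborel (\<lambda>x. 1 / (pi * (1 + x\<^sup>2)) :: real) 1"
proof -
  let ?f = "\<lambda>x::real. 1 / (pi * (1 + x\<^sup>2))" and ?F = "\<lambda>x. arctan x / pi"
  have deriv: "DERIV ?F x :> ?f x" for x
    using DERIV_cdivide[OF DERIV_arctan[of x], of pi] by (simp add: divide_inverse mult.commute)
  have cont: "isCont ?f x" for x :: real
  proof -
    have "1 + x\<^sup>2 \<noteq> 0" by (smt (verit) zero_le_power2)
    then show ?thesis by (intro continuous_intros) auto
  qed
  have "(arctan \<longlongrightarrow> - (pi/2)) at_bot" "(arctan \<longlongrightarrow> pi/2) at_top"
    by (rule tendsto_arctan_at_bot tendsto_arctan_at_top)+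
  then have "((\<lambda>x. arctan x / pi) \<longlongrightarrow> - (pi/2) / pi) at_bot" "((\<lambda>x. arctan x / pi) \<longlongrightarrow> (pi/2) / pi) at_top"
    by (intro tendsto_divide; simp)+
  then have lim: "((?F \<circ> real_of_ereal) \<longlongrightarrow> - 1 / 2) (at_right (-\<infinity>))"
    "((?F \<circ> real_of_ereal) \<longlongrightarrow> 1 / 2) (at_left \<infinity>)"
    by (simp_all add: ereal_tendsto_simps)
  have "0 \<le> ?f x" for x :: real by simp
  note interval_integral_FTC_nonneg[OF _ deriv cont _ lim]
  then show ?thesis
    unfolding has_bochner_integral_iff set_integrable_def interval_lebesgue_integral_def set_lebesgue_integral_def
    by (simp add: add_nonneg_nonneg)
qed

lemma sets_cauchy [simp, measurable_cong]: "sets cauchy = sets borel"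
  by (simp add: cauchy_def)

lemma space_cauchy [simp]: "space cauchy = UNIV"
  by (simp add: cauchy_def)

lemma cauchy_density_pos: "0 < 1 / (pi * (1 + x\<^sup>2))" for x :: real
  by (smt (verit) pi_gt_zero zero_le_power2 zero_less_divide_1_iff zero_less_mult_iff)

lemma prob_space_cauchy: "prob_space cauchy"
proof
  have "emeasure cauchy (space cauchy) = (\<integral>\<^sup>+x. ennreal (1 / (pi * (1 + x\<^sup>2))) \<partial>lborel)"
    by (simp add: cauchy_def emeasure_density)
  also have "\<dots> = 1"
    using has_integral_cauchy_density cauchy_density_pos
    by (subst nn_integral_eq_integral) (auto simp: less_imp_le has_bochner_integral_iff)
  finally show "emeasure cauchy (space cauchy) = 1" .
qed

interpretation cauchy: prob_space cauchy by (rule prob_space_cauchy)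

interpretation cauchy: real_distribution cauchy
  by unfold_locales (simp_all)

text \<open>Subtracting \<open>exp (- t)\<close> makes the singularity at \<open>\<i>\<close> removable, so that Cauchy's theorem on a convex set
  suffices and the integral over the segment is minus the one over the half circle.\<close>

lemma half_disc_bound:
  fixes t R :: real
  assumes t: "0 \<le> t" and R: "2 \<le> R"
  defines "g \<equiv> \<lambda>x::real. (exp (\<i> * t * x) - exp (- t)) / (1 + x\<^sup>2)"
  shows "cmod (integral {-R..R} g) \<le> 8 * pi / R"
proof -
  \<comment> \<open>This half plane is convex and contains the half circle, its diameter and the
    removable point \<open>\<i>\<close>, but not the other zero \<open>- \<i>\<close> of
    \<open>1 + z\<^sup>2\<close>.\<close>
  define S where "S = {z. Im z > - 1 / 2}"
  define f where "f = (\<lambda>z. exp (\<i> * t * z) / (z + \<i>))"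
  define e where "e = (\<lambda>z. exp (\<i> * t * z))"
  define h1 where "h1 = (\<lambda>z. if z = \<i> then deriv e \<i> else (e z - e \<i>) / (z - \<i>))"
  define h where "h = (\<lambda>z. h1 z / (z + \<i>))"
  have opS: "open S" unfolding S_def by (rule open_halfspace_Im_gt)
  have cS: "convex S" unfolding S_def by (rule convex_halfspace_Im_gt)
  have "\<i> \<in> S" by (simp add: S_def)
  then have h1: "h1 holomorphic_on S" unfolding h1_def
    by (intro pole_lemma) (auto simp: e_def interior_open[OF opS] intro!: holomorphic_intros)
  have "z + \<i> \<noteq> 0" if "z \<in> S" for z
    using that by (auto simp: S_def complex_eq_iff)
  then have h: "h holomorphic_on S" unfolding h_def by (intro holomorphic_intros h1) auto
  let ?l = "linepath (complex_of_real (-R)) (complex_of_real R)" and ?c = "part_circlepath 0 R 0 pi"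
  have "- (1 / 2) < R * sin (u * pi)" if "0 \<le> u" "u \<le> 1" for u
  proof -
    have "0 \<le> R * sin (u * pi)" using that R by (intro mult_nonneg_nonneg sin_ge_zero) auto
    then show ?thesis by linarith
  qed
  then have im: "path_image ?l \<subseteq> S" "path_image ?c \<subseteq> S"
    using R by (auto simp: S_def closed_segment_def path_image_part_circlepath' cis.ctr)
  have ends: "pathfinish ?l = pathstart ?c" "pathfinish ?c = pathstart ?l"
    by (simp_all add: exp_pi_i')
  have "(h has_contour_integral 0) (?l +++ ?c)"
    by (rule Cauchy_theorem_convex_simple[OF h cS])
       (use im ends in \<open>auto simp: path_image_join\<close>)
  moreover have ci: "h contour_integrable_on ?l" "h contour_integrable_on ?c"
    using im opS by (auto intro!: contour_integrable_holomorphic_simple[OF h opS] valid_path_linepath)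
  ultimately have eq: "contour_integral ?l h + contour_integral ?c h = 0"
    using ends by (metis contour_integral_join contour_integral_unique valid_path_linepath valid_path_part_circlepath)
  have hval: "h z = (exp (\<i> * t * z) - exp (- t)) / (1 + z\<^sup>2)" if "z \<noteq> \<i>" for z
  proof -
    have "1 + z\<^sup>2 = (z - \<i>) * (z + \<i>)" by (simp add: algebra_simps power2_eq_square)
    moreover have "\<i> * complex_of_real t * \<i> = of_real (- t)"
      by (simp add: complex_eq_iff)
    then have "e \<i> = exp (- t)" unfolding e_def by (simp only: exp_of_real)
    ultimately show ?thesis using that by (simp add: h_def h1_def e_def)
  qed
  \<comment> \<open>On the arc \<open>Im z \<ge> 0\<close>, so both exponentials have modulus at
    most 1 and the numerator at most 2; for \<open>R \<ge> 2\<close> the denominator is at least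
    \<open>R\<^sup>2 / 4\<close>. The arc has length \<open>R * pi\<close>.\<close>
  have "cmod (contour_integral ?c h) \<le> 8 / R\<^sup>2 * R * \<bar>pi - 0\<bar>"
  proof (rule contour_integral_bound_part_circlepath[OF ci(2)])
    fix z assume z: "z \<in> path_image ?c"
    then obtain \<theta> where th: "\<theta> \<in> {0..pi}" "z = R * cis \<theta>"
      by (auto simp: path_image_part_circlepath' closed_segment_eq_real_ivl)
    have nz: "cmod z = R" using th R by (simp add: norm_mult)
    have "Im z \<ge> 0" using th R by (auto intro!: mult_nonneg_nonneg sin_ge_zero)
    then have "cmod (exp (\<i> * t * z)) \<le> 1" using t by simp
    moreover have "cmod (exp (- t)) \<le> 1" using t by simp
    ultimately have 1: "cmod (exp (\<i> * t * z) - exp (- t)) \<le> 2"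
      by (metis add_mono norm_triangle_ineq4 one_add_one order_trans)
    have "R\<^sup>2 - 1 \<le> cmod (1 + z\<^sup>2)"
      using norm_triangle_ineq2[of "z\<^sup>2" "-1"] nz by (simp add: norm_power add.commute)
    moreover have "4 \<le> R\<^sup>2" using R power_mono[of 2 R 2] by simp
    ultimately have 2: "R\<^sup>2 / 4 \<le> cmod (1 + z\<^sup>2)" by linarith
    have "z \<noteq> \<i>" using nz R by auto
    then have "cmod (h z) = cmod (exp (\<i> * t * z) - exp (- t)) / cmod (1 + z\<^sup>2)"
      by (simp add: hval norm_divide)
    also have "\<dots> \<le> 2 / (R\<^sup>2 / 4)"
      using 1 2 R by (intro frac_le) auto
    finally show "cmod (h z) \<le> 8 / R\<^sup>2" by simp
  qed (use R in auto)
  also have "\<dots> = 8 * pi / R" using R by (simp add: field_simps power2_eq_square)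
  finally have b: "cmod (contour_integral ?l h) \<le> 8 * pi / R"
    using eq by (metis add_eq_0_iff norm_minus_cancel)
  have "((\<lambda>x. h (of_real x)) has_integral contour_integral ?l h) {-R..R}"
    using has_contour_integral_integral[OF ci(1)] R
    by (subst (asm) has_contour_integral_linepath_Reals_iff) auto
  moreover have "h (of_real x) = g x" for x :: real
  proof -
    have "complex_of_real x \<noteq> \<i>" by (simp add: complex_eq_iff)
    then show ?thesis unfolding g_def by (simp add: hval exp_of_real)
  qed
  ultimately have "integral {-R..R} g = contour_integral ?l h"
    by (simp add: integral_unique)
  with b show ?thesis by simp
qed

text \<open>A constant is its own mean, so the claim is that \<open>g\<close> integrates to 0. The
  integrals over \<open>{-R..R}\<close> tend to the full integral by dominated convergence and to 0
  by \<open>half_disc_bound\<close>.\<close>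

lemma char_cauchy_nonneg:
  assumes t: "0 \<le> t"
  shows "char cauchy t = exp (- t)"
proof -
  define g :: "real \<Rightarrow> complex" where "g = (\<lambda>x. (exp (\<i> * t * x) - exp (- t)) / (1 + x\<^sup>2))"
  have pos: "0 < 1 + x\<^sup>2" for x :: real by (smt (verit) zero_le_power2)
  have g_eq: "g x = pi * ((1 / (pi * (1 + x\<^sup>2))) *\<^sub>R (iexp (t * x) - exp (- t)))" for x
  proof -
    have "complex_of_real pi * (1 / (complex_of_real pi * A) * B) = B / A" for A B
      by simp
    then show ?thesis unfolding g_def scaleR_conv_of_real by (simp add: exp_of_real mult.assoc)
  qed
  have int: "integrable cauchy (\<lambda>x. iexp (t * x) - exp (- t))"
    by (intro Bochner_Integration.integrable_diff cauchy.integrable_iexp) auto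
  then have "integrable lborel (\<lambda>x. (1 / (pi * (1 + x\<^sup>2))) *\<^sub>R (iexp (t * x) - exp (- t)))"
    unfolding cauchy_def using cauchy_density_pos
    by (subst (asm) integrable_density) (auto simp: less_imp_le)
  then have gi: "integrable lborel g"
    unfolding g_eq[abs_def] by (rule integrable_mult_right)
  have char: "char cauchy t - exp (- t) = integral\<^sup>L lborel g / pi"
  proof -
    have "char cauchy t - exp (- t) = (CLINT x|cauchy. iexp (t * x) - exp (- t))"
      unfolding char_def by (subst Bochner_Integration.integral_diff)
         (auto intro!: cauchy.integrable_iexp simp: cauchy.prob_space[simplified])
    also have "\<dots> = (CLINT x|lborel. (1 / (pi * (1 + x\<^sup>2))) *\<^sub>R (iexp (t * x) - exp (- t)))"
      unfolding cauchy_def using cauchy_density_pos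
      by (subst integral_density) (auto simp: less_imp_le)
    also have "\<dots> = integral\<^sup>L lborel g / pi"
      unfolding g_eq[abs_def] by (subst integral_mult_right_zero) simp
    finally show ?thesis .
  qed
  have "((\<lambda>R. set_lebesgue_integral lborel {-R..R} g) \<longlongrightarrow> integral\<^sup>L lborel g) at_top"
    unfolding set_lebesgue_integral_def
  proof (rule integral_dominated_convergence_at_top[where w = "\<lambda>x. norm (g x)"])
    show "AE x in lborel. ((\<lambda>R. indicator {-R..R} x *\<^sub>R g x) \<longlongrightarrow> g x) at_top"
    proof (intro AE_I2 tendsto_eventually)
      fix x :: real
      show "\<forall>\<^sub>F R in at_top. indicat_real {-R..R} x *\<^sub>R g x = g x"
        using eventually_ge_at_top[of "\<bar>x\<bar>"] by eventually_elim (auto simp: indicator_def)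
    qed
  qed (use gi in \<open>auto simp: indicator_def intro!: always_eventually borel_measurable_scaleR\<close>)
  moreover have "((\<lambda>R. set_lebesgue_integral lborel {-R..R} g) \<longlongrightarrow> 0) at_top"
  proof (rule Lim_null_comparison)
    show "\<forall>\<^sub>F R in at_top. norm (set_lebesgue_integral lborel {-R..R} g) \<le> 8 * pi / R"
      using eventually_ge_at_top[of 2]
    proof eventually_elim
      case (elim R)
      have "set_lebesgue_integral lborel {-R..R} g = integral {-R..R} g"
        using gi by (intro set_borel_integral_eq_integral) (auto simp: set_integrable_def intro!: integrable_mult_indicator)
      then show ?case using half_disc_bound[OF t elim] by (simp add: g_def)
    qed
    show "((\<lambda>R. 8 * pi / R) \<longlongrightarrow> 0) at_top" by real_asymp
  qed
  ultimately have "integral\<^sup>L lborel g = 0"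
    by (rule tendsto_unique[rotated]) simp
  with char show ?thesis by simp
qed

lemma char_cauchy: "char cauchy t = exp (- \<bar>t\<bar>)"
proof (cases "0 \<le> t")
  case False
  have "cnj (char cauchy (- t)) = (CLINT x|cauchy. cnj (iexp (- t * x)))"
    by (simp only: char_def Bochner_Integration.integral_cnj)
  also have "\<dots> = char cauchy t"
    unfolding char_def by (intro Bochner_Integration.integral_cong) (auto simp: exp_cnj)
  finally show ?thesis using False char_cauchy_nonneg[of "- t"] by (metis abs_of_neg complex_cnj_complex_of_real linorder_not_le minus_minus neg_0_le_iff_le nle_le)
qed (simp add: char_cauchy_nonneg)

lemma (in prob_space) char_distr_scale:
  assumes "random_variable borel X"
  shows "char (distr M borel (\<lambda>\<omega>. c * X \<omega>)) t = char (distr M borel X) (c * t)"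
  using assms by (simp add: char_def integral_distr ac_simps)

text \<open>This is the 1-stability of the Cauchy law, the reason why a linear sketch can measure an
  \<open>L\<^sub>1\<close> quantity: the characteristic functions
  \<open>exp (- \<bar>c i * t\<bar>)\<close> multiply to that of a Cauchy variable of scale
  \<open>\<Sum>i\<in>I. \<bar>c i\<bar>\<close>.\<close>

lemma (in prob_space) distr_sum_cauchy:
  assumes ind: "indep_vars (\<lambda>_. borel) X I" and X: "\<And>i. i \<in> I \<Longrightarrow> distr M borel (X i) = cauchy"
  shows "distr M borel (\<lambda>\<omega>. \<Sum>i\<in>I. c i * X i \<omega>) = distr cauchy borel (\<lambda>x. (\<Sum>i\<in>I. \<bar>c i\<bar>) * x)"
proof (rule Levy_uniqueness)
  have rv [measurable]: "random_variable borel (X i)" if "i \<in> I" for i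
    using ind that by (auto simp: indep_vars_def)
  show "real_distribution (distr M borel (\<lambda>\<omega>. \<Sum>i\<in>I. c i * X i \<omega>))"
    by (intro real_distribution_distr borel_measurable_sum borel_measurable_times rv) auto
  show "real_distribution (distr cauchy borel (\<lambda>x. (\<Sum>i\<in>I. \<bar>c i\<bar>) * x))"
    by (intro cauchy.real_distribution_distr) auto
  have ind': "indep_vars (\<lambda>_. borel) (\<lambda>i \<omega>. c i * X i \<omega>) I"
    using indep_vars_compose2[OF ind, of "\<lambda>i x. c i * x" "\<lambda>_. borel"] by simp
  show "char (distr M borel (\<lambda>\<omega>. \<Sum>i\<in>I. c i * X i \<omega>)) = char (distr cauchy borel (\<lambda>x. (\<Sum>i\<in>I. \<bar>c i\<bar>) * x))"
  proof
    fix t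
    have "char (distr M borel (\<lambda>\<omega>. \<Sum>i\<in>I. c i * X i \<omega>)) t = (\<Prod>i\<in>I. exp (- \<bar>c i * t\<bar>))"
      unfolding char_distr_sum[OF ind'] of_real_prod
      by (intro prod.cong refl) (simp add: char_distr_scale[OF rv] X char_cauchy)
    also have "(\<Prod>i\<in>I. exp (- \<bar>c i * t\<bar>)) = exp (- \<bar>(\<Sum>i\<in>I. \<bar>c i\<bar>) * t\<bar>)"
    \<comment> \<open>For infinite \<open>I\<close> the sum is 0 and the product is 1 by convention,
      so both sides are 1.\<close>
    proof (cases "finite I")
      case True
      then show ?thesis
        by (simp add: exp_sum[symmetric] sum_negf abs_mult sum_distrib_right[symmetric] sum_nonneg)
    qed simp
    also have "\<dots> = char (distr cauchy borel (\<lambda>x. (\<Sum>i\<in>I. \<bar>c i\<bar>) * x)) t"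
      by (subst cauchy.char_distr_scale) (simp_all add: char_cauchy distr_id2)
    finally show "char (distr M borel (\<lambda>\<omega>. \<Sum>i\<in>I. c i * X i \<omega>)) t
        = char (distr cauchy borel (\<lambda>x. (\<Sum>i\<in>I. \<bar>c i\<bar>) * x)) t" .
  qed
qed

section \<open>Logarithmic moments of the Cauchy distribution\<close>

lemma measure_cauchy_interval:
  assumes "a \<le> b"
  shows "measure cauchy {a..b} = (arctan b - arctan a) / pi"
proof -
  let ?f = "\<lambda>x::real. 1 / (pi * (1 + x\<^sup>2))"
  have "emeasure cauchy {a..b} = (\<integral>\<^sup>+x. ennreal (?f x) * indicator {a..b} x \<partial>lborel)"
    by (simp add: cauchy_def emeasure_density)
  also have "\<dots> = ennreal (arctan b / pi - arctan a / pi)"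
  proof (rule nn_integral_FTC_Icc)
    fix x :: real
    show "((\<lambda>x. arctan x / pi) has_real_derivative ?f x) (at x)"
      using DERIV_cdivide[OF DERIV_arctan[of x], of pi] by (simp add: divide_inverse mult.commute)
    show "0 \<le> ?f x" using cauchy_density_pos[of x] by (rule less_imp_le)
  qed (use assms in auto)
  finally show ?thesis
    using assms by (simp add: measure_def arctan_monotone' divide_right_mono diff_divide_distrib)
qed

text \<open>Up to null sets, \<open>1 / \<bar>x\<bar> \<le> y\<close> is the complement of
  \<open>{- (1/y)..1/y}\<close>, and \<open>arctan (1/y) = pi/2 - arctan y\<close> for
  \<open>y > 0\<close>. In other words, \<open>ln \<bar>x\<bar>\<close> has a symmetric
  distribution.\<close>

lemma distr_cauchy_inverse_abs:
  "distr cauchy borel (\<lambda>x. inverse \<bar>x\<bar>) = distr cauchy borel abs"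
proof (rule cdf_unique)
  show "real_distribution (distr cauchy borel (\<lambda>x. inverse \<bar>x\<bar>))" "real_distribution (distr cauchy borel abs)"
    by (intro cauchy.real_distribution_distr; simp)+
  have zero: "measure cauchy {0} = 0"
    using measure_cauchy_interval[of 0 0] by simp
  show "cdf (distr cauchy borel (\<lambda>x. inverse \<bar>x\<bar>)) = cdf (distr cauchy borel abs)"
  proof
    fix y :: real
    let ?L = "{x. inverse \<bar>x\<bar> \<le> y}" and ?A = "{x. \<bar>x\<bar> \<le> y}" and ?d = "distr cauchy borel (\<lambda>x. inverse \<bar>x\<bar>)"
    have l: "cdf ?d y = measure cauchy ?L"
      and r: "cdf (distr cauchy borel abs) y = measure cauchy ?A"
      unfolding cdf_def by (subst measure_distr; auto intro!: arg_cong[where f = "measure cauchy"])+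
    consider "y < 0" | "y = 0" | "0 < y" by linarith
    then show "cdf ?d y = cdf (distr cauchy borel abs) y"
    proof cases
      case 1
      then have "?L = {}" "?A = {}"
        by (auto simp: not_le intro: less_le_trans)
      with l r show ?thesis by simp
    next
      case 2
      \<comment> \<open>Since \<open>inverse 0 = 0\<close>, the point 0 does lie in
        \<open>?L\<close>; it is a null set.\<close>
      then have "?L = {0}" "?A = {0}" by auto
      with l r show ?thesis by simp
    next
      case 3
      have "measure cauchy ?L = measure cauchy (UNIV - {- (1/y)..1/y})"
      proof (rule measure_eq_AE)
        have "measure cauchy {c} = 0" for c using measure_cauchy_interval[of c c] by simp
        then have "AE x in cauchy. x \<noteq> c" for c
          by (subst AE_iff_measurable[OF _ refl]) (auto simp: cauchy.emeasure_eq_measure)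
        from this[of 0] this[of "1/y"] this[of "-(1/y)"]
        show "AE x in cauchy. (x \<in> ?L) = (x \<in> UNIV - {- (1 / y)..1 / y})"
        proof eventually_elim
          case (elim x)
          then have "inverse \<bar>x\<bar> \<le> y \<longleftrightarrow> 1 / y \<le> \<bar>x\<bar>" using 3 by (simp add: field_simps)
          with elim show ?case by auto
        qed
      qed auto
      also have "\<dots> = 1 - measure cauchy {- (1/y)..1/y}"
        by (metis cauchy.prob_compl atLeastAtMost_borel sets_cauchy space_cauchy)
      also have "\<dots> = 2 * arctan y / pi"
        using 3 measure_cauchy_interval[of "- (1/y)" "1/y"] arctan_inverse[of y]
        by (simp add: arctan_minus field_simps)
      also have "\<dots> = measure cauchy ?A"
      proof -
        have "?A = {-y..y}" by auto
        then show ?thesis using 3 measure_cauchy_interval[of "- y" y] by (simp add: arctan_minus)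
      qed
      finally show ?thesis using l r by simp
    qed
  qed
qed

lemma nn_integral_cauchy_exp_neg_ln:
  "(\<integral>\<^sup>+x. ennreal (exp (- (u * ln \<bar>x\<bar>))) \<partial>cauchy) = (\<integral>\<^sup>+x. ennreal (exp (u * ln \<bar>x\<bar>)) \<partial>cauchy)"
proof -
  have "(\<integral>\<^sup>+x. ennreal (exp (u * ln \<bar>x\<bar>)) \<partial>cauchy) = (\<integral>\<^sup>+x. ennreal (exp (u * ln x)) \<partial>distr cauchy borel abs)"
    by (subst nn_integral_distr) auto
  also have "\<dots> = (\<integral>\<^sup>+x. ennreal (exp (u * ln x)) \<partial>distr cauchy borel (\<lambda>x. inverse \<bar>x\<bar>))"
    by (simp only: distr_cauchy_inverse_abs)
  also have "\<dots> = (\<integral>\<^sup>+x. ennreal (exp (u * ln (inverse \<bar>x\<bar>))) \<partial>cauchy)"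
    by (subst nn_integral_distr) auto
  \<comment> \<open>With the defaults \<open>inverse 0 = 0\<close> and \<open>ln 0 = 0\<close> the
    rule for the logarithm of an inverse holds at 0 too.\<close>
  also have "\<dots> = (\<integral>\<^sup>+x. ennreal (exp (- (u * ln \<bar>x\<bar>))) \<partial>cauchy)"
    by (intro nn_integral_cong) (metis abs_ge_zero inverse_zero ln_0 ln_inverse minus_zero mult_minus_right mult_zero_right order_le_less)
  finally show ?thesis by simp
qed

text \<open>The majorant \<open>w\<close> decays like the integrand, with exponent
  \<open>3/2\<close>, but has an elementary antiderivative. It yields the bound
  \<open>8 / pi\<close>, which is below 3.\<close>

lemma nn_integral_cauchy_sqrt: "(\<integral>\<^sup>+x. ennreal (exp (1 / 2 * ln \<bar>x\<bar>)) \<partial>cauchy) \<le> 3"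
proof -
  define w :: "real \<Rightarrow> real" where "w x = (1 + \<bar>x\<bar>) powr (- (3 / 2))" for x
  have "(\<integral>\<^sup>+x. ennreal (w x) * indicator {0..} x \<partial>lborel) = ennreal (0 - - 2 * (1 + 0) powr (- (1 / 2)))"
  proof (rule nn_integral_FTC_atLeast[where F = "\<lambda>x. - 2 * (1 + x) powr (- (1 / 2))"])
    fix x :: real assume "0 \<le> x"
    then show "((\<lambda>x. - 2 * (1 + x) powr (- (1 / 2))) has_real_derivative w x) (at x)"
      by (auto intro!: derivative_eq_intros simp: w_def)
    show "0 \<le> w x" by (simp add: w_def)
  next
    show "((\<lambda>x::real. - 2 * (1 + x) powr (- (1 / 2))) \<longlongrightarrow> 0) at_top" by real_asymp
  qed (auto simp: w_def)
  then have "has_bochner_integral lborel (\<lambda>x. indicator {0..} x *\<^sub>R w x) 2"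
    by (intro has_bochner_integral_nn_integral)
      (auto simp: w_def ennreal_mult' ennreal_indicator mult.commute)
  then have w: "has_bochner_integral lborel w (2 *\<^sub>R 2)"
    by (rule has_bochner_integral_even_function) (simp add: w_def)
  have "(\<integral>\<^sup>+x. ennreal (exp (1 / 2 * ln \<bar>x\<bar>)) \<partial>cauchy)
      = (\<integral>\<^sup>+x. ennreal (1 / (pi * (1 + x\<^sup>2))) * ennreal (exp (1 / 2 * ln \<bar>x\<bar>)) \<partial>lborel)"
    unfolding cauchy_def by (subst nn_integral_density) auto
  also have "\<dots> \<le> (\<integral>\<^sup>+x. ennreal (2 / pi * w x) \<partial>lborel)"
  proof (intro nn_integral_mono)
    fix x :: real
    define y where "y = \<bar>x\<bar>"
    have y: "0 \<le> y" by (simp add: y_def)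
    have "exp (1 / 2 * ln y) * (1 + y) powr (3 / 2) \<le> 2 * (1 + y\<^sup>2)"
    \<comment> \<open>At 0 the expression \<open>exp (1 / 2 * ln y)\<close> is 1, not
      \<open>sqrt y\<close>, because \<open>ln 0 = 0\<close>.\<close>
    proof (cases "y = 0")
      case False
      then have "exp (1 / 2 * ln y) = sqrt y"
        using y by (simp add: powr_half_sqrt[symmetric] powr_def)
      moreover have "(1 + y) powr (3 / 2) = sqrt ((1 + y) ^ 3)"
      proof -
        have "(1 + y) powr (3 / 2) = ((1 + y) powr 3) powr (1 / 2)" by (simp add: powr_powr)
        moreover have "(1 + y) powr 3 = (1 + y) ^ 3" using y by simp
        ultimately show ?thesis using y powr_half_sqrt[of "(1 + y) ^ 3"] by simp
      qed
      moreover have "sqrt y * sqrt ((1 + y) ^ 3) \<le> 2 * (1 + y\<^sup>2)"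
      proof -
        have "y * (1 + y) \<le> 2 * (1 + y\<^sup>2)"
          using zero_le_power2[of "y - 1"] zero_le_power2[of y] y by (simp add: power2_eq_square algebra_simps)
        moreover have "(1 + y)\<^sup>2 \<le> 2 * (1 + y\<^sup>2)"
          using zero_le_power2[of "y - 1"] by (simp add: power2_eq_square algebra_simps)
        ultimately have "(y * (1 + y)) * (1 + y)\<^sup>2 \<le> (2 * (1 + y\<^sup>2)) * (2 * (1 + y\<^sup>2))"
          by (rule mult_mono) (use y in auto)
        then have "y * (1 + y) ^ 3 \<le> (2 * (1 + y\<^sup>2))\<^sup>2"
          by (simp add: power2_eq_square power3_eq_cube mult.assoc)
        then show ?thesis
          by (simp add: real_sqrt_mult[symmetric] real_le_lsqrt y)
      qed
      ultimately show ?thesis by simp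
    qed simp
    then have "exp (1 / 2 * ln y) \<le> 2 * (1 + y\<^sup>2) * w x"
      using y by (simp add: w_def powr_minus y_def[symmetric] field_simps)
    then have "1 / (pi * (1 + x\<^sup>2)) * exp (1 / 2 * ln y) \<le> 1 / (pi * (1 + x\<^sup>2)) * (2 * (1 + y\<^sup>2) * w x)"
      using cauchy_density_pos[of x] by (intro mult_left_mono) auto
    also have "\<dots> = 2 / pi * w x"
      using cauchy_density_pos[of x] by (simp add: y_def field_simps)
    finally show "ennreal (1 / (pi * (1 + x\<^sup>2))) * ennreal (exp (1 / 2 * ln \<bar>x\<bar>)) \<le> ennreal (2 / pi * w x)"
      using cauchy_density_pos[of x] by (simp add: ennreal_mult'[symmetric] less_imp_le y_def ennreal_leI)
  qed
  also have "\<dots> = ennreal (8 / pi)"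
    using has_bochner_integral_mult_right[where c = "2 / pi", OF w]
    by (subst nn_integral_eq_integral) (auto simp: has_bochner_integral_iff w_def)
  also have "\<dots> \<le> 3"
    using pi_gt3 by (intro order.trans[OF ennreal_leI[of "8 / pi" 3]]) (auto simp: field_simps)
  finally show ?thesis .
qed

text \<open>The power series are compared term by term: \<open>s ^ n \<le> s\<^sup>2\<close> for
  even \<open>n \<ge> 2\<close>, and the term \<open>n = 0\<close> contributes the 1. A single
  finite moment thus controls all smaller exponents with a quadratic bound.\<close>

lemma cosh_mult_le:
  fixes s u :: real
  assumes "\<bar>s\<bar> \<le> 1"
  shows "cosh (s * u) \<le> 1 + s\<^sup>2 * cosh u"
proof -
  define a where "a x n = (if even n then x ^ n /\<^sub>R fact n else 0)" for x :: real and n :: nat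
  have "a (s * u) sums cosh (s * u)" unfolding a_def by (rule cosh_converges)
  moreover have "(\<lambda>n. (if n = 0 then 1 else 0) + s\<^sup>2 * a u n) sums (1 + s\<^sup>2 * cosh u)"
    unfolding a_def by (intro sums_add sums_mult cosh_converges) (rule sums_single[where f = "\<lambda>_. 1"])
  moreover have "a (s * u) n \<le> (if n = 0 then 1 else 0) + s\<^sup>2 * a u n" for n
  proof (cases "n = 0 \<or> odd n")
    case False
    then obtain k where k: "n = 2 * Suc k" by (metis evenE not0_implies_Suc mult_0_right)
    have "(s\<^sup>2) ^ k \<le> 1" using assms by (intro power_le_one[of "s\<^sup>2"]) (simp_all add: abs_square_le_1)
    then have "s\<^sup>2 * (s\<^sup>2) ^ k * u ^ n \<le> s\<^sup>2 * 1 * u ^ n"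
      using zero_le_even_power[of n u] False by (intro mult_right_mono mult_left_mono) auto
    then have "(s * u) ^ n \<le> s\<^sup>2 * u ^ n"
    proof -
      have "s ^ n = s\<^sup>2 * (s\<^sup>2) ^ k" by (simp add: k flip: power_mult power_add)
      with \<open>s\<^sup>2 * (s\<^sup>2) ^ k * u ^ n \<le> s\<^sup>2 * 1 * u ^ n\<close> show ?thesis by (simp add: power_mult_distrib)
    qed
    then show ?thesis using False by (auto simp: a_def divide_inverse mult.commute intro: mult_left_mono)
  qed (auto simp: a_def)
  ultimately show ?thesis by (rule sums_le[rotated 1])
qed

text \<open>As \<open>ln \<bar>x\<bar>\<close> is symmetric, the exponential may be replaced by \<open>cosh\<close>, which removes the linear term in \<open>u\<close>.\<close>

lemma nn_integral_cauchy_exp_ln: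
  assumes "\<bar>u\<bar> \<le> 1 / 2"
  shows "(\<integral>\<^sup>+x. ennreal (exp (u * ln \<bar>x\<bar>)) \<partial>cauchy) \<le> ennreal (exp (12 * u\<^sup>2))"
proof -
  have [measurable]: "cosh \<in> borel_measurable (borel :: real measure)"
    by (intro borel_measurable_continuous_onI continuous_intros)
  define E where "E u = (\<integral>\<^sup>+x. ennreal (exp (u * ln \<bar>x\<bar>)) \<partial>cauchy)" for u
  have two: "E u + E u = (\<integral>\<^sup>+x. ennreal (2 * cosh (u * ln \<bar>x\<bar>)) \<partial>cauchy)" for u
  proof -
    have "E u + E u = (\<integral>\<^sup>+x. ennreal (exp (u * ln \<bar>x\<bar>)) + ennreal (exp (- (u * ln \<bar>x\<bar>))) \<partial>cauchy)"
      by (subst nn_integral_add) (auto simp: E_def nn_integral_cauchy_exp_neg_ln)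
    moreover have "2 * cosh z = exp z + exp (- z)" for z :: real by (simp add: cosh_field_def)
    ultimately show ?thesis by (simp add: ennreal_plus[symmetric] del: ennreal_plus)
  qed
  have "E u + E u \<le> (\<integral>\<^sup>+x. 2 + ennreal ((2 * u)\<^sup>2) * ennreal (2 * cosh (1 / 2 * ln \<bar>x\<bar>)) \<partial>cauchy)"
    unfolding two
  proof (intro nn_integral_mono)
    fix x :: real
    \<comment> \<open>The exponent \<open>1 / 2\<close> is the one whose moment is bounded by 3, and
      \<open>\<bar>2 * u\<bar> \<le> 1\<close> is the scaling factor. Twice the moment is then at
      most \<open>2 + (2 * u)\<^sup>2 * (3 + 3)\<close>, whence the constant 12.\<close>
    have "cosh (2 * u * (1 / 2 * ln \<bar>x\<bar>)) \<le> 1 + (2 * u)\<^sup>2 * cosh (1 / 2 * ln \<bar>x\<bar>)"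
      using assms by (intro cosh_mult_le) auto
    then have "ennreal (2 * cosh (u * ln \<bar>x\<bar>)) \<le> ennreal (2 + (2 * u)\<^sup>2 * (2 * cosh (1 / 2 * ln \<bar>x\<bar>)))"
      by (intro ennreal_leI) (simp add: mult.assoc)
    also have "\<dots> = 2 + ennreal ((2 * u)\<^sup>2) * ennreal (2 * cosh (1 / 2 * ln \<bar>x\<bar>))"
    proof -
      have enn: "ennreal (2 + a * b) = 2 + ennreal a * ennreal b" if "0 \<le> a" "0 \<le> b" for a b :: real
        using that by (simp add: ennreal_mult)
      show ?thesis by (intro enn) auto
    qed
    finally show "ennreal (2 * cosh (u * ln \<bar>x\<bar>)) \<le> 2 + ennreal ((2 * u)\<^sup>2) * ennreal (2 * cosh (1 / 2 * ln \<bar>x\<bar>))" .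
  qed
  also have "\<dots> = 2 + ennreal ((2 * u)\<^sup>2) * (E (1 / 2) + E (1 / 2))"
    unfolding two by (subst nn_integral_add) (auto simp: nn_integral_cmult cauchy.emeasure_space_1[simplified])
  also have "\<dots> \<le> 2 + ennreal ((2 * u)\<^sup>2) * (3 + 3)"
    using nn_integral_cauchy_sqrt unfolding E_def by (intro add_left_mono mult_left_mono add_mono) auto
  also have "\<dots> = ennreal (2 * (1 + 12 * u\<^sup>2))"
  proof -
    have "2 + ennreal ((2 * u)\<^sup>2) * (3 + 3) = ennreal 2 + ennreal ((2 * u)\<^sup>2) * ennreal 6" by simp
    also have "\<dots> = ennreal (2 + (2 * u)\<^sup>2 * 6)"
      by (subst ennreal_plus) (simp_all only: ennreal_mult'', simp_all)
    finally show ?thesis by (simp add: power_mult_distrib)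
  qed
  also have "\<dots> \<le> ennreal (2 * exp (12 * u\<^sup>2))"
    using exp_ge_add_one_self[of "12 * u\<^sup>2"] by (intro ennreal_leI mult_left_mono) auto
  finally have "2 * E u \<le> 2 * ennreal (exp (12 * u\<^sup>2))"
    unfolding mult_2[of "E u"] by (simp add: ennreal_mult')
  then show ?thesis
    using ennreal_mult_le_mult_iff[of 2 "E u" "ennreal (exp (12 * u\<^sup>2))"] by (simp add: E_def)
qed

section \<open>Exponential concentration of the geometric mean\<close>

context prob_space
begin

text \<open>Chernoff's method: Markov's inequality for the exponential, whose expectation factorises
  by independence. As \<open>u\<close> may be negative, both tails are covered.\<close>

lemma exp_markov_sum_ln_cauchy:
  assumes "finite I" and ind: "indep_vars (\<lambda>_. borel) Z I"
    and Z: "\<And>i. i \<in> I \<Longrightarrow> distr M borel (Z i) = cauchy" and u: "\<bar>u\<bar> \<le> 1 / 2"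
  shows "prob {\<omega> \<in> space M. a \<le> u * (\<Sum>i\<in>I. ln \<bar>Z i \<omega>\<bar>)} \<le> exp (12 * u\<^sup>2 * card I - a)"
proof -
  have rv [measurable]: "random_variable borel (Z i)" if "i \<in> I" for i
    using ind that by (auto simp: indep_vars_def)
  let ?S = "\<lambda>\<omega>. \<Sum>i\<in>I. ln \<bar>Z i \<omega>\<bar>"
  let ?A = "{\<omega> \<in> space M. a \<le> u * ?S \<omega>}" and ?g = "\<lambda>i \<omega>. ennreal (exp (u * ln \<bar>Z i \<omega>\<bar>))"
  have "emeasure M ?A = (\<integral>\<^sup>+\<omega>. indicator ?A \<omega> \<partial>M)"
    by (subst nn_integral_indicator) auto
  also have "\<dots> \<le> (\<integral>\<^sup>+\<omega>. ennreal (exp (- a)) * (\<Prod>i\<in>I. ?g i \<omega>) \<partial>M)"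
  proof (intro nn_integral_mono)
    fix \<omega>
    have "ennreal (exp (- a)) * (\<Prod>i\<in>I. ?g i \<omega>) = ennreal (exp (u * ?S \<omega> - a))"
      using \<open>finite I\<close> by (simp add: prod_ennreal exp_sum[symmetric] sum_distrib_left
          ennreal_mult'[symmetric] exp_add[symmetric])
    then show "indicator ?A \<omega> \<le> ennreal (exp (- a)) * (\<Prod>i\<in>I. ?g i \<omega>)"
      by (auto simp: indicator_def)
  qed
  also have "\<dots> = ennreal (exp (- a)) * (\<Prod>i\<in>I. \<integral>\<^sup>+\<omega>. ?g i \<omega> \<partial>M)"
    using \<open>finite I\<close> indep_vars_compose2[OF ind, of "\<lambda>_ x. ennreal (exp (u * ln \<bar>x\<bar>))" "\<lambda>_. borel"]
    by (subst nn_integral_cmult) (auto intro!: indep_vars_nn_integral arg_cong2[where f = times])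
  also have "\<dots> \<le> ennreal (exp (- a)) * (\<Prod>i\<in>I. ennreal (exp (12 * u\<^sup>2)))"
  proof (intro mult_left_mono prod_mono_ennreal)
    fix i assume i: "i \<in> I"
    have "(\<integral>\<^sup>+\<omega>. ?g i \<omega> \<partial>M) = (\<integral>\<^sup>+x. ennreal (exp (u * ln \<bar>x\<bar>)) \<partial>distr M borel (Z i))"
      using rv[OF i] by (subst nn_integral_distr) auto
    with nn_integral_cauchy_exp_ln[OF u] show "(\<integral>\<^sup>+\<omega>. ?g i \<omega> \<partial>M) \<le> ennreal (exp (12 * u\<^sup>2))"
      by (simp add: Z[OF i])
  qed auto
  also have "\<dots> = ennreal (exp (12 * u\<^sup>2 * card I - a))"
    by (simp add: ennreal_power ennreal_mult'[symmetric] exp_add[symmetric] exp_of_nat_mult[symmetric]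
        algebra_simps)
  finally show ?thesis by (simp add: emeasure_eq_measure)
qed

text \<open>Besides the mean of the logarithms, the first sample is controlled separately because
  the search for the root starts from it. Vanishing samples, where \<open>ln\<close> takes its
  default value, form a null set.\<close>

lemma cauchy_samples_tail:
  assumes ind: "indep_vars (\<lambda>_. borel) Z {..<N::nat}"
    and Z: "\<And>i. i < N \<Longrightarrow> distr M borel (Z i) = cauchy" and N: "0 < N" and e: "0 < e" "e \<le> 1"
  shows "prob {\<omega> \<in> space M. \<not> ((\<forall>i<N. Z i \<omega> \<noteq> 0) \<and> \<bar>\<Sum>i<N. ln \<bar>Z i \<omega>\<bar>\<bar> \<le> e * N \<and> \<bar>ln \<bar>Z 0 \<omega>\<bar>\<bar> \<le> t)}
    \<le> 2 * exp (- (e\<^sup>2 * N / 48)) + 2 * exp (3 - t / 2)"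
    (is "prob ?bad \<le> _")
proof -
  have rv [measurable]: "random_variable borel (Z i)" if "i < N" for i
    using ind that by (auto simp: indep_vars_def)
  have "prob {\<omega> \<in> space M. Z i \<omega> = 0} = 0" if "i < N" for i
  proof -
    have "prob {\<omega> \<in> space M. Z i \<omega> = 0} = measure (distr M borel (Z i)) {0}"
      using rv[OF that] by (subst measure_distr) (auto intro!: arg_cong[where f = prob])
    then show ?thesis using measure_cauchy_interval[of 0 0] by (simp add: Z that)
  qed
  then have "AE \<omega> in M. Z i \<omega> \<noteq> 0" if "i < N" for i
    using that rv[OF that] by (subst AE_iff_measurable[OF _ refl]) (auto simp: emeasure_eq_measure)
  then have nz: "AE \<omega> in M. \<forall>i<N. Z i \<omega> \<noteq> 0"
  proof -
    have "AE \<omega> in M. \<forall>i\<in>{..<N}. Z i \<omega> \<noteq> 0"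
      by (rule AE_finite_allI) (use \<open>\<And>i. i < N \<Longrightarrow> AE \<omega> in M. Z i \<omega> \<noteq> 0\<close> in auto)
    then show ?thesis by (simp only: lessThan_iff Ball_def)
  qed
  define B where "B u a I = {\<omega> \<in> space M. a \<le> u * (\<Sum>i\<in>I. ln \<bar>Z i \<omega>\<bar>)}" for u a :: real and I
  have B [measurable]: "B u a I \<in> events" if "I \<subseteq> {..<N}" for u a I
  proof -
    have "(\<lambda>\<omega>. \<Sum>i\<in>I. ln \<bar>Z i \<omega>\<bar>) \<in> borel_measurable M"
    proof (rule borel_measurable_sum)
      fix i assume "i \<in> I"
      then have [measurable]: "random_variable borel (Z i)" using rv that by auto
      show "(\<lambda>\<omega>. ln \<bar>Z i \<omega>\<bar>) \<in> borel_measurable M" by measurable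
    qed
    then show ?thesis unfolding B_def by measurable
  qed
  have ind0: "indep_vars (\<lambda>_. borel) Z {0}"
    using N by (intro indep_vars_subset[OF ind]) auto
  \<comment> \<open>For the mean, \<open>u = e / 24\<close> minimises
    \<open>12 * u\<^sup>2 - u * e\<close> and leaves the exponent
    \<open>- (e\<^sup>2 * N / 48)\<close>. For the first sample \<open>u = 1 / 2\<close> is the
    largest admissible value, and \<open>12 * u\<^sup>2 = 3\<close>.\<close>
  have "prob ?bad
      \<le> prob ((B (e / 24) (e\<^sup>2 * N / 24) {..<N} \<union> B (- (e / 24)) (e\<^sup>2 * N / 24) {..<N})
        \<union> (B (1 / 2) (t / 2) {0} \<union> B (- (1 / 2)) (t / 2) {0}))"
  proof (rule finite_measure_mono_AE)
    show "AE \<omega> in M. \<omega> \<in> ?bad \<longrightarrow>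
      \<omega> \<in> (B (e / 24) (e\<^sup>2 * N / 24) {..<N} \<union> B (- (e / 24)) (e\<^sup>2 * N / 24) {..<N})
        \<union> (B (1 / 2) (t / 2) {0} \<union> B (- (1 / 2)) (t / 2) {0})"
      using nz
    proof eventually_elim
      case (elim \<omega>)
      have "e\<^sup>2 * N / 24 \<le> e / 24 * s" if "e * N \<le> s" for s
        using mult_left_mono[OF that, of "e / 24"] e by (simp add: power2_eq_square)
      from this[of "\<Sum>i<N. ln \<bar>Z i \<omega>\<bar>"] this[of "- (\<Sum>i<N. ln \<bar>Z i \<omega>\<bar>)"]
      have "\<bar>\<Sum>i<N. ln \<bar>Z i \<omega>\<bar>\<bar> \<le> e * N \<or> e\<^sup>2 * N / 24 \<le> e / 24 * (\<Sum>i<N. ln \<bar>Z i \<omega>\<bar>)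
          \<or> e\<^sup>2 * N / 24 \<le> - (e / 24) * (\<Sum>i<N. ln \<bar>Z i \<omega>\<bar>)"
        unfolding minus_mult_commute by linarith
      moreover have "\<bar>ln \<bar>Z 0 \<omega>\<bar>\<bar> \<le> t \<or> t / 2 \<le> 1 / 2 * ln \<bar>Z 0 \<omega>\<bar> \<or> t / 2 \<le> - (1 / 2) * ln \<bar>Z 0 \<omega>\<bar>"
        by linarith
      ultimately show ?case using elim unfolding B_def by fastforce
    qed
  qed (use N in auto)
  also have "\<dots> \<le> (prob (B (e / 24) (e\<^sup>2 * N / 24) {..<N}) + prob (B (- (e / 24)) (e\<^sup>2 * N / 24) {..<N}))
     + (prob (B (1 / 2) (t / 2) {0}) + prob (B (- (1 / 2)) (t / 2) {0}))"
    using N by (intro order.trans[OF measure_Un_le] add_mono measure_Un_le) auto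
  also have "\<dots> \<le> (exp (- (e\<^sup>2 * N / 48)) + exp (- (e\<^sup>2 * N / 48))) + (exp (3 - t / 2) + exp (3 - t / 2))"
  proof (intro add_mono)
    have *: "prob (B u (e\<^sup>2 * N / 24) {..<N}) \<le> exp (- (e\<^sup>2 * N / 48))" if "u = e / 24 \<or> u = - (e / 24)" for u
    proof -
      have "prob (B u (e\<^sup>2 * N / 24) {..<N}) \<le> exp (12 * u\<^sup>2 * card {..<N} - e\<^sup>2 * N / 24)"
        unfolding B_def using that e Z by (intro exp_markov_sum_ln_cauchy ind) auto
      also have "12 * u\<^sup>2 * card {..<N} - e\<^sup>2 * N / 24 = - (e\<^sup>2 * N / 48)"
      proof -
        have "u\<^sup>2 = e\<^sup>2 / 576" using that by (auto simp: power2_eq_square)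
        then show ?thesis unfolding \<open>u\<^sup>2 = e\<^sup>2 / 576\<close> by simp
      qed
      finally show ?thesis .
    qed
    show "prob (B (e / 24) (e\<^sup>2 * N / 24) {..<N}) \<le> exp (- (e\<^sup>2 * N / 48))"
      "prob (B (- (e / 24)) (e\<^sup>2 * N / 24) {..<N}) \<le> exp (- (e\<^sup>2 * N / 48))"
      by (rule *; simp)+
    have *: "prob (B u (t / 2) {0}) \<le> exp (3 - t / 2)" if "u = 1 / 2 \<or> u = - (1 / 2)" for u
    proof -
      have "prob (B u (t / 2) {0}) \<le> exp (12 * u\<^sup>2 * card {0::nat} - t / 2)"
        unfolding B_def using that Z N by (intro exp_markov_sum_ln_cauchy ind0) auto
      also have "12 * u\<^sup>2 * card {0::nat} - t / 2 = 3 - t / 2"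
      proof -
        have "u\<^sup>2 = 1 / 4" using that by (elim disjE; hypsubst; simp add: power2_eq_square)
        then show ?thesis by simp
      qed
      finally show ?thesis .
    qed
    show "prob (B (1 / 2) (t / 2) {0}) \<le> exp (3 - t / 2)" "prob (B (- (1 / 2)) (t / 2) {0}) \<le> exp (3 - t / 2)"
      by (rule *; simp)+
  qed
  finally show ?thesis by simp
qed

end

section \<open>Markov's inequality in mean\<close>

lemma sum_cis_roots:
  assumes "\<bar>l\<bar> < int M"
  shows "(\<Sum>r<M. cis (of_int l * (2 * pi * real r / M))) = (if l = 0 then of_nat M else 0)"
proof (cases "l = 0")
  case False
  define z where "z = cis (of_int l * (2 * pi / M))"
  have M: "0 < M" using assms by auto
  have pow: "cis (of_int l * (2 * pi * real r / M)) = z ^ r" for r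
    by (simp add: z_def Complex.DeMoivre mult_ac)
  have "z \<noteq> 1"
  proof
    assume "z = 1"
    then obtain k :: int where "of_int l * (2 * pi / M) = of_int k * (2 * pi)"
      unfolding z_def cis_eq_1_iff by auto
    then have "real_of_int l = real_of_int (k * int M)"
      using M by (simp add: field_simps)
    then have "l = k * int M" by (simp only: of_int_eq_iff)
    with False assms show False
      by (metis abs_mult abs_of_nat linorder_not_less mult_cancel_right1 mult_le_cancel_right1
          mult_zero_left of_nat_less_0_iff zero_less_abs_iff int_one_le_iff_zero_less)
  qed
  moreover have "z ^ M = 1"
    using M by (simp add: z_def Complex.DeMoivre cis_eq_1_iff mult_ac)
  ultimately show ?thesis using False by (simp only: pow sum_gp_strict) simp
qed simp

text \<open>Why \<open>3 * n\<close> nodes: the kernel has frequencies below \<open>n\<close> in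
  modulus and is tested against frequencies up to \<open>2 * n\<close>, so every frequency that
  occurs is below \<open>3 * n\<close> and none is aliased to 0.\<close>

abbreviation fejer_node :: "nat \<Rightarrow> nat \<Rightarrow> real" where
  "fejer_node n r \<equiv> 2 * pi * real r / (3 * real n)"

text \<open>By orthogonality only the pairs with \<open>j = l + i\<close> survive, and there are
  \<open>n - \<bar>l\<bar>\<close> of them. These are the triangular Fourier coefficients of the
  Fejer kernel; \<open>nat\<close> cuts them off at 0 for \<open>\<bar>l\<bar> > n\<close>.\<close>

lemma sum_cis_diff:
  assumes "\<bar>l\<bar> \<le> 2 * int n"
  shows "(\<Sum>r<3 * n. cis (of_int l * (fejer_node n r)) *
      (\<Sum>i<n. \<Sum>j<n. cis (of_int (int i - int j) * (fejer_node n r))))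
    = of_nat (3 * n) * of_nat (nat (int n - \<bar>l\<bar>))"
proof -
  have "(\<Sum>r<3 * n. cis (of_int l * (fejer_node n r)) *
      (\<Sum>i<n. \<Sum>j<n. cis (of_int (int i - int j) * (fejer_node n r))))
    = (\<Sum>r<3 * n. \<Sum>i<n. \<Sum>j<n. cis (of_int (l + int i - int j) * (fejer_node n r)))"
    by (simp add: sum_distrib_left cis_mult algebra_simps add_divide_distrib diff_divide_distrib)
  also have "\<dots> = (\<Sum>i<n. \<Sum>j<n. \<Sum>r<3 * n. cis (of_int (l + int i - int j) * (fejer_node n r)))"
    by (rule trans[OF sum.swap]) (intro sum.cong refl sum.swap)
  also have "\<dots> = (\<Sum>i<n. \<Sum>j<n. if l + int i - int j = 0 then of_nat (3 * n) else 0)"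
  proof (intro sum.cong refl)
    fix i j assume "i \<in> {..<n}" "j \<in> {..<n}"
    then show "(\<Sum>r<3 * n. cis (of_int (l + int i - int j) * (fejer_node n r)))
        = (if l + int i - int j = 0 then of_nat (3 * n) else 0)"
      using sum_cis_roots[of "l + int i - int j" "3 * n"] assms by simp
  qed
  also have "\<dots> = of_nat (3 * n) * (\<Sum>i<n. \<Sum>j<n. if int j = l + int i then 1 else 0)"
    by (simp add: sum_distrib_left if_distrib[where f = "(*) _"] eq_diff_eq algebra_simps cong: if_cong)
      (intro sum.cong refl if_cong; auto)
  also have "(\<Sum>i<n. \<Sum>j<n. if int j = l + int i then 1 else 0 :: complex)
      = (\<Sum>i<n. if i \<in> {nat (- l)..<nat (int n - l)} then 1 else 0)"
  proof (intro sum.cong refl)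
    fix i assume "i \<in> {..<n}"
    have "(\<Sum>j<n. if int j = l + int i then 1 else 0 :: complex) = (\<Sum>j<n. if j = nat (l + int i) \<and> 0 \<le> l + int i then 1 else 0)"
      by (intro sum.cong refl if_cong) auto
    also have "\<dots> = (if nat (l + int i) < n \<and> 0 \<le> l + int i then 1 else 0)"
      by (cases "0 \<le> l + int i") auto
    also have "\<dots> = (if i \<in> {nat (- l)..<nat (int n - l)} then 1 else 0)"
      by (intro if_cong) auto
    finally show "(\<Sum>j<n. if int j = l + int i then 1 else 0 :: complex) = (if i \<in> {nat (- l)..<nat (int n - l)} then 1 else 0)" .
  qed
  also have "\<dots> = of_nat (card ({..<n} \<inter> {nat (- l)..<nat (int n - l)}))"
    by (subst sum.inter_restrict[symmetric]) auto
  also have "{..<n} \<inter> {nat (- l)..<nat (int n - l)} = {nat (- l)..<min n (nat (int n - l))}" by auto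
  also have "card {nat (- l)..<min n (nat (int n - l))} = nat (int n - \<bar>l\<bar>)"
    by (auto simp: min_def abs_if)
  finally show ?thesis .
qed

text \<open>The Fejer kernel without its usual factor \<open>1 / n\<close>. As a squared modulus it
  is nonnegative by construction; the Fourier side is \<open>fejer_eq\<close>.\<close>

definition fejer :: "nat \<Rightarrow> real \<Rightarrow> real" where
  "fejer n t = (cmod (\<Sum>i<n. cis (real i * t)))\<^sup>2"

lemma fejer_eq: "of_real (fejer n t) = (\<Sum>i<n. \<Sum>j<n. cis (of_int (int i - int j) * t))"
  unfolding fejer_def complex_norm_square cnj_sum sum_product
  by (intro sum.cong refl) (simp add: cis_cnj cis_mult algebra_simps)

lemma sum_fejer:
  assumes "0 < n"
  shows "(\<Sum>r<3 * n. fejer n (fejer_node n r)) = 3 * real n * real n"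
proof -
  have "complex_of_real (\<Sum>r<3 * n. fejer n (fejer_node n r)) = complex_of_real (3 * real n * real n)"
    using sum_cis_diff[of 0 n] by (simp add: fejer_eq)
  then show ?thesis by (simp only: of_real_eq_iff)
qed

text \<open>A discrete form of Riesz' interpolation formula: the derivative of a trigonometric polynomial is a combination of
  its translates, with weights of total modulus at most \<open>2 * n\<close> because the Fejer kernel is nonnegative.\<close>

lemma fejer_derivative_cis:
  assumes "\<bar>k\<bar> \<le> int n" "0 < n"
  shows "(\<Sum>r<3 * n. of_real (2 / (3 * real n) * sin (n * (fejer_node n r)) * fejer n (fejer_node n r))
      * cis (of_int k * (\<theta> + fejer_node n r))) = of_int k * \<i> * cis (of_int k * \<theta>)"
proof -
  define \<tau> where "\<tau> r = fejer_node n r" for r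
  define G where "G l = (\<Sum>r<3 * n. cis (of_int l * \<tau> r) * of_real (fejer n (\<tau> r)))" for l
  have G: "G l = of_nat (3 * n) * of_nat (nat (int n - \<bar>l\<bar>))" if "\<bar>l\<bar> \<le> 2 * int n" for l
    using sum_cis_diff[OF that] by (simp add: G_def fejer_eq \<tau>_def)
  have s: "of_real (2 * sin x) = - \<i> * (cis x - cis (- x))" for x
    by (simp add: complex_eq_iff)
  have "(\<Sum>r<3 * n. of_real (2 / (3 * real n) * sin (n * \<tau> r) * fejer n (\<tau> r)) * cis (of_int k * (\<theta> + \<tau> r)))
     = (\<Sum>r<3 * n. - \<i> / (3 * n) * cis (of_int k * \<theta>) * (cis (of_int (k + int n) * \<tau> r) * of_real (fejer n (\<tau> r))
         - cis (of_int (k - int n) * \<tau> r) * of_real (fejer n (\<tau> r))))"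
  proof (intro sum.cong refl)
    fix r
    have "of_real (2 / (3 * real n) * sin (n * \<tau> r) * fejer n (\<tau> r)) * cis (of_int k * (\<theta> + \<tau> r))
       = of_real (2 * sin (n * \<tau> r)) * (cis (of_int k * \<theta>) * cis (of_int k * \<tau> r)) * of_real (fejer n (\<tau> r)) / (3 * n)"
      by (simp add: cis_mult distrib_left)
    also have "\<dots> = - \<i> / (3 * n) * cis (of_int k * \<theta>) * ((cis (n * \<tau> r) * cis (of_int k * \<tau> r)) * of_real (fejer n (\<tau> r))
        - (cis (- (n * \<tau> r)) * cis (of_int k * \<tau> r)) * of_real (fejer n (\<tau> r)))"
      unfolding s by (simp add: algebra_simps add_divide_distrib diff_divide_distrib)
    finally show "of_real (2 / (3 * real n) * sin (n * \<tau> r) * fejer n (\<tau> r)) * cis (of_int k * (\<theta> + \<tau> r))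
       = - \<i> / (3 * n) * cis (of_int k * \<theta>) * (cis (of_int (k + int n) * \<tau> r) * of_real (fejer n (\<tau> r))
         - cis (of_int (k - int n) * \<tau> r) * of_real (fejer n (\<tau> r)))"
      by (simp add: cis_mult algebra_simps)
  qed
  also have "\<dots> = - \<i> / (3 * n) * cis (of_int k * \<theta>) * (G (k + int n) - G (k - int n))"
    by (simp only: sum_distrib_left[symmetric] sum_subtractf G_def)
  also have "\<dots> = of_int k * \<i> * cis (of_int k * \<theta>)"
  proof -
    \<comment> \<open>Multiplication by the sine shifts the frequency by \<open>n\<close> both ways.
      For \<open>\<bar>k\<bar> \<le> n\<close> the triangle has at these two places the negative and
      the positive part of \<open>k\<close>, so that the difference is linear in \<open>k\<close>,
      as a derivative requires.\<close>
    have "G (k + int n) = of_nat (3 * n) * of_nat (nat (- k))" "G (k - int n) = of_nat (3 * n) * of_nat (nat k)"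
    proof -
      have "int n - \<bar>k + int n\<bar> = - k" "int n - \<bar>k - int n\<bar> = k" using assms by auto
      then show "G (k + int n) = of_nat (3 * n) * of_nat (nat (- k))" "G (k - int n) = of_nat (3 * n) * of_nat (nat k)"
        using assms by (simp_all only: G)
    qed
    moreover have "of_nat (nat (- k)) - of_nat (nat k) = (- of_int k :: complex)"
      by (cases "0 \<le> k") auto
    ultimately have "G (k + int n) - G (k - int n) = of_nat (3 * n) * (- of_int k)"
      by (metis right_diff_distrib)
    with \<open>0 < n\<close> show ?thesis by simp
  qed
  finally show ?thesis unfolding \<tau>_def .
qed

text \<open>By the binomial theorem \<open>p (cos \<theta>)\<close> is a combination of exponentials
  with frequencies \<open>2 * i - j\<close>, at most \<open>n\<close> in modulus, and
  \<open>fejer_derivative_cis\<close> applies to each of them. The left side is the derivative by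
  the chain rule, the right side the derivative taken term by term.\<close>

lemma poly_cos_derivative_eq:
  fixes p :: "real poly"
  assumes "degree p \<le> n" "0 < n"
  shows "- sin \<theta> * poly (pderiv p) (cos \<theta>) =
    (\<Sum>r<3 * n. 2 / (3 * real n) * sin (n * (fejer_node n r)) * fejer n (fejer_node n r)
      * poly p (cos (\<theta> + fejer_node n r)))"
proof -
  define w where "w r = 2 / (3 * real n) * sin (n * (fejer_node n r)) * fejer n (fejer_node n r)" for r
  define \<tau> where "\<tau> r = fejer_node n r" for r
  define c where "c j i = complex_of_real (coeff p j / 2 ^ j * (j choose i))" for j i
  define k where "k j i = 2 * int i - int j" for j i :: nat
  define T where "T \<theta> = (\<Sum>j\<le>n. \<Sum>i\<le>j. c j i * cis (of_int (k j i) * \<theta>))" for \<theta>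
  have T: "T \<theta> = of_real (poly p (cos \<theta>))" for \<theta>
  proof -
    have "of_real (cos \<theta> ^ j) = (\<Sum>i\<le>j. of_real ((j choose i) / 2 ^ j) * cis (of_int (k j i) * \<theta>))" for j
    proof -
      have "complex_of_real (cos \<theta> ^ j) = (cis \<theta> + cis (- \<theta>)) ^ j / 2 ^ j"
      proof -
        have "complex_of_real (cos \<theta>) = (cis \<theta> + cis (- \<theta>)) / 2"
          by (simp add: complex_eq_iff)
        then show ?thesis by (simp only: of_real_power power_divide)
      qed
      also have "\<dots> = (\<Sum>i\<le>j. of_nat (j choose i) * cis \<theta> ^ i * cis (- \<theta>) ^ (j - i)) / 2 ^ j"
        by (simp only: binomial_ring)
      also have "\<dots> = (\<Sum>i\<le>j. of_real ((j choose i) / 2 ^ j) * cis (of_int (k j i) * \<theta>))"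
        unfolding sum_divide_distrib
        by (intro sum.cong refl) (simp add: Complex.DeMoivre cis_mult k_def of_nat_diff algebra_simps)
      finally show ?thesis .
    qed
    then have "of_real (coeff p j * cos \<theta> ^ j) = (\<Sum>i\<le>j. c j i * cis (of_int (k j i) * \<theta>))" for j
      unfolding of_real_mult by (simp add: c_def sum_distrib_left mult.assoc)
    moreover have "poly p (cos \<theta>) = (\<Sum>j\<le>n. coeff p j * cos \<theta> ^ j)"
      using assms unfolding poly_altdef by (intro sum.mono_neutral_left) (auto simp: coeff_eq_0)
    ultimately show ?thesis by (simp add: T_def)
  qed
  define T' where "T' \<theta> = (\<Sum>j\<le>n. \<Sum>i\<le>j. c j i * (of_int (k j i) * \<i> * cis (of_int (k j i) * \<theta>)))" for \<theta>
  have "((\<lambda>x. cis (of_int l * x)) has_vector_derivative of_int l * \<i> * cis (of_int l * \<theta>)) (at \<theta>)" for l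
  proof -
    have "((\<lambda>z. exp (\<i> * of_int l * z)) has_field_derivative of_int l * \<i> * exp (\<i> * of_int l * of_real \<theta>)) (at (of_real \<theta>))"
      by (auto intro!: derivative_eq_intros)
    from has_vector_derivative_real_field[OF this] show ?thesis by (simp add: cis_conv_exp mult.assoc)
  qed
  then have "(T has_vector_derivative T' \<theta>) (at \<theta>)"
    unfolding T_def T'_def
    by (intro has_vector_derivative_sum has_vector_derivative_mult_right)
  moreover have "(T has_vector_derivative of_real (- sin \<theta> * poly (pderiv p) (cos \<theta>))) (at \<theta>)"
    unfolding T
    by (intro has_vector_derivative_of_real)
      (auto intro!: derivative_eq_intros simp flip: has_real_derivative_iff_has_vector_derivative)
  ultimately have "of_real (- sin \<theta> * poly (pderiv p) (cos \<theta>)) = T' \<theta>"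
    using vector_derivative_unique_at by blast
  also have "T' \<theta> = (\<Sum>j\<le>n. \<Sum>i\<le>j. c j i * (\<Sum>r<3 * n. of_real (w r) * cis (of_int (k j i) * (\<theta> + \<tau> r))))"
    unfolding T'_def w_def \<tau>_def using assms
    by (intro sum.cong refl arg_cong2[where f = times] fejer_derivative_cis[symmetric]) (auto simp: k_def)
  also have "\<dots> = (\<Sum>r<3 * n. of_real (w r) * T (\<theta> + \<tau> r))"
  proof -
    have "(\<Sum>j\<le>n. \<Sum>i\<le>j. c j i * (\<Sum>r<3 * n. of_real (w r) * cis (of_int (k j i) * (\<theta> + \<tau> r))))
        = (\<Sum>j\<le>n. \<Sum>i\<le>j. \<Sum>r<3 * n. of_real (w r) * (c j i * cis (of_int (k j i) * (\<theta> + \<tau> r))))"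
      by (simp add: sum_distrib_left mult_ac)
    also have "\<dots> = (\<Sum>j\<le>n. \<Sum>r<3 * n. \<Sum>i\<le>j. of_real (w r) * (c j i * cis (of_int (k j i) * (\<theta> + \<tau> r))))"
      by (intro sum.cong refl sum.swap)
    also have "\<dots> = (\<Sum>r<3 * n. \<Sum>j\<le>n. \<Sum>i\<le>j. of_real (w r) * (c j i * cis (of_int (k j i) * (\<theta> + \<tau> r))))"
      by (rule sum.swap)
    finally show ?thesis by (simp add: T_def sum_distrib_left)
  qed
  also have "\<dots> = of_real (\<Sum>r<3 * n. w r * poly p (cos (\<theta> + \<tau> r)))"
    by (simp add: T)
  finally show ?thesis unfolding of_real_eq_iff w_def \<tau>_def .
qed

section \<open>Bernstein's and Markov's inequalities in mean\<close>

lemma integral_periodic_shift: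
  fixes g :: "real \<Rightarrow> real"
  assumes cont: "continuous_on UNIV g" and per: "\<And>x. g (x + a) = g x" and t: "0 \<le> t" "t \<le> a"
  shows "integral {0..a} (\<lambda>x. g (x + t)) = integral {0..a} g"
proof -
  have int: "g integrable_on {u..v}" for u v
    by (rule integrable_continuous_real) (rule continuous_on_subset[OF cont], simp)
  have "integral {0..a} (\<lambda>x. g (x + t)) = integral {t..a + t} g"
    using integral_shift_real_ivl[of t t "a + t" g] by simp
  also have "\<dots> = integral {t..a} g + integral {a..a + t} g"
    using t by (intro Henstock_Kurzweil_Integration.integral_combine[symmetric] int) auto
  also have "integral {a..a + t} g = integral {0..t} g"
    using integral_shift_real_ivl[of a a "a + t" g] by (simp add: per)
  also have "integral {t..a} g + integral {0..t} g = integral {0..a} g"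
    using Henstock_Kurzweil_Integration.integral_combine[of 0 t a g] t int by simp
  finally show ?thesis .
qed

text \<open>All translates have the same integral over a period, so the constant is the total weight
  of the interpolation formula with the sine bounded by 1: \<open>2 / (3 * n)\<close> times
  \<open>3 * n * n\<close>.\<close>

lemma bernstein_L1_cos:
  fixes p :: "real poly"
  assumes "degree p \<le> n" "0 < n"
  shows "integral {0..2 * pi} (\<lambda>\<theta>. \<bar>sin \<theta> * poly (pderiv p) (cos \<theta>)\<bar>)
    \<le> 2 * n * integral {0..2 * pi} (\<lambda>\<theta>. \<bar>poly p (cos \<theta>)\<bar>)"
proof -
  define \<tau> where "\<tau> r = fejer_node n r" for r
  let ?T = "\<lambda>\<theta>. \<bar>poly p (cos \<theta>)\<bar>"
  let ?W = "\<lambda>r \<theta>. 2 / (3 * real n) * fejer n (\<tau> r) * ?T (\<theta> + \<tau> r)"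
  let ?U = "\<lambda>r \<theta>. 2 / (3 * real n) * sin (n * \<tau> r) * fejer n (\<tau> r) * poly p (cos (\<theta> + \<tau> r))"
  have F: "0 \<le> fejer n t" for t by (simp add: fejer_def)
  have int: "(\<lambda>\<theta>. ?T (\<theta> + t)) integrable_on {0..2 * pi}" for t
    by (intro integrable_continuous_real continuous_intros)
  have "integral {0..2 * pi} (\<lambda>\<theta>. \<bar>sin \<theta> * poly (pderiv p) (cos \<theta>)\<bar>)
    \<le> integral {0..2 * pi} (\<lambda>\<theta>. \<Sum>r<3 * n. ?W r \<theta>)"
  proof (rule integral_le)
    fix \<theta>
    have "\<bar>sin \<theta> * poly (pderiv p) (cos \<theta>)\<bar> = \<bar>- sin \<theta> * poly (pderiv p) (cos \<theta>)\<bar>" by simp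
    also have "\<dots> \<le> (\<Sum>r<3 * n. \<bar>?U r \<theta>\<bar>)"
      unfolding poly_cos_derivative_eq[OF assms] \<tau>_def by (rule sum_abs)
    also have "\<dots> \<le> (\<Sum>r<3 * n. ?W r \<theta>)"
    proof (intro sum_mono)
      fix r
      have "\<bar>?U r \<theta>\<bar>
          = \<bar>sin (n * \<tau> r)\<bar> * (?W r \<theta>)"
        using F by (simp add: abs_mult)
      also have "\<dots> \<le> 1 * (?W r \<theta>)"
        using F by (intro mult_right_mono) auto
      finally show "\<bar>?U r \<theta>\<bar>
          \<le> ?W r \<theta>" by simp
    qed
    finally show "\<bar>sin \<theta> * poly (pderiv p) (cos \<theta>)\<bar> \<le> (\<Sum>r<3 * n. ?W r \<theta>)" .
  qed (intro integrable_continuous_real continuous_intros)+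
  also have "\<dots> = (\<Sum>r<3 * n. 2 / (3 * real n) * fejer n (\<tau> r) * integral {0..2 * pi} (\<lambda>\<theta>. ?T (\<theta> + \<tau> r)))"
    by (subst integral_sum) (auto intro!: integrable_continuous_real continuous_intros)
  also have "\<dots> = (\<Sum>r<3 * n. 2 / (3 * real n) * fejer n (\<tau> r) * integral {0..2 * pi} ?T)"
  proof (intro sum.cong refl arg_cong2[where f = times] integral_periodic_shift[where g = ?T])
    fix r assume "r \<in> {..<3 * n}"
    then have "real r \<le> 3 * real n" by simp
    then show "0 \<le> \<tau> r" "\<tau> r \<le> 2 * pi" using \<open>0 < n\<close> by (simp_all add: \<tau>_def field_simps)
  qed (auto intro!: continuous_intros)
  also have "\<dots> = 2 / (3 * real n) * (\<Sum>r<3 * n. fejer n (\<tau> r)) * integral {0..2 * pi} ?T"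
    by (simp add: sum_distrib_left sum_distrib_right)
  also have "(\<Sum>r<3 * n. fejer n (\<tau> r)) = 3 * real n * real n"
    unfolding \<tau>_def by (rule sum_fejer[OF \<open>0 < n\<close>])
  finally show ?thesis using \<open>0 < n\<close> by simp
qed

text \<open>Sine and cosine are separate arguments of \<open>g\<close> so that the symmetry under
  reflection of the angle becomes evenness in the first argument.\<close>

lemma integral_cos_symmetric:
  fixes g :: "real \<Rightarrow> real \<Rightarrow> real"
  assumes "continuous_on UNIV (\<lambda>\<theta>. g (sin \<theta>) (cos \<theta>))" "\<And>s c. g (- s) c = g s c"
  shows "integral {0..2 * pi} (\<lambda>\<theta>. g (sin \<theta>) (cos \<theta>)) = 2 * integral {0..pi} (\<lambda>\<theta>. g (sin \<theta>) (cos \<theta>))"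
proof -
  let ?h = "\<lambda>\<theta>. g (sin \<theta>) (cos \<theta>)"
  have int: "?h integrable_on {u..v}" for u v
    by (rule integrable_continuous_real) (rule continuous_on_subset[OF assms(1)], simp)
  have "integral {pi..2 * pi} ?h = integral {- (2 * pi)..- pi} (\<lambda>\<theta>. ?h (- \<theta>))"
    by (rule Henstock_Kurzweil_Integration.integral_reflect_real[symmetric])
  also have "\<dots> = integral {- (2 * pi)..- pi} ?h"
    by (simp add: assms(2))
  also have "\<dots> = integral {0..pi} ?h"
    using integral_shift_real_ivl[of 0 "2 * pi" pi ?h] integral_shift_real_ivl[of "2 * pi" "0" "pi" ?h]
    by simp
  finally show ?thesis
    using Henstock_Kurzweil_Integration.integral_combine[of 0 pi "2 * pi" ?h] int by simp
qed

lemma integral_sin_cos_substitution: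
  fixes g :: "real \<Rightarrow> real"
  assumes "continuous_on UNIV g"
  shows "integral {0..pi} (\<lambda>\<theta>. sin \<theta> * g (cos \<theta>)) = integral {-1..1} g"
proof -
  \<comment> \<open>The substitution is made with \<open>- cos\<close>, which increases from -1 to
    1; the reflection undoes the sign.\<close>
  have "((\<lambda>\<theta>. sin \<theta> *\<^sub>R (\<lambda>x. g (- x)) (- cos \<theta>)) has_integral (integral {- cos 0..- cos pi} (\<lambda>x. g (- x)))) {0..pi}"
    by (rule has_integral_substitution[where c = "-1" and d = 1])
      (auto intro!: derivative_eq_intros continuous_on_compose2[OF assms] continuous_intros)
  then show ?thesis
    using Henstock_Kurzweil_Integration.integral_reflect_real[of 1 "-1" g] by (simp add: integral_unique)
qed

text \<open>Bernstein's inequality bounds the variation of the polynomial in the angular variable. It also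
  shows that a fixed fraction of the angular mass lies at distance at least $1/(8n)$ from the end
  points, where the Jacobian $\sin\theta$ is bounded below by a multiple of $1/n$.\<close>

lemma markov_L1:
  fixes p :: "real poly"
  assumes "degree p \<le> n" "0 < n"
  shows "integral {-1..1} (\<lambda>x. \<bar>poly (pderiv p) x\<bar>) \<le> 192 * n\<^sup>2 * integral {-1..1} (\<lambda>x. \<bar>poly p x\<bar>)"
proof -
  let ?T = "\<lambda>\<theta>. \<bar>poly p (cos \<theta>)\<bar>" and ?D = "\<lambda>\<theta>. \<bar>sin \<theta> * poly (pderiv p) (cos \<theta>)\<bar>"
  define A where "A = integral {0..pi} ?T"
  define V where "V = integral {0..pi} ?D"
  \<comment> \<open>With \<open>V \<le> 2 * n * A\<close> this width makes
    \<open>\<beta> * V \<le> A / 4\<close>, so that the two edge strips together lose at most half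
    of \<open>A\<close>.\<close>
  define \<beta> where "\<beta> = 1 / (8 * real n)"
  have n: "1 \<le> real n" using assms by simp
  have \<beta>: "0 < \<beta>" "\<beta> \<le> 1 / 8" using n by (auto simp: \<beta>_def field_simps)
  have intT: "?T integrable_on {u..v}" and intD: "?D integrable_on {u..v}" for u v
    by (intro integrable_continuous_real continuous_intros)+
  have V: "V = integral {-1..1} (\<lambda>x. \<bar>poly (pderiv p) x\<bar>)"
    unfolding V_def integral_sin_cos_substitution[of "\<lambda>x. \<bar>poly (pderiv p) x\<bar>", symmetric, OF continuous_on_rabs[OF continuous_on_poly[OF continuous_on_id]]]
    by (intro integral_cong) (auto simp: abs_mult sin_ge_zero)
  have VA: "V \<le> 2 * n * A"
    using bernstein_L1_cos[OF assms] integral_cos_symmetric[of "\<lambda>s c. \<bar>poly p c\<bar>"]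
      integral_cos_symmetric[of "\<lambda>s c. \<bar>s * poly (pderiv p) c\<bar>"]
    by (simp add: A_def V_def continuous_intros)
  have var: "?T u \<le> ?T v + V" if "u \<in> {0..pi}" "v \<in> {0..pi}" for u v
  proof -
    have *: "\<bar>poly p (cos b) - poly p (cos a)\<bar> \<le> V" if "0 \<le> a" "a \<le> b" "b \<le> pi" for a b
    proof -
      have "((\<lambda>\<theta>. - (sin \<theta> * poly (pderiv p) (cos \<theta>))) has_integral poly p (cos b) - poly p (cos a)) {a..b}"
        using that by (intro fundamental_theorem_of_calculus)
          (auto intro!: derivative_eq_intros simp flip: has_real_derivative_iff_has_vector_derivative)
      then have "\<bar>poly p (cos b) - poly p (cos a)\<bar> = \<bar>integral {a..b} (\<lambda>\<theta>. - (sin \<theta> * poly (pderiv p) (cos \<theta>)))\<bar>"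
        by (simp only: integral_unique)
      also have "\<dots> \<le> integral {a..b} ?D"
        using integral_norm_bound_integral[of "\<lambda>\<theta>. - (sin \<theta> * poly (pderiv p) (cos \<theta>))" "{a..b}" ?D]
        by (simp add: integrable_continuous_real continuous_intros)
      also have "\<dots> \<le> V" unfolding V_def
        using that by (intro integral_subset_le intD) auto
      finally show ?thesis .
    qed
    show ?thesis
      using *[of u v] *[of v u] that by (cases "u \<le> v") auto
  qed
  let ?mid = "integral {\<beta>..pi - \<beta>} ?T" and ?I = "integral {-1..1} (\<lambda>x. \<bar>poly p x\<bar>)"
  \<comment> \<open>An edge strip is translated by \<open>c\<close> into the middle part. Pointwise
    this changes the integrand by at most the total variation \<open>V\<close>.\<close>
  have edge: "integral {u..u + \<beta>} ?T \<le> ?mid + A / 4"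
    if "0 \<le> u" "u + \<beta> \<le> pi" "\<beta> \<le> u + c" "u + c + \<beta> \<le> pi - \<beta>" for u c
  proof -
    have "integral {u..u + \<beta>} ?T \<le> integral {u..u + \<beta>} (\<lambda>\<theta>. ?T (\<theta> + c) + V)"
      using that \<beta> by (intro integral_le intT var) (auto intro!: integrable_continuous_real continuous_intros)
    also have "\<dots> = integral {u..u + \<beta>} (\<lambda>\<theta>. ?T (\<theta> + c)) + \<beta> * V"
      using \<beta> by (subst integral_add) (auto intro!: integrable_continuous_real continuous_intros)
    also have "integral {u..u + \<beta>} (\<lambda>\<theta>. ?T (\<theta> + c)) = integral {u + c..u + c + \<beta>} ?T"
      using integral_shift_real_ivl[of "u + c" c "u + c + \<beta>" ?T] by (simp add: algebra_simps)
    also have "\<dots> \<le> ?mid"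
      using that by (intro integral_subset_le intT) auto
    also have "\<beta> * V \<le> A / 4"
      using mult_left_mono[OF VA, of \<beta>] \<beta> n by (simp add: \<beta>_def)
    finally show ?thesis by simp
  qed
  have "A = integral {0..\<beta>} ?T + ?mid + integral {pi - \<beta>..pi} ?T"
    unfolding A_def using Henstock_Kurzweil_Integration.integral_combine[of 0 \<beta> pi ?T] Henstock_Kurzweil_Integration.integral_combine[of \<beta> "pi - \<beta>" "pi" ?T] \<beta> pi_gt3 intT
    by simp
  \<comment> \<open>The left strip moves right by \<open>\<beta>\<close>, the right strip moves left
    by \<open>\<beta>\<close>; each is bounded by the whole middle integral plus
    \<open>A / 4\<close>.\<close>
  also have "\<dots> \<le> 3 * ?mid + A / 2"
    using edge[of 0 \<beta>] edge[of "pi - \<beta>" "- \<beta>"] \<beta> pi_gt3 by simp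
  finally have A: "A \<le> 6 * ?mid" by simp
  have "sin \<beta> \<le> sin \<theta>" if "\<theta> \<in> {\<beta>..pi - \<beta>}" for \<theta>
  proof (cases "\<theta> \<le> pi / 2")
    case True
    then show ?thesis using that \<beta> by (intro sin_monotone_2pi_le) auto
  next
    case False
    then have "sin \<beta> \<le> sin (pi - \<theta>)" using that \<beta> by (intro sin_monotone_2pi_le) auto
    then show ?thesis by simp
  qed
  \<comment> \<open>Mean value theorem: the cosine is at least \<open>cos (pi / 3) = 1 / 2\<close>
    on \<open>{0..\<beta>}\<close>, because \<open>\<beta> \<le> 1 / 8\<close>.\<close>
  moreover have "\<beta> / 2 \<le> sin \<beta>"
  proof -
    obtain z where z: "0 < z" "z < \<beta>" "sin \<beta> - sin 0 = (\<beta> - 0) * cos z"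
      using MVT2[of 0 \<beta> sin cos] \<beta> by auto
    have "cos (pi / 3) \<le> cos z" using z \<beta> pi_gt3 by (intro cos_monotone_0_pi_le) auto
    then have "\<beta> * (1 / 2) \<le> \<beta> * cos z" using \<beta> by (intro mult_left_mono) (auto simp: cos_60)
    with z show ?thesis by simp
  qed
  ultimately have sin: "\<beta> / 2 \<le> sin \<theta>" if "\<theta> \<in> {\<beta>..pi - \<beta>}" for \<theta>
    using that by force
  have "\<beta> / 2 * ?mid = integral {\<beta>..pi - \<beta>} (\<lambda>\<theta>. \<beta> / 2 * ?T \<theta>)" by simp
  also have "\<dots> \<le> integral {\<beta>..pi - \<beta>} (\<lambda>\<theta>. sin \<theta> * ?T \<theta>)"
    by (intro integral_le mult_right_mono sin) (auto intro!: integrable_continuous_real continuous_intros)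
  also have "\<dots> \<le> integral {0..pi} (\<lambda>\<theta>. sin \<theta> * ?T \<theta>)"
    using \<beta> by (intro integral_subset_le) (auto intro!: integrable_continuous_real continuous_intros mult_nonneg_nonneg sin_ge_zero)
  also have "\<dots> = ?I"
    by (rule integral_sin_cos_substitution) (intro continuous_intros)
  finally have "?mid \<le> 16 * n * ?I"
    using n by (simp add: \<beta>_def field_simps)
  \<comment> \<open>The factors are 6 from the edge strips and 16 from
    \<open>sin \<theta> \<ge> 1 / (16 * n)\<close>; Bernstein's \<open>2 * n\<close> then turns
    \<open>96 * n\<close> into \<open>192 * n\<^sup>2\<close>.\<close>
  with A have "A \<le> 96 * n * ?I" by simp
  then have "2 * n * A \<le> 2 * n * (96 * n * ?I)"
    by (intro mult_left_mono) auto
  with VA V show ?thesis by (simp add: power2_eq_square mult_ac)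
qed

text \<open>The affine map from \<open>{-1..1}\<close> has slope \<open>(b - a) / 2\<close>. The
  derivative gains this factor, which doubles the constant 192.\<close>

lemma markov_L1_interval:
  fixes p :: "real poly"
  assumes "degree p \<le> n" "0 < n" "a < b"
  shows "(b - a) * integral {a..b} (\<lambda>x. \<bar>poly (pderiv p) x\<bar>) \<le> 384 * n\<^sup>2 * integral {a..b} (\<lambda>x. \<bar>poly p x\<bar>)"
proof -
  define w m where "w = (b - a) / 2" and "m = (a + b) / 2"
  define P where "P = pcompose p [:m, w:]"
  have w: "0 < w" "w * -1 + m = a" "w * 1 + m = b" using assms by (auto simp: w_def m_def field_simps)
  have subst: "integral {-1..1} (\<lambda>t. w * g (w * t + m)) = integral {a..b} g" if "continuous_on UNIV g" for g :: "real \<Rightarrow> real"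
  proof -
    have "w * -1 \<le> w * t" "w * t \<le> w * 1" if "t \<in> {-1..1}" for t
      using that w(1) by (intro mult_left_mono; simp)+
    then have "(\<lambda>t. w * t + m) ` {-1..1} \<subseteq> {w * -1 + m..w * 1 + m}" by force
    then have "((\<lambda>t. w *\<^sub>R g (w * t + m)) has_integral integral {w * -1 + m..w * 1 + m} g) {-1..1}"
      using w(1)
      by (intro has_integral_substitution[where c = "w * -1 + m" and d = "w * 1 + m"])
        (auto intro!: derivative_eq_intros continuous_on_subset[OF that])
    then show ?thesis using w by (simp only: integral_unique real_scaleR_def)
  qed
  have "degree P \<le> n"
    using degree_pcompose_le[of p "[:m, w:]"] assms by (simp add: P_def split: if_splits)
  from markov_L1[OF this \<open>0 < n\<close>]
  have "integral {-1..1} (\<lambda>t. w * \<bar>poly (pderiv p) (w * t + m)\<bar>) \<le> 192 * n\<^sup>2 * integral {-1..1} (\<lambda>t. \<bar>poly p (w * t + m)\<bar>)"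
    using w(1) by (simp add: P_def poly_pcompose pderiv_pcompose pderiv_pCons abs_mult add.commute mult.commute)
  then have "w * integral {a..b} (\<lambda>x. \<bar>poly (pderiv p) x\<bar>)
      \<le> 192 * n\<^sup>2 * integral {-1..1} (\<lambda>t. w * \<bar>poly p (w * t + m)\<bar>)"
    using w(1) by (subst (asm) subst) (auto intro!: continuous_intros)
  also have "integral {-1..1} (\<lambda>t. w * \<bar>poly p (w * t + m)\<bar>) = integral {a..b} (\<lambda>x. \<bar>poly p x\<bar>)"
    by (rule subst) (intro continuous_intros)
  finally show ?thesis by (simp add: w_def)
qed

section \<open>Quadrature with an error relative to the integral\<close>

lemma riemann_sum_abs_error:
  fixes f f' :: "real \<Rightarrow> real"
  assumes deriv: "\<And>x. (f has_real_derivative f' x) (at x)" and cont: "continuous_on UNIV f'" and h: "0 \<le> h"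
  shows "\<bar>h * (\<Sum>r<k. \<bar>f (a + real r * h)\<bar>) - integral {a..a + real k * h} (\<lambda>x. \<bar>f x\<bar>)\<bar> \<le> h * integral {a..a + real k * h} (\<lambda>x. \<bar>f' x\<bar>)"
proof (induction k)
  case (Suc k)
  have contf: "continuous_on UNIV f"
    using deriv by (meson DERIV_continuous continuous_at_imp_continuous_on)
  have int: "(\<lambda>x. \<bar>f x\<bar>) integrable_on {s..t}" "(\<lambda>x. \<bar>f' x\<bar>) integrable_on {s..t}" "f' integrable_on {s..t}" for s t
    by (intro integrable_continuous_real continuous_on_rabs continuous_on_subset[OF cont] continuous_on_subset[OF contf] subset_UNIV)+
  define u where "u = a + real k * h"
  have u: "a \<le> u" "a + real (Suc k) * h = u + h" using h by (auto simp: u_def algebra_simps)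
  define V where "V = integral {u..u + h} (\<lambda>x. \<bar>f' x\<bar>)"
  have var: "\<bar>f x - f u\<bar> \<le> V" if "x \<in> {u..u + h}" for x
  proof -
    have "(f' has_integral f x - f u) {u..x}"
      using that by (intro fundamental_theorem_of_calculus)
        (auto intro: has_field_derivative_at_within[OF deriv] simp flip: has_real_derivative_iff_has_vector_derivative)
    then have "\<bar>f x - f u\<bar> = \<bar>integral {u..x} f'\<bar>" by (simp add: integral_unique)
    also have "\<dots> \<le> integral {u..x} (\<lambda>x. \<bar>f' x\<bar>)"
      using integral_norm_bound_integral[OF int(3) int(2), of u x] by simp
    also have "\<dots> \<le> V" unfolding V_def
      using that by (intro integral_subset_le int) auto
    finally show ?thesis .
  qed
  have const: "h * c = integral {u..u + h} (\<lambda>x. c)" for c using h by simp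
  \<comment> \<open>Taking absolute values does not increase the oscillation, so sign changes of
    \<open>f\<close> inside the cell are harmless.\<close>
  have bounds: "\<bar>f u\<bar> - V \<le> \<bar>f x\<bar>" "\<bar>f x\<bar> \<le> \<bar>f u\<bar> + V" if "x \<in> {u..u + h}" for x
    using var[OF that] by linarith+
  have "h * (\<bar>f u\<bar> - V) \<le> integral {u..u + h} (\<lambda>x. \<bar>f x\<bar>)"
    unfolding const by (intro integral_le int bounds) auto
  moreover have "integral {u..u + h} (\<lambda>x. \<bar>f x\<bar>) \<le> h * (\<bar>f u\<bar> + V)"
    unfolding const by (intro integral_le int bounds) auto
  moreover have cmb: "integral {a..u + h} (\<lambda>x. \<bar>f x\<bar>) = integral {a..u} (\<lambda>x. \<bar>f x\<bar>) + integral {u..u + h} (\<lambda>x. \<bar>f x\<bar>)"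
    "integral {a..u + h} (\<lambda>x. \<bar>f' x\<bar>) = integral {a..u} (\<lambda>x. \<bar>f' x\<bar>) + V"
    unfolding V_def using u h by (intro Henstock_Kurzweil_Integration.integral_combine[symmetric] int; simp)+
  ultimately show ?case
    using Suc.IH unfolding u(2) sum.lessThan_Suc u_def[symmetric] cmb distrib_left right_diff_distrib by linarith
qed simp

text \<open>The Riemann sum error carries the step \<open>(b - a) / q\<close> and Markov's
  inequality the reciprocal of \<open>b - a\<close>. The length cancels, so the relative error is
  the same on every interval, however long or short.\<close>

lemma quadrature_abs_poly:
  fixes p :: "real poly"
  assumes "degree p \<le> n" "0 < n" "a < b" "0 < q"
  shows "\<bar>(b - a) / real q * (\<Sum>r<q. \<bar>poly p (a + real r * ((b - a) / real q))\<bar>) - integral {a..b} (\<lambda>x. \<bar>poly p x\<bar>)\<bar>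
    \<le> 384 * n\<^sup>2 / real q * integral {a..b} (\<lambda>x. \<bar>poly p x\<bar>)"
proof -
  let ?h = "(b - a) / real q"
  have "a + real q * ?h = b" "0 \<le> ?h" using assms by auto
  then have "\<bar>?h * (\<Sum>r<q. \<bar>poly p (a + real r * ?h)\<bar>) - integral {a..b} (\<lambda>x. \<bar>poly p x\<bar>)\<bar> \<le> ?h * integral {a..b} (\<lambda>x. \<bar>poly (pderiv p) x\<bar>)"
    using riemann_sum_abs_error[of "poly p" "poly (pderiv p)" ?h a q] by (simp add: poly_DERIV continuous_intros)
  also have "\<dots> = (b - a) * integral {a..b} (\<lambda>x. \<bar>poly (pderiv p) x\<bar>) / real q" by simp
  also have "\<dots> \<le> 384 * n\<^sup>2 * integral {a..b} (\<lambda>x. \<bar>poly p x\<bar>) / real q"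
    using markov_L1_interval[OF assms(1-3)] by (intro divide_right_mono) auto
  finally show ?thesis by simp
qed

section \<open>The program and its operational behaviour\<close>

text \<open>Total correctness, with the operation count as an argument of the postcondition. As
  \<open>exec\<close> is deterministic, the run asserted to exist is the only one.\<close>

definition wp :: "(nat \<Rightarrow> real) \<Rightarrow> com \<Rightarrow> state \<Rightarrow> (nat \<Rightarrow> state \<Rightarrow> bool) \<Rightarrow> bool" where
  "wp \<omega> P s Q \<longleftrightarrow> (\<exists>t s'. exec \<omega> P s t s' \<and> Q t s')"

definition iput :: "string \<Rightarrow> nat \<Rightarrow> nat \<Rightarrow> state \<Rightarrow> state" where
  "iput v i x s = s\<lparr>imem := (imem s)(v := (imem s v)(i := x))\<rparr>"

definition rput :: "string \<Rightarrow> nat \<Rightarrow> real \<Rightarrow> state \<Rightarrow> state" where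
  "rput v i x s = s\<lparr>rmem := (rmem s)(v := (rmem s v)(i := x))\<rparr>"

definition advance :: "state \<Rightarrow> state" where
  "advance s = s\<lparr>drawn := Suc (drawn s)\<rparr>"

lemma put_simps [simp]:
  "imem (iput v i x s) w = (if w = v then (imem s v)(i := x) else imem s w)"
  "rmem (iput v i x s) = rmem s" "drawn (iput v i x s) = drawn s"
  "rmem (rput v i y s) w = (if w = v then (rmem s v)(i := y) else rmem s w)"
  "imem (rput v i y s) = imem s" "drawn (rput v i y s) = drawn s"
  "imem (advance s) = imem s" "rmem (advance s) = rmem s" "drawn (advance s) = Suc (drawn s)"
  by (simp_all add: iput_def rput_def advance_def)

lemma wp_simps [simp]:
  "wp \<omega> Skip s Q \<longleftrightarrow> Q 1 s"
  "wp \<omega> (ISet v i e) s Q \<longleftrightarrow> Q (1 + icost i + icost e) (iput v (ival i s) (ival e s) s)"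
  "wp \<omega> (RSet v i r) s Q \<longleftrightarrow> Q (1 + icost i + rcost r) (rput v (ival i s) (rval r s) s)"
  "wp \<omega> (Draw v i) s Q \<longleftrightarrow> Q (1 + icost i) (advance (rput v (ival i s) (\<omega> (drawn s)) s))"
  "wp \<omega> (Seq P R) s Q \<longleftrightarrow> wp \<omega> P s (\<lambda>t s'. wp \<omega> R s' (\<lambda>t' s''. Q (t + t') s''))"
  "wp \<omega> (Cond b P R) s Q \<longleftrightarrow>
     (if bval b s then wp \<omega> P s (\<lambda>t s'. Q (1 + bcost b + t) s') else wp \<omega> R s (\<lambda>t s'. Q (1 + bcost b + t) s'))"
  unfolding wp_def iput_def rput_def advance_def
  by (auto elim!: exec_SkipE exec_ISetE exec_RSetE exec_DrawE exec_SeqE exec_CondE intro: exec.intros)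
    (fastforce intro: exec.intros)+

lemma wp_mono: "wp \<omega> P s Q \<Longrightarrow> (\<And>t s'. Q t s' \<Longrightarrow> R t s') \<Longrightarrow> wp \<omega> P s R"
  unfolding wp_def by blast

text \<open>The variant serves twice: it forces termination, and its initial value bounds the number
  of iterations and therefore the cost.\<close>

lemma wp_Loop:
  fixes \<mu> :: "state \<Rightarrow> nat"
  assumes "I s"
    and step: "\<And>s. I s \<Longrightarrow> bval b s \<Longrightarrow> wp \<omega> P s (\<lambda>t s'. t \<le> c \<and> I s' \<and> \<mu> s' < \<mu> s)"
    and post: "\<And>t s'. I s' \<Longrightarrow> \<not> bval b s' \<Longrightarrow> t \<le> \<mu> s * (1 + bcost b + c) + 1 + bcost b \<Longrightarrow> Q t s'"
  shows "wp \<omega> (Loop b P) s Q"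
proof -
  have "\<exists>t s'. exec \<omega> (Loop b P) s t s' \<and> I s' \<and> \<not> bval b s' \<and> t \<le> \<mu> s * (1 + bcost b + c) + 1 + bcost b"
    using \<open>I s\<close>
  proof (induction "\<mu> s" arbitrary: s rule: less_induct)
    case less
    show ?case
    proof (cases "bval b s")
      case True
      obtain t s' where 1: "exec \<omega> P s t s'" "t \<le> c" "I s'" "\<mu> s' < \<mu> s"
        using step[OF less.prems True] unfolding wp_def by blast
      obtain t' s'' where 2: "exec \<omega> (Loop b P) s' t' s''" "I s''" "\<not> bval b s''"
        "t' \<le> \<mu> s' * (1 + bcost b + c) + 1 + bcost b"
        using less.hyps[OF 1(4,3)] by blast
      have "Suc (\<mu> s') * (1 + bcost b + c) \<le> \<mu> s * (1 + bcost b + c)"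
        using 1(4) by (intro mult_right_mono) auto
      with 1(2) 2(4) have "1 + bcost b + t + t' \<le> \<mu> s * (1 + bcost b + c) + 1 + bcost b" by simp
      with exec.LoopT[OF True 1(1) 2(1)] 2(2,3) show ?thesis by blast
    next
      case False
      with exec.LoopF[OF False] less.prems show ?thesis by fastforce
    qed
  qed
  with post show ?thesis unfolding wp_def by blast
qed

abbreviation IV :: "string \<Rightarrow> iexp" where "IV v \<equiv> IGet v (INum 0)"
abbreviation RV :: "string \<Rightarrow> rexp" where "RV v \<equiv> RGet v (INum 0)"

definition For :: "string \<Rightarrow> iexp \<Rightarrow> com \<Rightarrow> com" where
  "For v e P = Seq (ISet v (INum 0) (INum 0))
     (Loop (ILess (IV v) e) (Seq P (ISet v (INum 0) (IAdd (IV v) (INum 1)))))"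

text \<open>The overhead per iteration is \<open>4 + icost e\<close> for the guard and 6 for the
  increment. Outside there remain 3 for the initialisation and \<open>4 + icost e\<close> for the
  guard that fails.\<close>

lemma wp_For:
  assumes init: "I 0 (iput v 0 0 s)"
    and counter: "\<And>i s. I i s \<Longrightarrow> imem s v 0 = i \<and> ival e s = n"
    and step: "\<And>i s. i < n \<Longrightarrow> I i s \<Longrightarrow> wp \<omega> P s (\<lambda>t s'. t \<le> c \<and> I (Suc i) (iput v 0 (Suc (imem s' v 0)) s'))"
    and post: "\<And>t s'. I n s' \<Longrightarrow> t \<le> n * (c + icost e + 10) + icost e + 7 \<Longrightarrow> Q t s'"
  shows "wp \<omega> (For v e P) s Q"
proof -
  let ?s0 = "iput v (ival (INum 0) s) (ival (INum 0) s) s"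
  show ?thesis
    unfolding For_def wp_simps
  proof (rule wp_Loop[where I = "\<lambda>s. I (imem s v 0) s \<and> imem s v 0 \<le> n" and \<mu> = "\<lambda>s. n - imem s v 0" and c = "c + 6"])
    show "I (imem ?s0 v 0) ?s0 \<and> imem ?s0 v 0 \<le> n"
      using init by simp
  next
    fix s assume I: "I (imem s v 0) s \<and> imem s v 0 \<le> n" and b: "bval (ILess (IV v) e) s"
    then have lt: "imem s v 0 < n" using counter by auto
    from wp_mono[OF step[OF this conjunct1[OF I]]]
    show "wp \<omega> (Seq P (ISet v (INum 0) (IAdd (IV v) (INum 1)))) s
        (\<lambda>t s'. t \<le> c + 6 \<and> (I (imem s' v 0) s' \<and> imem s' v 0 \<le> n) \<and> n - imem s' v 0 < n - imem s v 0)"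
      unfolding wp_simps
    proof this
      fix t s' assume *: "t \<le> c \<and> I (Suc (imem s v 0)) (iput v 0 (Suc (imem s' v 0)) s')"
      have eq: "imem s' v 0 = imem s v 0" using counter[OF conjunct2[OF *]] by simp
      let ?u = "iput v (ival (INum 0) s') (ival (IAdd (IV v) (INum 1)) s') s'"
      from eq * lt show "t + (1 + icost (INum 0) + icost (IAdd (IV v) (INum 1))) \<le> c + 6 \<and>
        (I (imem ?u v 0) ?u \<and> imem ?u v 0 \<le> n) \<and> n - imem ?u v 0 < n - imem s v 0"
        by simp
    qed
  next
    fix t s' assume I: "I (imem s' v 0) s' \<and> imem s' v 0 \<le> n" "\<not> bval (ILess (IV v) e) s'"
      and t: "t \<le> (n - imem ?s0 v 0) * (1 + bcost (ILess (IV v) e) + (c + 6)) + 1 + bcost (ILess (IV v) e)"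
    then have "imem s' v 0 = n" using counter[of "imem s' v 0" s'] by simp
    then show "Q (1 + icost (INum 0) + icost (INum 0) + t) s'"
      using I t by (intro post) (auto simp: algebra_simps)
  qed
qed

lemma cost_bound:
  fixes t n A B x :: nat
  assumes "t \<le> n * A + x + 7" "A \<le> B" "x \<le> 3"
  shows "t \<le> n * B + 10"
  using mult_left_mono[OF assms(2), of n] assms by linarith

text \<open>A frame condition: \<open>A\<close> and \<open>B\<close> name the natural and the real
  arrays that may be written. The sample counter \<open>drawn\<close> is not covered and is tracked
  separately.\<close>

definition keep :: "string set \<Rightarrow> string set \<Rightarrow> state \<Rightarrow> state \<Rightarrow> bool" where
  "keep A B s s' \<longleftrightarrow> (\<forall>v. v \<notin> A \<longrightarrow> imem s' v = imem s v) \<and> (\<forall>v. v \<notin> B \<longrightarrow> rmem s' v = rmem s v)"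

abbreviation "keep_projections \<equiv> keep {''u'', ''r'', ''i'', ''l'', ''j'', ''p''} {''M'', ''w'', ''z'', ''x'', ''S'', ''h'', ''y'', ''Y''}"
abbreviation "keep_projection \<equiv> keep {''u'', ''r'', ''i'', ''l'', ''j''} {''M'', ''w'', ''z'', ''x'', ''S'', ''h'', ''y'', ''Y''}"
abbreviation "keep_moments \<equiv> keep {''u'', ''r'', ''i''} {''M'', ''w'', ''z'', ''x'', ''S'', ''h''}"
abbreviation "keep_cell \<equiv> keep {''u'', ''r''} {''M'', ''w'', ''z'', ''x''}"
abbreviation "keep_sketch \<equiv> keep {''u'', ''l'', ''j''} {''y'', ''Y''}"

lemma keep_refl: "keep A B s s"
  by (simp add: keep_def)

lemma keep_put [simp]:
  "v \<in> A \<Longrightarrow> keep A B s (iput v i x s') \<longleftrightarrow> keep (insert v A) B s s'"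
  "v \<in> B \<Longrightarrow> keep A B s (rput v i y s') \<longleftrightarrow> keep A (insert v B) s s'"
  "keep A B s (advance s') \<longleftrightarrow> keep A B s s'"
  by (auto simp: keep_def insert_absorb)

lemma keepD:
  assumes "keep A B s s'"
  shows "v \<notin> A \<Longrightarrow> imem s' v = imem s v" "w \<notin> B \<Longrightarrow> rmem s' w = rmem s w"
  using assms by (auto simp: keep_def)

lemma keep_trans: "keep A B s s' \<Longrightarrow> keep A' B' s' s'' \<Longrightarrow> A' \<subseteq> A \<Longrightarrow> B' \<subseteq> B \<Longrightarrow> keep A B s s''"
  by (force simp: keep_def subset_iff)

section \<open>Computing the sketches\<close>

abbreviation coeff_count :: iexp where
  "coeff_count \<equiv> IAdd (IV ''d'') (INum 1)"

definition add_powers :: com where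
  "add_powers = For ''u'' coeff_count
     (Seq (RSet ''M'' (IV ''u'') (RAdd (RGet ''M'' (IV ''u'')) (RV ''w'')))
          (RSet ''w'' (INum 0) (RMul (RV ''w'') (RV ''x''))))"

lemma wp_add_powers:
  assumes d: "imem s ''d'' 0 = d"
    and post: "\<And>t s'. keep {''u''} {''M'', ''w''} s s' \<Longrightarrow> drawn s' = drawn s \<Longrightarrow>
      rmem s' ''M'' = (\<lambda>v. rmem s ''M'' v + (if v < d + 1 then rmem s ''w'' 0 * rmem s ''x'' 0 ^ v else 0)) \<Longrightarrow>
      t \<le> 50 * (d + 1) \<Longrightarrow> Q t s'"
  shows "wp \<omega> add_powers s Q"
  unfolding add_powers_def
proof (rule wp_For[where n = "d + 1" and c = 16 and I = "\<lambda>i s'. imem s' ''u'' 0 = i \<and> keep {''u''} {''M'', ''w''} s s' \<and>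
    drawn s' = drawn s \<and> rmem s' ''w'' 0 = rmem s ''w'' 0 * rmem s ''x'' 0 ^ i \<and>
    rmem s' ''M'' = (\<lambda>v. rmem s ''M'' v + (if v < i then rmem s ''w'' 0 * rmem s ''x'' 0 ^ v else 0))"],
    goal_cases init counter step post)
  case (step i s')
  then show ?case by (auto simp: keepD[of _ _ s s'] insert_absorb)
next
  case (post t s')
  then show ?case by (intro assms) auto
qed (use d in \<open>auto simp: keepD[of _ _ s] intro: keep_refl\<close>)

definition add_cell :: com where
  "add_cell = For ''r'' (IV ''q'')
     (Seq (Draw ''z'' (INum 0))
     (Seq (RSet ''w'' (INum 0) (RMul (RV ''z'') (RV ''h'')))
     (Seq (RSet ''x'' (INum 0) (RAdd (RGet ''a'' (IV ''i'')) (RMul (RNat (IV ''r'')) (RV ''h''))))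
     add_powers)))"

definition cell :: "(nat \<Rightarrow> real) \<Rightarrow> real \<Rightarrow> real \<Rightarrow> nat \<Rightarrow> nat \<Rightarrow> nat \<Rightarrow> real" where
  "cell \<omega> h x q B u = (\<Sum>r<q. \<omega> (B + r) * h * (x + real r * h) ^ u)"

lemma wp_add_cell:
  assumes dq: "imem s ''d'' 0 = d" "imem s ''q'' 0 = q"
    and post: "\<And>t s'. keep_cell s s' \<Longrightarrow> drawn s' = drawn s + q \<Longrightarrow>
      (\<And>v. v \<le> d \<Longrightarrow> rmem s' ''M'' v = rmem s ''M'' v + cell \<omega> (rmem s ''h'' 0) (rmem s ''a'' (imem s ''i'' 0)) q (drawn s) v) \<Longrightarrow>
      t \<le> q * (100 * (d + 1)) + 10 \<Longrightarrow> Q t s'"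
  shows "wp \<omega> add_cell s Q"
  unfolding add_cell_def
proof (rule wp_For[where n = q and c = "50 * (d + 1) + 30" and I = "\<lambda>i s'. imem s' ''r'' 0 = i \<and>
    keep_cell s s' \<and> drawn s' = drawn s + i \<and>
    (\<forall>v\<le>d. rmem s' ''M'' v = rmem s ''M'' v + cell \<omega> (rmem s ''h'' 0) (rmem s ''a'' (imem s ''i'' 0)) i (drawn s) v)"],
    goal_cases init counter step post)
  case (step i s')
  then have I: "imem s' ''r'' 0 = i" "keep_cell s s'" "drawn s' = drawn s + i"
    "\<forall>v\<le>d. rmem s' ''M'' v = rmem s ''M'' v + cell \<omega> (rmem s ''h'' 0) (rmem s ''a'' (imem s ''i'' 0)) i (drawn s) v"
    by auto
  show ?case unfolding wp_simps
  proof (rule wp_add_powers[where d = d], goal_cases d post)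
    case d
    then show ?case using dq I(2) by (simp add: keepD[OF I(2)])
  next
    case (post t s'')
    from post(1) have k: "keep_cell s s''"
      by (rule keep_trans[rotated]) (use I(2) in \<open>auto simp: insert_absorb\<close>)
    have r: "imem s'' ''r'' = imem s' ''r''" using keepD(1)[OF post(1), of "''r''"] by simp
    have eqs: "imem s' ''i'' = imem s ''i''" "rmem s' ''a'' = rmem s ''a''" "rmem s' ''h'' = rmem s ''h''"
      using keepD[OF I(2)] by simp_all
    have M: "rmem s'' ''M'' v = rmem s' ''M'' v + \<omega> (drawn s + i) * rmem s ''h'' 0 *
        (rmem s ''a'' (imem s ''i'' 0) + real i * rmem s ''h'' 0) ^ v" if "v \<le> d" for v
      using post(3) that eqs I(1,3) by simp
    have "drawn s'' = Suc (drawn s + i)" using post(2) I(3) by simp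
    then show ?case using post(4) I(1,4) k r
      by (simp add: M cell_def insert_absorb)
  qed
next
  case (post t s')
  have "t \<le> q * (100 * (d + 1)) + 10"
    by (rule cost_bound[OF post(2)]) simp_all
  with post(1) show ?case by (intro assms) auto
qed (use dq in \<open>auto simp: keepD[of _ _ s] cell_def intro: keep_refl\<close>)

definition store_moments :: com where
  "store_moments = For ''u'' coeff_count
     (RSet ''S'' (IAdd (IMul (IV ''i'') coeff_count) (IV ''u'')) (RGet ''M'' (IV ''u'')))"

lemma wp_store_moments:
  assumes d: "imem s ''d'' 0 = d"
    and post: "\<And>t s'. keep {''u''} {''S''} s s' \<Longrightarrow> drawn s' = drawn s \<Longrightarrow>
      (\<And>v. v < imem s ''i'' 0 * (d + 1) \<Longrightarrow> rmem s' ''S'' v = rmem s ''S'' v) \<Longrightarrow>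
      (\<And>v. v \<le> d \<Longrightarrow> rmem s' ''S'' (imem s ''i'' 0 * (d + 1) + v) = rmem s ''M'' v) \<Longrightarrow>
      t \<le> 50 * (d + 1) \<Longrightarrow> Q t s'"
  shows "wp \<omega> store_moments s Q"
  unfolding store_moments_def
proof (rule wp_For[where n = "d + 1" and c = 20 and I = "\<lambda>i s'. imem s' ''u'' 0 = i \<and>
    keep {''u''} {''S''} s s' \<and> drawn s' = drawn s \<and>
    (\<forall>v < imem s ''i'' 0 * (d + 1). rmem s' ''S'' v = rmem s ''S'' v) \<and>
    (\<forall>v < i. rmem s' ''S'' (imem s ''i'' 0 * (d + 1) + v) = rmem s ''M'' v)"],
    goal_cases init counter step post)
  case (step i s')
  then have I: "imem s' ''u'' 0 = i" "keep {''u''} {''S''} s s'" "drawn s' = drawn s"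
    "\<And>v. v < imem s ''i'' 0 * (d + 1) \<Longrightarrow> rmem s' ''S'' v = rmem s ''S'' v"
    "\<And>v. v < i \<Longrightarrow> rmem s' ''S'' (imem s ''i'' 0 * (d + 1) + v) = rmem s ''M'' v" by auto
  have eqs: "imem s' ''i'' = imem s ''i''" "imem s' ''d'' 0 = d" "rmem s' ''M'' = rmem s ''M''"
    using keepD[OF I(2)] d by simp_all
  have old: "v \<noteq> imem s ''i'' 0 * (d + 1) + i" if "v < imem s ''i'' 0 * (d + 1)" for v
    using that by linarith
  show ?case using I eqs old by (simp add: insert_absorb less_Suc_eq del: mult_Suc_right)
next
  case (post t s')
  then show ?case by (intro assms) auto
qed (use d in \<open>auto simp: keepD[of _ _ s] intro: keep_refl\<close>)

text \<open>Storing precedes adding, so row \<open>i\<close> of \<open>S\<close> holds the cells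
  before endpoint \<open>i\<close>. The last round reads the default 0 as the endpoint after the
  last one; its contribution enters \<open>M\<close> only after the last row has been stored and
  never reaches \<open>S\<close>. It still consumes \<open>q\<close> samples, so a projection uses
  \<open>s * q\<close> of them.\<close>

definition all_moments :: com where
  "all_moments = For ''i'' (IV ''s'')
     (Seq store_moments
     (Seq (RSet ''h'' (INum 0) (RDiv (RSub (RGet ''a'' (IAdd (IV ''i'') (INum 1))) (RGet ''a'' (IV ''i''))) (RNat (IV ''q''))))
     add_cell))"

definition moment :: "(nat \<Rightarrow> real) \<Rightarrow> (nat \<Rightarrow> real) \<Rightarrow> nat \<Rightarrow> nat \<Rightarrow> nat \<Rightarrow> nat \<Rightarrow> real" where
  "moment \<omega> a q B i u = (\<Sum>i'<i. cell \<omega> ((a (i' + 1) - a i') / real q) (a i') q (B + i' * q) u)"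

lemma wp_all_moments:
  assumes dq: "imem s ''d'' 0 = d" "imem s ''q'' 0 = q" "imem s ''s'' 0 = K"
    and M: "\<And>v. v \<le> d \<Longrightarrow> rmem s ''M'' v = 0"
    and post: "\<And>t s'. keep_moments s s' \<Longrightarrow> drawn s' = drawn s + K * q \<Longrightarrow>
      (\<And>i v. i < K \<Longrightarrow> v \<le> d \<Longrightarrow> rmem s' ''S'' (i * (d + 1) + v) = moment \<omega> (rmem s ''a'') q (drawn s) i v) \<Longrightarrow>
      t \<le> K * (200 * (d + 1) * (q + 1)) + 10 \<Longrightarrow> Q t s'"
  shows "wp \<omega> all_moments s Q"
  unfolding all_moments_def
proof (rule wp_For[where n = K and c = "50 * (d + 1) + q * (100 * (d + 1)) + 40" and I = "\<lambda>i s'. imem s' ''i'' 0 = i \<and>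
    keep_moments s s' \<and> drawn s' = drawn s + i * q \<and>
    (\<forall>v\<le>d. rmem s' ''M'' v = moment \<omega> (rmem s ''a'') q (drawn s) i v) \<and>
    (\<forall>i'<i. \<forall>v\<le>d. rmem s' ''S'' (i' * (d + 1) + v) = moment \<omega> (rmem s ''a'') q (drawn s) i' v)"],
    goal_cases init counter step post)
  case (step i s')
  then have I: "imem s' ''i'' 0 = i" "keep_moments s s'"
    "drawn s' = drawn s + i * q"
    "\<And>v. v\<le>d \<Longrightarrow> rmem s' ''M'' v = moment \<omega> (rmem s ''a'') q (drawn s) i v"
    "\<And>i' v. i'<i \<Longrightarrow> v \<le> d \<Longrightarrow> rmem s' ''S'' (i' * (d + 1) + v) = moment \<omega> (rmem s ''a'') q (drawn s) i' v"
    by auto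
  show ?case unfolding wp_simps
  proof (rule wp_store_moments[where d = d], goal_cases d post)
    case d
    then show ?case using dq I(2) by (simp add: keepD[OF I(2)])
  next
    case (post t1 s1)
    note s1 = post
    show ?case
    proof (rule wp_add_cell[where d = d and q = q], goal_cases d q post)
      case (post t2 s2)
      note s2 = post
      have k: "keep_moments s s2"
      proof (rule keep_trans[OF _ s2(1)])
        have "keep_moments s s1"
          by (rule keep_trans[OF I(2) s1(1)]) auto
        then show "keep_moments s
          (rput ''h'' (ival (INum 0) s1) (rval (RDiv (RSub (RGet ''a'' (IAdd (IV ''i'') (INum 1))) (RGet ''a'' (IV ''i''))) (RNat (IV ''q''))) s1) s1)"
          by (simp add: insert_absorb)
      qed auto
      have eqs: "imem s2 ''i'' = imem s' ''i''" "rmem s2 ''S'' = rmem s1 ''S''" "rmem s1 ''M'' = rmem s' ''M''"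
        "rmem s1 ''a'' = rmem s ''a''" "imem s1 ''i'' = imem s' ''i''" "imem s1 ''q'' = imem s ''q''"
        using keepD[OF s1(1)] keepD[OF s2(1)] keepD[OF I(2)] by simp_all
      have S: "rmem s2 ''S'' (i' * (d + 1) + v) = moment \<omega> (rmem s ''a'') q (drawn s) i' v" if "i' \<le> i" "v \<le> d" for i' v
      proof (cases "i' = i")
        case True
        then show ?thesis using s1(4)[of v] that I eqs by simp
      next
        case False
        \<comment> \<open>Earlier rows lie entirely below the addresses of row \<open>i\<close>,
          where \<open>wp_store_moments\<close> guarantees that nothing changes.\<close>
        then have "Suc i' * (d + 1) \<le> i * (d + 1)" using that by (intro mult_right_mono) auto
        then have "i' * (d + 1) + v < i * (d + 1)" using that by simp
        then show ?thesis using s1(3) False that I eqs by simp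
      qed
      have M: "rmem s2 ''M'' v = moment \<omega> (rmem s ''a'') q (drawn s) (Suc i) v" if "v \<le> d" for v
        using s2(3)[OF that] s1(2) I(1,3) I(4)[OF that] eqs dq by (simp add: moment_def)
      have "drawn s2 = drawn s + Suc i * q" using s2(2) s1(2) I(3) by simp
      then show ?case using s2(4) s1(5) I(1) k eqs(1) S M
        by (simp add: insert_absorb less_Suc_eq_le)
    qed (use dq keepD[OF I(2)] keepD[OF s1(1)] in simp_all)
  qed
next
  case (post t s')
  have "t \<le> K * (200 * (d + 1) * (q + 1)) + 10"
    by (rule cost_bound[OF post(2)]) (simp_all add: algebra_simps)
  with post(1) show ?case by (intro assms) auto
qed (use dq M in \<open>auto simp: keepD[of _ _ s] moment_def intro: keep_refl\<close>)

text \<open>From the second projection on, \<open>M\<close> still holds the totals of the previous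
  one.\<close>

definition clear_moments :: com where
  "clear_moments = For ''u'' coeff_count (RSet ''M'' (IV ''u'') (RNat (INum 0)))"

lemma wp_clear_moments:
  assumes d: "imem s ''d'' 0 = d"
    and post: "\<And>t s'. keep {''u''} {''M''} s s' \<Longrightarrow> drawn s' = drawn s \<Longrightarrow>
      (\<And>v. v \<le> d \<Longrightarrow> rmem s' ''M'' v = 0) \<Longrightarrow> t \<le> 50 * (d + 1) \<Longrightarrow> Q t s'"
  shows "wp \<omega> clear_moments s Q"
  unfolding clear_moments_def
proof (rule wp_For[where n = "d + 1" and c = 20 and I = "\<lambda>i s'. imem s' ''u'' 0 = i \<and>
    keep {''u''} {''M''} s s' \<and> drawn s' = drawn s \<and> (\<forall>v < i. rmem s' ''M'' v = 0)"],
    goal_cases init counter step post)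
  case (step i s')
  then have I: "imem s' ''u'' 0 = i" "keep {''u''} {''M''} s s'" "drawn s' = drawn s"
    "\<And>v. v < i \<Longrightarrow> rmem s' ''M'' v = 0" by auto
  show ?case using I by (simp add: insert_absorb less_Suc_eq)
next
  case (post t s')
  then show ?case by (intro assms) auto
qed (use d in \<open>auto simp: keepD[of _ _ s] intro: keep_refl\<close>)

definition row_of :: iexp where
  "row_of = IAdd (IMul (IV ''j'') (IV ''n'')) (IV ''l'')"

definition add_piece :: com where
  "add_piece = For ''u'' coeff_count
     (RSet ''y'' (INum 0) (RAdd (RV ''y'')
       (RMul (RGet ''alpha'' (IAdd (IMul row_of coeff_count) (IV ''u'')))
         (RSub (RGet ''S'' (IAdd (IMul (IGet ''c'' row_of) coeff_count) (IV ''u'')))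
               (RGet ''S'' (IAdd (IMul (IGet ''b'' row_of) coeff_count) (IV ''u'')))))))"

abbreviation piece_term :: "state \<Rightarrow> nat \<Rightarrow> nat \<Rightarrow> nat \<Rightarrow> real" where
  "piece_term s d a u \<equiv> rmem s ''alpha'' (a * (d + 1) + u) *
     (rmem s ''S'' (imem s ''c'' a * (d + 1) + u) - rmem s ''S'' (imem s ''b'' a * (d + 1) + u))"

lemma wp_add_piece:
  assumes d: "imem s ''d'' 0 = d" "imem s ''n'' 0 = n" "imem s ''j'' 0 = j" "imem s ''l'' 0 = l"
    and post: "\<And>t s'. keep {''u''} {''y''} s s' \<Longrightarrow> drawn s' = drawn s \<Longrightarrow>
      rmem s' ''y'' 0 = rmem s ''y'' 0 + (\<Sum>u<d + 1. piece_term s d (j * n + l) u) \<Longrightarrow>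
      t \<le> 150 * (d + 1) \<Longrightarrow> Q t s'"
  shows "wp \<omega> add_piece s Q"
  unfolding add_piece_def
proof (rule wp_For[where n = "d + 1" and c = 100 and I = "\<lambda>i s'. imem s' ''u'' 0 = i \<and>
    keep {''u''} {''y''} s s' \<and> drawn s' = drawn s \<and>
    rmem s' ''y'' 0 = rmem s ''y'' 0 + (\<Sum>u<i. piece_term s d (j * n + l) u)"],
    goal_cases init counter step post)
  case (step i s')
  then have I: "imem s' ''u'' 0 = i" "keep {''u''} {''y''} s s'" "drawn s' = drawn s"
    "rmem s' ''y'' 0 = rmem s ''y'' 0 + (\<Sum>u<i. piece_term s d (j * n + l) u)"
    by auto
  have eqs: "imem s' ''d'' 0 = d" "imem s' ''n'' 0 = n" "imem s' ''j'' 0 = j" "imem s' ''l'' 0 = l"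
    "imem s' ''b'' = imem s ''b''" "imem s' ''c'' = imem s ''c''" "rmem s' ''S'' = rmem s ''S''"
    "rmem s' ''alpha'' = rmem s ''alpha''"
    using keepD[OF I(2)] d by simp_all
  show ?case using I eqs by (simp add: insert_absorb row_of_def)
next
  case (post t s')
  then show ?case by (intro assms) auto
qed (use d in \<open>auto simp: keepD[of _ _ s] intro: keep_refl\<close>)

definition project :: com where
  "project = For ''j'' (IV ''m'')
     (Seq (RSet ''y'' (INum 0) (RNat (INum 0)))
     (Seq (For ''l'' (IV ''n'') add_piece)
     (RSet ''Y'' (IAdd (IMul (IV ''p'') (IV ''m'')) (IV ''j'')) (RV ''y''))))"

definition projection :: "(nat \<Rightarrow> nat \<Rightarrow> real) \<Rightarrow> (nat \<Rightarrow> nat) \<Rightarrow> (nat \<Rightarrow> nat) \<Rightarrow> (nat \<Rightarrow> real) \<Rightarrow> nat \<Rightarrow> nat \<Rightarrow> nat \<Rightarrow> real" where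
  "projection M b c al n d j = (\<Sum>l<n. \<Sum>u<d + 1. al ((j * n + l) * (d + 1) + u) * (M (c (j * n + l)) u - M (b (j * n + l)) u))"

abbreviation state_projection :: "state \<Rightarrow> nat \<Rightarrow> nat \<Rightarrow> nat \<Rightarrow> real" where
  "state_projection s n d \<equiv>
     projection (\<lambda>i u. rmem s ''S'' (i * (d + 1) + u)) (imem s ''b'') (imem s ''c'') (rmem s ''alpha'') n d"

lemma wp_project:
  assumes d: "imem s ''d'' 0 = d" "imem s ''n'' 0 = n" "imem s ''m'' 0 = m"
    and post: "\<And>t s'. keep_sketch s s' \<Longrightarrow> drawn s' = drawn s \<Longrightarrow>
      (\<And>v. v < imem s ''p'' 0 * m \<Longrightarrow> rmem s' ''Y'' v = rmem s ''Y'' v) \<Longrightarrow>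
      (\<And>j. j < m \<Longrightarrow> rmem s' ''Y'' (imem s ''p'' 0 * m + j) =
        state_projection s n d j) \<Longrightarrow>
      t \<le> m * (200 * (d + 1) * (n + 1)) + 10 \<Longrightarrow> Q t s'"
  shows "wp \<omega> project s Q"
  unfolding project_def
proof (rule wp_For[where n = m and c = "n * (150 * (d + 1) + 12) + 40" and I = "\<lambda>i s'. imem s' ''j'' 0 = i \<and>
    keep_sketch s s' \<and> drawn s' = drawn s \<and>
    (\<forall>v < imem s ''p'' 0 * m. rmem s' ''Y'' v = rmem s ''Y'' v) \<and>
    (\<forall>j<i. rmem s' ''Y'' (imem s ''p'' 0 * m + j) =
      state_projection s n d j)"],
    goal_cases init counter step post)
  case (step j s')
  then have I: "imem s' ''j'' 0 = j" "keep_sketch s s'" "drawn s' = drawn s"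
    "\<And>v. v < imem s ''p'' 0 * m \<Longrightarrow> rmem s' ''Y'' v = rmem s ''Y'' v"
    "\<And>i. i<j \<Longrightarrow> rmem s' ''Y'' (imem s ''p'' 0 * m + i) =
      state_projection s n d i"
    by auto
  have k1: "imem s' ''n'' 0 = n" "imem s' ''d'' 0 = d" "imem s' ''m'' 0 = m" using d keepD[OF I(2)] by auto
  let ?add = "\<lambda>l. \<Sum>u<d + 1. piece_term s d (j * n + l) u"
  show ?case unfolding wp_simps
  proof (rule wp_For[where n = n and c = "150 * (d + 1)" and I = "\<lambda>i s2. imem s2 ''l'' 0 = i \<and>
      keep {''u'', ''l''} {''y''} s' s2 \<and> drawn s2 = drawn s' \<and> rmem s2 ''y'' 0 = (\<Sum>l<i. ?add l)"],
      goal_cases init counter step post)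
    case (step i s2)
    show ?case
    proof (rule wp_add_piece[where d = d and n = n and j = j and l = i], goal_cases d n j l post)
      case (post t s3)
      have I2: "imem s2 ''l'' 0 = i" "keep {''u'', ''l''} {''y''} s' s2" "drawn s2 = drawn s'"
        "rmem s2 ''y'' 0 = (\<Sum>l<i. ?add l)" using step by auto
      have k: "keep {''u'', ''l''} {''y''} s' s3" by (rule keep_trans[OF I2(2) post(1)]) auto
      have eqs: "imem s3 ''l'' = imem s2 ''l''" "rmem s2 ''alpha'' = rmem s ''alpha''" "rmem s2 ''S'' = rmem s ''S''"
        "imem s2 ''c'' = imem s ''c''" "imem s2 ''b'' = imem s ''b''"
        using keepD[OF post(1)] keepD[OF I2(2)] keepD[OF I(2)] by simp_all
      show ?case using I2(1,3,4) post(2,3,4) k eqs by (simp add: insert_absorb)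
    qed (use k1 I step keepD[of _ _ s' s2] in auto)
  next
    case (post t s2)
    then have I2: "keep {''u'', ''l''} {''y''} s' s2" "drawn s2 = drawn s'"
        "rmem s2 ''y'' 0 = (\<Sum>l<n. ?add l)" by auto
    have k: "keep_sketch s s2" by (rule keep_trans[OF I(2) I2(1)]) auto
    have eqs: "rmem s2 ''Y'' = rmem s' ''Y''" "imem s2 ''j'' = imem s' ''j''" "imem s2 ''m'' 0 = m" "imem s2 ''p'' = imem s ''p''"
      using keepD[OF I2(1)] keepD[OF I(2)] d by simp_all
    show ?case using post(2) I(1,3,4,5) I2(2,3) k eqs
      by (simp add: insert_absorb less_Suc_eq projection_def)
  qed (use k1 in \<open>auto simp: keepD[of _ _ s'] intro: keep_refl\<close>)
next
  case (post t s')
  have "t \<le> m * (200 * (d + 1) * (n + 1)) + 10"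
    by (rule cost_bound[OF post(2)]) (simp_all add: algebra_simps)
  with post(1) show ?case by (intro assms) auto
qed (use d in \<open>auto simp: keepD[of _ _ s] intro: keep_refl\<close>)

definition one_projection :: com where
  "one_projection = Seq clear_moments (Seq all_moments project)"

text \<open>\<open>B\<close> is the index of the first sample that the projection consumes.\<close>

definition sketch :: "family_input \<Rightarrow> nat \<Rightarrow> (nat \<Rightarrow> real) \<Rightarrow> nat \<Rightarrow> nat \<Rightarrow> real" where
  "sketch F q \<omega> B j = (\<Sum>l<npiece F. \<Sum>u<deg F + 1. coef F j l u *
     (moment \<omega> (table (nend F) (endp F)) q B (ridx F j l) u - moment \<omega> (table (nend F) (endp F)) q B (lidx F j l) u))"

text \<open>The part of \<open>init_state\<close> that all later phases read, stated through the
  contents of the cells so that it survives every command that writes other arrays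
  (\<open>input_loaded_keep\<close>). The two error parameters are read only while the counts are
  set up.\<close>

definition input_loaded :: "family_input \<Rightarrow> state \<Rightarrow> bool" where
  "input_loaded F s \<longleftrightarrow>
     imem s ''m'' 0 = nfun F \<and> imem s ''n'' 0 = npiece F \<and> imem s ''d'' 0 = deg F \<and> imem s ''s'' 0 = nend F \<and>
     (\<forall>j<nfun F. \<forall>l<npiece F. imem s ''b'' (j * npiece F + l) = lidx F j l \<and> imem s ''c'' (j * npiece F + l) = ridx F j l \<and>
        (\<forall>u<deg F + 1. rmem s ''alpha'' ((j * npiece F + l) * (deg F + 1) + u) = coef F j l u)) \<and>
     rmem s ''a'' = table (nend F) (endp F)"

lemma input_loaded_keep:
  assumes "input_loaded F s" "keep A B s s'"
    and "A \<inter> {''m'', ''n'', ''d'', ''s'', ''b'', ''c''} = {}" "B \<inter> {''a'', ''alpha''} = {}"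
  shows "input_loaded F s'"
proof -
  have "imem s' ''m'' = imem s ''m''" "imem s' ''n'' = imem s ''n''" "imem s' ''d'' = imem s ''d''" "imem s' ''s'' = imem s ''s''"
    "imem s' ''b'' = imem s ''b''" "imem s' ''c'' = imem s ''c''" "rmem s' ''a'' = rmem s ''a''" "rmem s' ''alpha'' = rmem s ''alpha''"
    using assms(3,4) by (auto intro!: keepD[OF assms(2)])
  then show ?thesis using assms(1) unfolding input_loaded_def by simp
qed

lemma index_bound: "j < m \<Longrightarrow> l < n \<Longrightarrow> j * n + l < m * n" for j :: nat
proof -
  assume "j < m" "l < n"
  then have "j * n + l < Suc j * n" by simp
  also have "\<dots> \<le> m * n" using \<open>j < m\<close> by (intro mult_right_mono) auto
  finally show ?thesis .
qed

lemma input_loaded_init: "input_loaded F (init_state F \<delta> \<epsilon>)"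
proof -
  have "(j * npiece F + l) * (deg F + 1) + u < nfun F * npiece F * (deg F + 1)"
    if "j < nfun F" "l < npiece F" "u < deg F + 1" for j l u
    by (intro index_bound that)
  moreover have "((j * npiece F + l) * (deg F + 1) + u) div (deg F + 1) = j * npiece F + l"
    "((j * npiece F + l) * (deg F + 1) + u) mod (deg F + 1) = u"
    if "u < deg F + 1" for j l u
    using that by (simp_all del: mult_Suc_right add_mult_distrib add: div_mult_self3)
  ultimately show ?thesis
    unfolding input_loaded_def init_state_def Let_def
    using index_bound[of _ "nfun F" _ "npiece F"] by (auto simp: scalar_def table_def)
qed

abbreviation sweep_cost :: "family_input \<Rightarrow> nat \<Rightarrow> nat \<Rightarrow> nat" where
  "sweep_cost F q c \<equiv> (deg F + 1) * (200 * nend F * (q + 1) + 200 * nfun F * (npiece F + 1) + c)"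

lemma wp_one_projection:
  assumes wf: "wf_input F" and inp: "input_loaded F s" "imem s ''q'' 0 = q"
    and post: "\<And>t s'. keep_projection s s' \<Longrightarrow>
      drawn s' = drawn s + nend F * q \<Longrightarrow>
      (\<And>v. v < imem s ''p'' 0 * nfun F \<Longrightarrow> rmem s' ''Y'' v = rmem s ''Y'' v) \<Longrightarrow>
      (\<And>j. j < nfun F \<Longrightarrow> rmem s' ''Y'' (imem s ''p'' 0 * nfun F + j) = sketch F q \<omega> (drawn s) j) \<Longrightarrow>
      t \<le> sweep_cost F q 80 \<Longrightarrow> Q t s'"
  shows "wp \<omega> one_projection s Q"
  unfolding one_projection_def wp_simps
proof (rule wp_clear_moments[where d = "deg F"], goal_cases d post)
  case (post t1 s1)
  note s1 = post
  have inp1: "input_loaded F s1" "imem s1 ''q'' = imem s ''q''"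
    using input_loaded_keep[OF inp(1) s1(1)] keepD[OF s1(1)] by simp_all
  show ?case
  proof (rule wp_all_moments[where d = "deg F" and q = q and K = "nend F"], goal_cases d q K M post)
    case (post t2 s2)
    note s2 = post
    have inp2: "input_loaded F s2"
      using input_loaded_keep[OF inp1(1) s2(1)] by simp
    show ?case
    proof (rule wp_project[where d = "deg F" and n = "npiece F" and m = "nfun F"], goal_cases d n m post)
      case (post t3 s3)
      note s3 = post
      have p: "imem s2 ''p'' = imem s ''p''" "rmem s2 ''Y'' = rmem s ''Y''" "rmem s1 ''a'' = table (nend F) (endp F)"
        using keepD[OF s2(1)] keepD[OF s1(1)] inp1(1) by (simp_all add: input_loaded_def)
      have "rmem s3 ''Y'' (imem s ''p'' 0 * nfun F + j) = sketch F q \<omega> (drawn s) j" if j: "j < nfun F" for j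
      proof -
        have "rmem s2 ''S'' (i * (deg F + 1) + u) = moment \<omega> (table (nend F) (endp F)) q (drawn s) i u"
          if "i < nend F" "u < deg F + 1" for i u
          using s2(3)[of i u] that s1(2) p(3) by simp
        moreover have "ridx F j l < nend F" "lidx F j l < nend F" if "l < npiece F" for l
          using wf j that unfolding wf_input_def by (meson less_trans)+
        ultimately show ?thesis
          using s3(4)[OF j] inp2 j p(1) unfolding input_loaded_def sketch_def projection_def by simp
      qed
      moreover have "keep_projection s s3"
      proof -
        have "keep_projection s s2"
          by (rule keep_trans[OF _ s2(1)], rule keep_trans[OF keep_refl s1(1)]) auto
        then show ?thesis by (rule keep_trans[OF _ s3(1)]) auto
      qed
      moreover have "t1 + (t2 + t3) \<le> sweep_cost F q 80"
        using s1(4) s2(4) s3(5) by (simp add: algebra_simps)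
      moreover have "drawn s3 = drawn s + nend F * q" using s1(2) s2(2) s3(2) by simp
      moreover have "rmem s3 ''Y'' v = rmem s ''Y'' v" if "v < imem s ''p'' 0 * nfun F" for v
        using s3(3)[of v] that p by simp
      ultimately show ?case by (intro assms)
    qed (use inp2 in \<open>simp_all add: input_loaded_def\<close>)
  qed (use inp1 inp s1 in \<open>simp_all add: input_loaded_def\<close>)
qed (use inp in \<open>simp add: input_loaded_def\<close>)

definition all_projections :: com where
  "all_projections = For ''p'' (IV ''N'') one_projection"

text \<open>Projection \<open>p\<close> reads its samples from index \<open>p * (nend F * q)\<close>
  on. Different projections thus use disjoint blocks of samples, the source of their independence in
  \<open>block_combinations\<close>.\<close>

lemma wp_all_projections:
  assumes wf: "wf_input F" and inp: "input_loaded F s" "imem s ''q'' 0 = q" "imem s ''N'' 0 = N" "drawn s = 0"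
    and post: "\<And>t s'. keep_projections s s' \<Longrightarrow>
      (\<And>p j. p < N \<Longrightarrow> j < nfun F \<Longrightarrow> rmem s' ''Y'' (p * nfun F + j) = sketch F q \<omega> (p * (nend F * q)) j) \<Longrightarrow>
      t \<le> N * (sweep_cost F q 100) + 10 \<Longrightarrow> Q t s'"
  shows "wp \<omega> all_projections s Q"
  unfolding all_projections_def
proof (rule wp_For[where n = N and c = "sweep_cost F q 80" and I = "\<lambda>i s'. imem s' ''p'' 0 = i \<and>
    keep_projections s s' \<and>
    drawn s' = i * (nend F * q) \<and>
    (\<forall>p<i. \<forall>j<nfun F. rmem s' ''Y'' (p * nfun F + j) = sketch F q \<omega> (p * (nend F * q)) j)"],
    goal_cases init counter step post)
  case (step i s')
  then have I: "imem s' ''p'' 0 = i"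
    "keep_projections s s'"
    "drawn s' = i * (nend F * q)"
    "\<And>p j. p<i \<Longrightarrow> j < nfun F \<Longrightarrow> rmem s' ''Y'' (p * nfun F + j) = sketch F q \<omega> (p * (nend F * q)) j" by auto
  have inp': "input_loaded F s'" "imem s' ''q'' 0 = q"
    using input_loaded_keep[OF inp(1) I(2)] keepD[OF I(2)] inp by simp_all
  show ?case
  proof (rule wp_one_projection[OF wf inp'], goal_cases post)
    case (post t s2)
    have k: "keep_projections s s2"
      by (rule keep_trans[OF I(2) post(1)]) auto
    have p: "imem s2 ''p'' = imem s' ''p''" using keepD[OF post(1)] by simp
    have "rmem s2 ''Y'' (p * nfun F + j) = sketch F q \<omega> (p * (nend F * q)) j" if "p < Suc i" "j < nfun F" for p j
    proof (cases "p = i")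
      case True
      then show ?thesis using post(4)[OF that(2)] I by simp
    next
      case False
      then show ?thesis using that I post(3)[OF index_bound] by simp
    qed
    then show ?case using I(1) k p post(2,5) I(3) by (simp add: insert_absorb)
  qed
next
  case (post t s')
  have "t \<le> N * (sweep_cost F q 100) + 10"
    by (rule cost_bound[OF post(2)]) (simp_all add: add_mult_distrib2)
  with post(1) show ?case by (intro assms) auto
qed (use inp in \<open>auto simp: keepD[of _ _ s] intro: keep_refl\<close>)

section \<open>Estimating the distances of all pairs\<close>

definition scan_step :: "real \<Rightarrow> real \<Rightarrow> real \<times> real \<Rightarrow> real \<times> real" where
  "scan_step a A = (\<lambda>(\<rho>, y). if A < \<rho> then (\<rho> / A, y * a) else if \<rho> < 1 then (\<rho> * A, y / a) else (\<rho>, y))"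

text \<open>With \<open>G\<close> the geometric mean of the \<open>\<bar>x p\<bar>\<close>, the loop maintains \<open>\<rho> = (G / y) ^ (2 * N)\<close>.
  Comparing \<open>\<rho>\<close> with \<open>1\<close> and \<open>a ^ (2 * N)\<close> thus amounts to comparing \<open>G\<close> with \<open>y\<close> and \<open>a * y\<close>, without
  extracting a root.\<close>

definition geometric_mean_scan :: "real \<Rightarrow> nat \<Rightarrow> (nat \<Rightarrow> real) \<Rightarrow> real" where
  "geometric_mean_scan a N x = snd ((scan_step a ((a * a) ^ N) ^^ N) (\<Prod>p<N. (x p / \<bar>x 0\<bar>)\<^sup>2, \<bar>x 0\<bar>))"

definition diff_exp :: rexp where
  "diff_exp = RSub (RGet ''Y'' (IAdd (IMul (IV ''p'') (IV ''m'')) (IV ''j''))) (RGet ''Y'' (IAdd (IMul (IV ''p'') (IV ''m'')) (IV ''g'')))"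

definition init_estimate :: com where
  "init_estimate =
     Seq (ISet ''p'' (INum 0) (INum 0))
    (Seq (RSet ''y'' (INum 0) diff_exp)
    (Seq (Cond (RLess (RV ''y'') (RNat (INum 0))) (RSet ''y'' (INum 0) (RSub (RNat (INum 0)) (RV ''y''))) Skip)
    (RSet ''R'' (INum 0) (RNat (INum 1)))))"

text \<open>Dividing by the first difference fits the product to the starting guess
  \<open>\<bar>x 0\<bar>\<close>, and squaring replaces absolute values. If the first difference is
  0, the quotients are 0 and the guess stays 0.\<close>

definition multiply_ratios :: com where
  "multiply_ratios = For ''p'' (IV ''N'')
       (Seq (RSet ''t'' (INum 0) (RDiv diff_exp (RV ''y'')))
            (RSet ''R'' (INum 0) (RMul (RV ''R'') (RMul (RV ''t'') (RV ''t'')))))"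

definition scan_loop :: com where
  "scan_loop = For ''p'' (IV ''N'')
       (Cond (RLess (RV ''Q'') (RV ''R''))
         (Seq (RSet ''R'' (INum 0) (RDiv (RV ''R'') (RV ''Q'')))
              (RSet ''y'' (INum 0) (RMul (RV ''y'') (RAdd (RNat (INum 1)) (RV ''e'')))))
       (Cond (RLess (RV ''R'') (RNat (INum 1)))
         (Seq (RSet ''R'' (INum 0) (RMul (RV ''R'') (RV ''Q'')))
              (RSet ''y'' (INum 0) (RDiv (RV ''y'') (RAdd (RNat (INum 1)) (RV ''e'')))))
         Skip))"

definition estimate_pair :: com where
  "estimate_pair = Seq init_estimate (Seq multiply_ratios scan_loop)"

abbreviation scan_difference :: "real \<Rightarrow> nat \<Rightarrow> (nat \<Rightarrow> real) \<Rightarrow> nat \<Rightarrow> nat \<Rightarrow> nat \<Rightarrow> real" where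
  "scan_difference a N Y m j g \<equiv> geometric_mean_scan a N (\<lambda>p. Y (p * m + j) - Y (p * m + g))"

lemma wp_estimate_pair:
  assumes inp: "imem s ''m'' 0 = m" "imem s ''N'' 0 = N" "imem s ''j'' 0 = j" "imem s ''g'' 0 = g"
      "rmem s ''Q'' 0 = (a * a) ^ N" "1 + rmem s ''e'' 0 = a"
    and post: "\<And>t s'. keep {''p''} {''y'', ''R'', ''t''} s s' \<Longrightarrow>
      rmem s' ''y'' 0 = scan_difference a N (rmem s ''Y'') m j g \<Longrightarrow>
      t \<le> 200 * (N + 1) \<Longrightarrow> Q t s'"
  shows "wp \<omega> estimate_pair s Q"
proof -
  define x where "x p = rmem s ''Y'' (p * m + j) - rmem s ''Y'' (p * m + g)" for p
  define A where "A = (a * a) ^ N"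
  have Q0: "rmem s ''Q'' 0 = A" using inp by (simp add: A_def)
  let ?K = "\<lambda>s'. keep {''p''} {''y'', ''R'', ''t''} s s'"
  have diff: "rval diff_exp s' = x (imem s' ''p'' 0)" if "?K s'" for s'
    using keepD[OF that] inp by (simp add: diff_exp_def x_def)
  have [simp]: "rcost diff_exp = 19" by (simp add: diff_exp_def)
  have init: "wp \<omega> init_estimate s (\<lambda>t s'. ?K s' \<and> rmem s' ''y'' 0 = \<bar>x 0\<bar> \<and> rmem s' ''R'' 0 = 1 \<and> t \<le> 80)"
  proof -
    have K: "?K (iput ''p'' 0 0 s)" by (simp add: keep_refl)
    show ?thesis using diff[OF K] by (simp add: init_estimate_def keep_refl)
  qed
  have prod: "wp \<omega> multiply_ratios s1
      (\<lambda>t s'. ?K s' \<and> rmem s' ''y'' 0 = \<bar>x 0\<bar> \<and> rmem s' ''R'' 0 = (\<Prod>p<N. (x p / \<bar>x 0\<bar>)\<^sup>2) \<and> t \<le> N * 60 + 10)"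
    if s1: "?K s1" "rmem s1 ''y'' 0 = \<bar>x 0\<bar>" "rmem s1 ''R'' 0 = 1" for s1
    unfolding multiply_ratios_def
  proof (rule wp_For[where n = N and c = 40 and I = "\<lambda>i s'. imem s' ''p'' 0 = i \<and> ?K s' \<and>
      rmem s' ''y'' 0 = \<bar>x 0\<bar> \<and> rmem s' ''R'' 0 = (\<Prod>p<i. (x p / \<bar>x 0\<bar>)\<^sup>2)"], goal_cases init counter step post)
    case (step i s')
    then show ?case using diff[of s'] by (simp add: insert_absorb power2_eq_square)
  next
    case (post t s')
    have "t \<le> N * 60 + 10" by (rule cost_bound[OF post(2)]) simp_all
    with post(1) show ?case by auto
  qed (use s1 inp in \<open>auto simp: keepD[of _ _ s] insert_absorb\<close>)
  have scan: "wp \<omega> scan_loop s1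
      (\<lambda>t s'. ?K s' \<and> rmem s' ''y'' 0 = snd ((scan_step a A ^^ N) (rmem s1 ''R'' 0, rmem s1 ''y'' 0)) \<and> t \<le> N * 100 + 10)"
    if s1: "?K s1" for s1
    unfolding scan_loop_def
  proof (rule wp_For[where n = N and c = 60 and I = "\<lambda>i s'. imem s' ''p'' 0 = i \<and> ?K s' \<and>
      (rmem s' ''R'' 0, rmem s' ''y'' 0) = (scan_step a A ^^ i) (rmem s1 ''R'' 0, rmem s1 ''y'' 0)"], goal_cases init counter step post)
    case (step i s')
    then have I: "imem s' ''p'' 0 = i" "?K s'"
      and funpow: "(scan_step a A ^^ i) (rmem s1 ''R'' 0, rmem s1 ''y'' 0) = (rmem s' ''R'' 0, rmem s' ''y'' 0)" by auto
    have eqs: "rmem s' ''Q'' 0 = A" "1 + rmem s' ''e'' 0 = a" using keepD[OF I(2)] inp Q0 by simp_all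
    have st: "scan_step a A (\<rho>, y) = (if A < \<rho> then (\<rho> / A, y * a) else if \<rho> < 1 then (\<rho> * A, y / a) else (\<rho>, y))" for \<rho> y
      by (simp add: scan_step_def)
    show ?case using I eqs by (simp add: funpow st insert_absorb)
  next
    case (post t s')
    have "t \<le> N * 100 + 10" by (rule cost_bound[OF post(2)]) simp_all
    with post(1) show ?case by (auto dest: arg_cong[where f = snd])
  qed (use s1 inp in \<open>auto simp: keepD[of _ _ s] insert_absorb\<close>)
  show ?thesis
    unfolding estimate_pair_def wp_simps
  proof (rule wp_mono[OF init], elim conjE)
    fix t1 :: nat and s1 assume s1: "?K s1" "rmem s1 ''y'' 0 = \<bar>x 0\<bar>" "rmem s1 ''R'' 0 = 1" "t1 \<le> 80"
    show "wp \<omega> multiply_ratios s1 (\<lambda>t s'. wp \<omega> scan_loop s' (\<lambda>t' s''. Q (t1 + (t + t')) s''))"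
    proof (rule wp_mono[OF prod[OF s1(1-3)]], elim conjE)
      fix t2 :: nat and s2 assume s2: "?K s2" "rmem s2 ''y'' 0 = \<bar>x 0\<bar>" "rmem s2 ''R'' 0 = (\<Prod>p<N. (x p / \<bar>x 0\<bar>)\<^sup>2)" "t2 \<le> N * 60 + 10"
      show "wp \<omega> scan_loop s2 (\<lambda>t' s''. Q (t1 + (t2 + t')) s'')"
      proof (rule wp_mono[OF scan[OF s2(1)]], elim conjE)
        fix t3 :: nat and s3 assume s3: "?K s3" "rmem s3 ''y'' 0 = snd ((scan_step a A ^^ N) (rmem s2 ''R'' 0, rmem s2 ''y'' 0))" "t3 \<le> N * 100 + 10"
        show "Q (t1 + (t2 + t3)) s3"
        proof (rule post)
          show "rmem s3 ''y'' 0 = scan_difference a N (rmem s ''Y'') m j g"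
            unfolding s3(2) s2(2,3) geometric_mean_scan_def A_def x_def ..
        qed (use s1(4) s2(4) s3(1,3) in auto)
      qed
    qed
  qed
qed

definition all_pairs :: com where
  "all_pairs = For ''j'' (IV ''m'') (For ''g'' (IV ''m'')
     (Seq estimate_pair (RSet ''D'' (IAdd (IMul (IV ''j'') (IV ''m'')) (IV ''g'')) (RV ''y''))))"

lemma wp_all_pairs:
  assumes inp: "imem s ''m'' 0 = m" "imem s ''N'' 0 = N" "rmem s ''Q'' 0 = (a * a) ^ N" "1 + rmem s ''e'' 0 = a"
    and post: "\<And>t s'.
      (\<And>j g. j < m \<Longrightarrow> g < m \<Longrightarrow> rmem s' ''D'' (j * m + g) =
         scan_difference a N (rmem s ''Y'') m j g) \<Longrightarrow>
      t \<le> m * (m * (200 * (N + 1) + 40) + 40) + 10 \<Longrightarrow> Q t s'"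
  shows "wp \<omega> all_pairs s Q"
proof -
  let ?K = "\<lambda>s'. keep {''p'', ''j'', ''g''} {''y'', ''R'', ''t'', ''D''} s s'"
  let ?D = "\<lambda>j g. scan_difference a N (rmem s ''Y'') m j g"
  have row: "wp \<omega> (For ''g'' (IV ''m'')
     (Seq estimate_pair (RSet ''D'' (IAdd (IMul (IV ''j'') (IV ''m'')) (IV ''g'')) (RV ''y'')))) s1
     (\<lambda>t s2. ?K s2 \<and> imem s2 ''j'' = imem s1 ''j'' \<and> (\<forall>v<j * m. rmem s2 ''D'' v = rmem s1 ''D'' v) \<and>
        (\<forall>g<m. rmem s2 ''D'' (j * m + g) = ?D j g) \<and> t \<le> m * (200 * (N + 1) + 40) + 10)"
    if s1: "?K s1" "imem s1 ''j'' 0 = j" for s1 j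
  proof (rule wp_For[where n = m and c = "200 * (N + 1) + 20" and I = "\<lambda>i s2. imem s2 ''g'' 0 = i \<and> ?K s2 \<and>
      imem s2 ''j'' = imem s1 ''j'' \<and> (\<forall>v<j * m. rmem s2 ''D'' v = rmem s1 ''D'' v) \<and>
      (\<forall>g<i. rmem s2 ''D'' (j * m + g) = ?D j g)"], goal_cases init counter step post)
    case (step i s2)
    then have I: "imem s2 ''g'' 0 = i" "?K s2" "imem s2 ''j'' = imem s1 ''j''"
      "\<And>v. v<j * m \<Longrightarrow> rmem s2 ''D'' v = rmem s1 ''D'' v" "\<And>g. g<i \<Longrightarrow> rmem s2 ''D'' (j * m + g) = ?D j g" by auto
    have eqs: "imem s2 ''m'' 0 = m" "imem s2 ''N'' 0 = N" "rmem s2 ''Q'' 0 = (a * a) ^ N" "1 + rmem s2 ''e'' 0 = a"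
      "rmem s2 ''Y'' = rmem s ''Y''"
      using keepD[OF I(2)] inp by simp_all
    show ?case unfolding wp_simps
    proof (rule wp_estimate_pair[where m = m and N = N and j = j and g = i and a = a], goal_cases m N j g Q e post)
      case (post t s3)
      have k: "?K s3" by (rule keep_trans[OF I(2) post(1)]) auto
      have eqs3: "imem s3 ''m'' 0 = m" "imem s3 ''j'' = imem s1 ''j''" "imem s3 ''g'' 0 = i" "rmem s3 ''D'' = rmem s2 ''D''"
        using keepD[OF post(1)] eqs I by simp_all
      show ?case using k eqs3 post(2,3) eqs(5) I(4,5) s1(2) by (simp add: insert_absorb less_Suc_eq)
    qed (use eqs I s1 in simp_all)
  next
    case (post t s2)
    have "t \<le> m * (200 * (N + 1) + 40) + 10" by (rule cost_bound[OF post(2)]) simp_all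
    with post(1) show ?case by auto
  qed (use s1 inp in \<open>auto simp: keepD[of _ _ s] insert_absorb\<close>)
  show ?thesis unfolding all_pairs_def
  proof (rule wp_For[where n = m and c = "m * (200 * (N + 1) + 40) + 10" and I = "\<lambda>i s2. imem s2 ''j'' 0 = i \<and> ?K s2 \<and>
      (\<forall>j<i. \<forall>g<m. rmem s2 ''D'' (j * m + g) = ?D j g)"], goal_cases init counter step post)
    case (step i s1)
    then have I: "imem s1 ''j'' 0 = i" "?K s1" "\<And>j g. j < i \<Longrightarrow> g < m \<Longrightarrow> rmem s1 ''D'' (j * m + g) = ?D j g" by auto
    show ?case
    proof (rule wp_mono[OF row[OF I(2,1)]], elim conjE)
      fix t s2 assume s2: "?K s2" "imem s2 ''j'' = imem s1 ''j''" "\<forall>v<i * m. rmem s2 ''D'' v = rmem s1 ''D'' v"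
        "\<forall>g<m. rmem s2 ''D'' (i * m + g) = ?D i g" "t \<le> m * (200 * (N + 1) + 40) + 10"
      have "rmem s2 ''D'' (j * m + g) = ?D j g" if "j < Suc i" "g < m" for j g
        using that s2(3,4) I(3) index_bound[of j i g m] by (cases "j = i") auto
      then show "t \<le> m * (200 * (N + 1) + 40) + 10 \<and> imem (iput ''j'' 0 (Suc (imem s2 ''j'' 0)) s2) ''j'' 0 = Suc i \<and>
          ?K (iput ''j'' 0 (Suc (imem s2 ''j'' 0)) s2) \<and>
          (\<forall>j<Suc i. \<forall>g<m. rmem (iput ''j'' 0 (Suc (imem s2 ''j'' 0)) s2) ''D'' (j * m + g) = ?D j g)"
        using s2(1,2,5) I(1) by (simp add: insert_absorb)
    qed
  next
    case (post t s')
    have "t \<le> m * (m * (200 * (N + 1) + 40) + 40) + 10" by (rule cost_bound[OF post(2)]) simp_all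
    with post(1) show ?case by (intro assms) auto
  qed (use inp in \<open>auto simp: keepD[of _ _ s] intro: keep_refl\<close>)
qed

section \<open>Computing the parameters\<close>

lemma wp_counting_loop:
  assumes counter: "\<And>c. imem (\<sigma> c) v 0 = c" and le: "a \<le> n"
    and guard: "\<And>c. a \<le> c \<Longrightarrow> c \<le> n \<Longrightarrow> bval b (\<sigma> c) \<longleftrightarrow> c < n"
    and step: "\<And>c. a \<le> c \<Longrightarrow> c < n \<Longrightarrow> wp \<omega> P (\<sigma> c) (\<lambda>t s'. t \<le> C \<and> s' = \<sigma> (Suc c))"
    and post: "\<And>t. t \<le> (n + 1) * (1 + bcost b + C) \<Longrightarrow> Q t (\<sigma> n)"
  shows "wp \<omega> (Loop b P) (\<sigma> a) Q"
proof (rule wp_Loop[where I = "\<lambda>s. \<exists>c\<ge>a. c \<le> n \<and> s = \<sigma> c" and \<mu> = "\<lambda>s. n - imem s v 0" and c = C])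
  show "\<exists>c\<ge>a. c \<le> n \<and> \<sigma> a = \<sigma> c" using le by blast
next
  fix s assume "\<exists>c\<ge>a. c \<le> n \<and> s = \<sigma> c" "bval b s"
  then obtain c where c: "a \<le> c" "c < n" "s = \<sigma> c" using guard by auto
  show "wp \<omega> P s (\<lambda>t s'. t \<le> C \<and> (\<exists>c\<ge>a. c \<le> n \<and> s' = \<sigma> c) \<and> n - imem s' v 0 < n - imem s v 0)"
    unfolding c(3) by (rule wp_mono[OF step[OF c(1,2)]]) (use c(1,2) in \<open>auto simp: counter intro: Suc_leI le_SucI\<close>)
next
  fix t s' assume "\<exists>c\<ge>a. c \<le> n \<and> s' = \<sigma> c" "\<not> bval b s'" and t: "t \<le> (n - imem (\<sigma> a) v 0) * (1 + bcost b + C) + 1 + bcost b"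
  then have "s' = \<sigma> n" using guard by (metis order_le_less)
  moreover have "(n - a) * (1 + bcost b + C) \<le> n * (1 + bcost b + C)" by (intro mult_right_mono) auto
  ultimately show "Q t s'" using t post[of t] by (simp add: counter)
qed

lemma iput_iput [simp]: "iput v i x (iput v i y s) = iput v i x s"
  by (simp add: iput_def)

text \<open>Without a floor operation the ceiling of a quotient is found by counting multiples of
  the denominator. The cost is linear in the result, which is harmless since the result is the
  number of cells or projections to be processed anyway.\<close>

definition count_up :: "string \<Rightarrow> rexp \<Rightarrow> iexp \<Rightarrow> com" where
  "count_up v r b = Seq (ISet v (INum 0) (INum 1))
     (Loop (RLess (RMul (RNat (IV v)) r) (RNat b)) (ISet v (INum 0) (IAdd (IV v) (INum 1))))"

lemma wp_count_up:
  fixes x :: real and B :: nat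
  defines "n \<equiv> max 1 (nat \<lceil>B / x\<rceil>)"
  assumes r: "\<And>c. rval r (iput v 0 c s) = x" and b: "\<And>c. ival b (iput v 0 c s) = B" and x: "0 < x"
    and post: "\<And>t. t \<le> (n + 1) * (rcost r + icost b + 20) \<Longrightarrow> Q t (iput v 0 n s)"
  shows "wp \<omega> (count_up v r b) s Q"
  unfolding count_up_def wp_simps ival.simps
proof (rule wp_counting_loop[where v = v and n = n and \<sigma> = "\<lambda>c. iput v 0 c s" and a = 1 and C = 6])
  fix c assume c: "1 \<le> c" "c \<le> n"
  have "real c * x < B \<longleftrightarrow> c < nat \<lceil>B / x\<rceil>"
    using x by (simp add: pos_less_divide_eq[symmetric] less_ceiling_iff zless_nat_eq_int_zless)
  also have "\<dots> \<longleftrightarrow> c < n" using c by (auto simp: n_def)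
  finally show "bval (RLess (RMul (RNat (IV v)) r) (RNat b)) (iput v 0 c s) \<longleftrightarrow> c < n"
    by (simp add: r b)
next
  fix t assume t: "t \<le> (n + 1) * (1 + bcost (RLess (RMul (RNat (IV v)) r) (RNat b)) + 6)"
  have "1 + icost (INum 0) + icost (INum 1) + t \<le> (n + 1) * (rcost r + icost b + 20)"
    using t by (simp add: algebra_simps)
  then show "Q (1 + icost (INum 0) + icost (INum 1) + t) (iput v 0 n s)" by (rule post)
qed (auto simp: n_def)

text \<open>Replaces the logarithm of \<open>m / \<delta>\<close>, which the machine cannot
  evaluate; the count is 0 if \<open>m \<le> \<delta>\<close>.\<close>

definition count_doublings :: com where
  "count_doublings = Seq (RSet ''t'' (INum 0) (RNat (INum 1))) (Seq (ISet ''k'' (INum 0) (INum 0))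
     (Loop (RLess (RMul (RV ''t'') (RV ''delta'')) (RNat (IV ''m'')))
       (Seq (RSet ''t'' (INum 0) (RAdd (RV ''t'') (RV ''t''))) (ISet ''k'' (INum 0) (IAdd (IV ''k'') (INum 1))))))"

lemma wp_count_doublings:
  fixes \<delta> :: real
  assumes s: "imem s ''m'' 0 = m" "rmem s ''delta'' 0 = \<delta>" "0 < m" "0 < \<delta>"
    and post: "\<And>t s'. keep {''k''} {''t''} s s' \<Longrightarrow> drawn s' = drawn s \<Longrightarrow>
      imem s' ''k'' 0 = nat \<lceil>log 2 (m / \<delta>)\<rceil> \<Longrightarrow>
      t \<le> (nat \<lceil>log 2 (m / \<delta>)\<rceil> + 1) * 50 \<Longrightarrow> Q t s'"
  shows "wp \<omega> count_doublings s Q"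
proof -
  define n where "n = nat \<lceil>log 2 (m / \<delta>)\<rceil>"
  define \<sigma> where "\<sigma> c = iput ''k'' 0 c (rput ''t'' 0 (2 ^ c) s)" for c
  have put: "rput v i x (rput v i y s) = rput v i x s" "rput v i x (iput w j c s) = iput w j c (rput v i x s)"
    for v i x y w j c s
    by (simp_all add: rput_def iput_def)
  have "wp \<omega> (Loop (RLess (RMul (RV ''t'') (RV ''delta'')) (RNat (IV ''m'')))
       (Seq (RSet ''t'' (INum 0) (RAdd (RV ''t'') (RV ''t''))) (ISet ''k'' (INum 0) (IAdd (IV ''k'') (INum 1)))))
     (\<sigma> 0) (\<lambda>t. Q (4 + (3 + t)))"
  proof (rule wp_counting_loop[where v = "''k''" and n = n and C = 20])
    fix c assume c: "0 \<le> c" "c \<le> n"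
    have "2 ^ c * \<delta> < m \<longleftrightarrow> 2 powr c < m / \<delta>"
      using s by (simp add: pos_less_divide_eq powr_realpow)
    also have "\<dots> \<longleftrightarrow> c < log 2 (m / \<delta>)"
      using s by (subst less_log_iff) auto
    also have "\<dots> \<longleftrightarrow> c < n"
      by (simp add: n_def less_ceiling_iff zless_nat_eq_int_zless)
    finally show "bval (RLess (RMul (RV ''t'') (RV ''delta'')) (RNat (IV ''m''))) (\<sigma> c) \<longleftrightarrow> c < n"
      using s by (simp add: \<sigma>_def)
  next
    fix t assume "t \<le> (n + 1) * (1 + bcost (RLess (RMul (RV ''t'') (RV ''delta'')) (RNat (IV ''m''))) + 20)"
    then show "Q (4 + (3 + t)) (\<sigma> n)"
      by (intro post) (auto simp: \<sigma>_def keep_refl n_def)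
  qed (auto simp: \<sigma>_def put)
  then show ?thesis by (simp add: count_doublings_def \<sigma>_def put numeral_eq_Suc)
qed

text \<open>The threshold \<open>(1 + e) ^ (2 * N)\<close> is the same for all pairs and is computed
  once; the even exponent matches the squared ratios.\<close>

definition compute_power :: com where
  "compute_power = Seq (RSet ''Q'' (INum 0) (RNat (INum 1))) (For ''p'' (IV ''N'')
     (RSet ''Q'' (INum 0) (RMul (RV ''Q'') (RMul (RAdd (RNat (INum 1)) (RV ''e'')) (RAdd (RNat (INum 1)) (RV ''e''))))))"

lemma wp_compute_power:
  assumes s: "imem s ''N'' 0 = N" "1 + rmem s ''e'' 0 = a"
    and post: "\<And>t s'. keep {''p''} {''Q''} s s' \<Longrightarrow> drawn s' = drawn s \<Longrightarrow> rmem s' ''Q'' 0 = (a * a) ^ N \<Longrightarrow>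
      t \<le> (N + 1) * 50 \<Longrightarrow> Q t s'"
  shows "wp \<omega> compute_power s Q"
  unfolding compute_power_def wp_simps
proof (rule wp_For[where n = N and c = 30 and I = "\<lambda>i s'. imem s' ''p'' 0 = i \<and> keep {''p''} {''Q''} s s' \<and>
    drawn s' = drawn s \<and> rmem s' ''Q'' 0 = (a * a) ^ i"], goal_cases init counter step post)
  case (step i s')
  then have I: "imem s' ''p'' 0 = i" "keep {''p''} {''Q''} s s'" "drawn s' = drawn s" "rmem s' ''Q'' 0 = (a * a) ^ i" by auto
  have "1 + rmem s' ''e'' 0 = a" using keepD[OF I(2)] s by simp
  then show ?case using I by (simp add: insert_absorb mult.commute)
next
  case (post t s')
  then show ?case by (intro assms) (auto simp: algebra_simps)
qed (use s in \<open>auto simp: keepD[of _ _ s] intro: keep_refl\<close>)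

text \<open>The three approximations (quadrature, geometric mean, root) each get an eighth of the error. The
  constant in \<open>cells\<close> is that of \<open>quadrature_abs_poly\<close>; the one in \<open>projections\<close> is 8 times the
  denominator 48 of the tail bound, so that each pair fails with probability at most \<open>\<delta> / m\<^sup>2\<close>.\<close>

definition accuracy :: "real \<Rightarrow> real" where
  "accuracy \<epsilon> = (if \<epsilon> < 1 then \<epsilon> / 8 else 1 / 8)"

definition doublings :: "nat \<Rightarrow> real \<Rightarrow> nat" where
  "doublings m \<delta> = nat \<lceil>log 2 (m / \<delta>)\<rceil>"

definition cells :: "nat \<Rightarrow> real \<Rightarrow> nat" where
  "cells d \<epsilon> = max 1 (nat \<lceil>real (384 * ((d + 1) * (d + 1))) / accuracy \<epsilon>\<rceil>)"

definition projections :: "nat \<Rightarrow> real \<Rightarrow> real \<Rightarrow> nat" where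
  "projections m \<delta> \<epsilon> = max 1 (nat \<lceil>real (384 * (doublings m \<delta> + 1)) / (accuracy \<epsilon> * accuracy \<epsilon>)\<rceil>)"

definition choose_accuracy :: com where
  "choose_accuracy = Cond (RLess (RV ''epsilon'') (RNat (INum 1)))
       (RSet ''e'' (INum 0) (RDiv (RV ''epsilon'') (RNat (INum 8))))
       (RSet ''e'' (INum 0) (RDiv (RNat (INum 1)) (RNat (INum 8))))"

definition set_counts :: com where
  "set_counts = Seq count_doublings
    (Seq (count_up ''q'' (RV ''e'') (IMul (INum 384) (IMul coeff_count coeff_count)))
    (Seq (count_up ''N'' (RMul (RV ''e'') (RV ''e'')) (IMul (INum 384) (IAdd (IV ''k'') (INum 1))))
    compute_power))"

definition set_parameters :: com where
  "set_parameters = Seq choose_accuracy set_counts"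

lemma accuracy_pos: "0 < \<epsilon> \<Longrightarrow> 0 < accuracy \<epsilon>"
  by (simp add: accuracy_def)

lemma wp_set_parameters:
  assumes s: "s = init_state F \<delta> \<epsilon>" and pos: "0 < \<delta>" "0 < \<epsilon>" "0 < nfun F"
    and post: "\<And>t s'. input_loaded F s' \<Longrightarrow> drawn s' = 0 \<Longrightarrow> imem s' ''q'' 0 = cells (deg F) \<epsilon> \<Longrightarrow>
      imem s' ''N'' 0 = projections (nfun F) \<delta> \<epsilon> \<Longrightarrow> rmem s' ''e'' 0 = accuracy \<epsilon> \<Longrightarrow>
      rmem s' ''Q'' 0 = ((1 + accuracy \<epsilon>) * (1 + accuracy \<epsilon>)) ^ projections (nfun F) \<delta> \<epsilon> \<Longrightarrow>
      t \<le> 200 * (doublings (nfun F) \<delta> + cells (deg F) \<epsilon> + projections (nfun F) \<delta> \<epsilon> + 1) \<Longrightarrow> Q t s'"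
  shows "wp \<omega> set_parameters s Q"
proof -
  have inp: "input_loaded F s" "rmem s ''delta'' 0 = \<delta>" "rmem s ''epsilon'' 0 = \<epsilon>" "drawn s = 0"
    unfolding s by (rule input_loaded_init) (simp_all add: init_state_def Let_def scalar_def)
  define s1 where "s1 = rput ''e'' 0 (accuracy \<epsilon>) s"
  have k1: "keep {} {''e''} s s1" by (simp add: s1_def keep_refl)
  note inp1 = input_loaded_keep[OF inp(1) k1, simplified]
  have counts: "wp \<omega> set_counts s1 (\<lambda>t. Q (13 + t))"
    unfolding set_counts_def wp_simps(5)
  proof (rule wp_count_doublings[where m = "nfun F" and \<delta> = \<delta>], goal_cases m delta _ _ post)
    case (post t2 s2)
    have inp2: "input_loaded F s2" using input_loaded_keep[OF inp1 post(1)] by simp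
    have s2: "imem s2 ''k'' 0 = doublings (nfun F) \<delta>" "rmem s2 ''e'' 0 = accuracy \<epsilon>" "drawn s2 = 0"
      using post(2,3) keepD[OF post(1)] inp(4) by (simp_all add: s1_def doublings_def)
    define s3 where "s3 = iput ''q'' 0 (cells (deg F) \<epsilon>) s2"
    define s4 where "s4 = iput ''N'' 0 (projections (nfun F) \<delta> \<epsilon>) s3"
    have k4: "keep {''q'', ''N''} {} s2 s4" by (simp add: s3_def s4_def keep_refl)
    have inp4: "input_loaded F s4" using input_loaded_keep[OF inp2 k4] by simp
    have fin: "wp \<omega> compute_power s4 (\<lambda>t. Q (13 + (t2 + (t3 + (t4 + t)))))"
      if t: "t3 \<le> (cells (deg F) \<epsilon> + 1) * 40" "t4 \<le> (projections (nfun F) \<delta> \<epsilon> + 1) * 40" for t3 t4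
    proof (rule wp_compute_power[where N = "projections (nfun F) \<delta> \<epsilon>" and a = "1 + accuracy \<epsilon>"], goal_cases N a post)
      case (post t5 s5)
      have inp5: "input_loaded F s5" using input_loaded_keep[OF inp4 post(1)] by simp
      show ?case
        using keepD[OF post(1)] post(2,3,4) inp5 t \<open>t2 \<le> _\<close> s2
        by (intro assms) (simp_all add: s3_def s4_def doublings_def)
    qed (use s2 in \<open>simp_all add: s3_def s4_def\<close>)
    show ?case
    proof (rule wp_count_up[where x = "accuracy \<epsilon>" and B = "384 * ((deg F + 1) * (deg F + 1))"], goal_cases r b x post)
      case (post t3)
      show ?case unfolding cells_def[symmetric] s3_def[symmetric]
      proof (rule wp_count_up[where x = "accuracy \<epsilon> * accuracy \<epsilon>" and B = "384 * (doublings (nfun F) \<delta> + 1)"], goal_cases r b x post)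
        case (post t4)
        then show ?case unfolding projections_def[symmetric] s4_def[symmetric]
          using \<open>t3 \<le> _\<close> by (intro fin) (simp_all add: cells_def)
      qed (use s2 accuracy_pos[OF pos(2)] in \<open>simp_all add: s3_def\<close>)
    qed (use s2 inp2 accuracy_pos[OF pos(2)] in \<open>simp_all add: input_loaded_def\<close>)
  qed (use inp1 inp pos in \<open>simp_all add: input_loaded_def s1_def\<close>)
  have "wp \<omega> choose_accuracy s (\<lambda>t s'. t = 13 \<and> s' = s1)"
    by (simp add: choose_accuracy_def s1_def accuracy_def inp(3))
  then show ?thesis unfolding set_parameters_def wp_simps(5)
    by (rule wp_mono) (use counts in simp)
qed

section \<open>The complete program and the function it computes\<close>

definition estimate_distances :: com where
  "estimate_distances = Seq set_parameters (Seq all_projections all_pairs)"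

text \<open>The output as an explicit function of the sample sequence. All probabilities are
  computed for this function, whose measurability is easy to establish.\<close>

definition estimate :: "family_input \<Rightarrow> real \<Rightarrow> real \<Rightarrow> (nat \<Rightarrow> real) \<Rightarrow> nat \<Rightarrow> nat \<Rightarrow> real" where
  "estimate F \<delta> \<epsilon> \<omega> j k =
     geometric_mean_scan (1 + accuracy \<epsilon>) (projections (nfun F) \<delta> \<epsilon>)
       (\<lambda>p. sketch F (cells (deg F) \<epsilon>) \<omega> (p * (nend F * cells (deg F) \<epsilon>)) j
          - sketch F (cells (deg F) \<epsilon>) \<omega> (p * (nend F * cells (deg F) \<epsilon>)) k)"

lemma wp_estimate_distances:
  fixes F \<delta> \<epsilon>
  defines "q \<equiv> cells (deg F) \<epsilon>" and "N \<equiv> projections (nfun F) \<delta> \<epsilon>"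
  assumes wf: "wf_input F" and pos: "0 < \<delta>" "0 < \<epsilon>" "0 < nfun F"
  shows "wp \<omega> estimate_distances (init_state F \<delta> \<epsilon>) (\<lambda>t s.
      (\<forall>j<nfun F. \<forall>k<nfun F. dist_estimate (nfun F) s j k = estimate F \<delta> \<epsilon> \<omega> j k) \<and>
      t \<le> 200 * (doublings (nfun F) \<delta> + q + N + 1)
        + (N * (sweep_cost F q 100) + 10)
        + (nfun F * (nfun F * (200 * (N + 1) + 40) + 40) + 10))"
  unfolding estimate_distances_def wp_simps(5)
proof (rule wp_set_parameters[OF refl pos], goal_cases post)
  case (post t1 s1)
  note s1 = post
  show ?case
  proof (rule wp_all_projections[where F = F and q = q and N = N, OF wf s1(1)], goal_cases q N drawn post)
    case (post t2 s2)
    have keep: "imem s2 ''m'' 0 = nfun F" "imem s2 ''N'' 0 = N" "rmem s2 ''e'' 0 = accuracy \<epsilon>"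
      "rmem s2 ''Q'' 0 = ((1 + accuracy \<epsilon>) * (1 + accuracy \<epsilon>)) ^ N"
      using keepD[OF post(1)] s1 by (simp_all add: input_loaded_def N_def)
    show ?case
    proof (rule wp_all_pairs[where m = "nfun F" and N = N and a = "1 + accuracy \<epsilon>"], goal_cases m N Q e post)
      case (post t3 s3)
      have "dist_estimate (nfun F) s3 j k = estimate F \<delta> \<epsilon> \<omega> j k" if "j < nfun F" "k < nfun F" for j k
      proof -
        have eq: "geometric_mean_scan a N x = geometric_mean_scan a N x'" if "\<And>p. p < N \<Longrightarrow> x p = x' p" for x x' a
        proof -
          \<comment> \<open>Needed because the scan reads \<open>x 0\<close> in addition to the
            \<open>x p\<close> with \<open>p < N\<close>.\<close>
          have "0 < N" by (simp add: N_def projections_def)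
          with that show ?thesis unfolding geometric_mean_scan_def by simp
        qed
        show ?thesis
          unfolding dist_estimate_def post(1)[OF that] estimate_def q_def[symmetric] N_def[symmetric]
          by (intro eq) (simp add: \<open>\<And>j p. p < N \<Longrightarrow> j < nfun F \<Longrightarrow> rmem s2 ''Y'' (p * nfun F + j) = _\<close> that)
      qed
      then show ?case using s1(7) \<open>t2 \<le> _\<close> post(2) by (simp add: q_def N_def)
    qed (use keep in simp_all)
  qed (use s1 in \<open>simp_all add: q_def N_def\<close>)
qed

section \<open>Accuracy of the estimates\<close>

text \<open>This settles pairs whose sketches coincide, in particular \<open>j = k\<close>: a
  relative error requires the estimate of distance 0 to be exactly 0.\<close>

lemma snd_scan_zero: "snd ((scan_step a A ^^ n) (\<rho>, 0)) = 0"
proof (induction n)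
  case (Suc n)
  then show ?case by (cases "(scan_step a A ^^ n) (\<rho>, 0)") (auto simp: scan_step_def)
qed simp

lemma geometric_mean_scan_zero: "x 0 = 0 \<Longrightarrow> geometric_mean_scan a N x = 0"
  by (simp add: geometric_mean_scan_def snd_scan_zero)

text \<open>Induction on the number \<open>T\<close> of steps left: \<open>y\<close> may exceed
  \<open>G\<close> by the factor \<open>a ^ T\<close> and fall below it by
  \<open>a ^ (T + 1)\<close>. A step either removes one factor \<open>a\<close> from the gap or
  finds \<open>y\<close> already between \<open>G / a\<close> and \<open>G\<close> and leaves it
  there.\<close>

lemma scan_converges:
  assumes a: "1 < a" and N: "0 < N" and G: "0 < G" and y: "0 < y" "y \<le> G * a ^ T" "G \<le> a ^ (T + 1) * y"
  shows "0 < snd ((scan_step a ((a * a) ^ N) ^^ T) ((G / y) ^ (2 * N), y)) \<and>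
    snd ((scan_step a ((a * a) ^ N) ^^ T) ((G / y) ^ (2 * N), y)) \<le> G \<and>
    G \<le> a * snd ((scan_step a ((a * a) ^ N) ^^ T) ((G / y) ^ (2 * N), y))"
  using y
proof (induction T arbitrary: y)
  case (Suc T)
  have A: "(a * a) ^ N = a ^ (2 * N)" by (simp add: power_mult power2_eq_square)
  \<comment> \<open>The power \<open>2 * N\<close> is strictly increasing on nonnegative numbers, so
    the tests of the program on powers decide the comparisons of \<open>G\<close> with
    \<open>y\<close> and \<open>a * y\<close>.\<close>
  have less: "u ^ (2 * N) < v ^ (2 * N) \<longleftrightarrow> u < v" if "0 \<le> u" "0 \<le> v" for u v :: real
    using power_mono_iff[OF that(2,1), of "2 * N"] N by (meson mult_pos_pos not_le pos2)
  have g1: "(a * a) ^ N < (G / y) ^ (2 * N) \<longleftrightarrow> a * y < G"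
    unfolding A using Suc.prems a G by (subst less) (auto simp: pos_less_divide_eq)
  have g2: "(G / y) ^ (2 * N) < 1 \<longleftrightarrow> G < y"
    using less[of "G / y" 1] Suc.prems G by simp
  define y' where "y' = (if a * y < G then y * a else if G < y then y / a else y)"
  have step: "scan_step a ((a * a) ^ N) ((G / y) ^ (2 * N), y) = ((G / y') ^ (2 * N), y')"
  proof -
    have "(G / y) ^ (2 * N) / (a * a) ^ N = (G / (y * a)) ^ (2 * N)"
      "(G / y) ^ (2 * N) * (a * a) ^ N = (G / (y / a)) ^ (2 * N)"
      unfolding A using a by (simp_all add: power_divide power_mult_distrib)
    then show ?thesis unfolding scan_step_def prod.case g1 g2 y'_def by simp
  qed
  have "0 < y'" using Suc.prems(1) a by (simp add: y'_def)
  moreover have "y' \<le> G * a ^ T"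
  proof -
    have "1 \<le> a ^ T" using a by (intro one_le_power) simp
    then have "G * 1 \<le> G * a ^ T" using G by (intro mult_left_mono) auto
    moreover have "y / a \<le> G * a ^ T" using Suc.prems(2) a by (simp add: field_simps)
    ultimately show ?thesis by (auto simp: y'_def mult.commute)
  qed
  moreover have "G \<le> a ^ (T + 1) * y'"
  proof -
    have a1: "1 \<le> a ^ T" using a by (intro one_le_power) simp
    consider "a * y < G" | "G < y" "\<not> a * y < G" | "\<not> a * y < G" "\<not> G < y" by blast
    then show ?thesis
    proof cases
      case 1
      then show ?thesis using Suc.prems(3) by (simp add: y'_def mult_ac)
    next
      case 2
      have "G \<le> 1 * y" using 2 by simp
      also have "\<dots> \<le> a ^ T * y" using a1 Suc.prems(1) by (intro mult_right_mono) auto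
      finally show ?thesis using 2 a by (simp add: y'_def)
    next
      case 3
      then have "G \<le> 1 * (a * y)" by simp
      also have "\<dots> \<le> a ^ T * (a * y)" using a1 a Suc.prems(1) by (intro mult_right_mono) auto
      finally show ?thesis using 3 by (simp add: y'_def mult_ac)
    qed
  qed
  ultimately show ?case
    using Suc.IH[of y'] unfolding funpow_Suc_right comp_def step by blast
qed auto

text \<open>Since \<open>G ^ N\<close> is the product of the \<open>\<bar>x p\<bar>\<close>, the
  product of the squared ratios is \<open>(G / \<bar>x 0\<bar>) ^ (2 * N)\<close>, which is the
  state in which \<open>scan_converges\<close> starts with
  \<open>y = \<bar>x 0\<bar>\<close>.\<close>

lemma geometric_mean_scan_bounds:
  fixes x :: "nat \<Rightarrow> real" and N :: nat
  defines "G \<equiv> exp ((\<Sum>p<N. ln \<bar>x p\<bar>) / N)"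
  assumes a: "1 < a" and N: "0 < N" and nz: "\<And>p. p < N \<Longrightarrow> x p \<noteq> 0"
    and range: "\<bar>x 0\<bar> \<le> G * a ^ N" "G \<le> a ^ (N + 1) * \<bar>x 0\<bar>"
  shows "0 < geometric_mean_scan a N x" "geometric_mean_scan a N x \<le> G" "G \<le> a * geometric_mean_scan a N x"
proof -
  have "G ^ N = exp (\<Sum>p<N. ln \<bar>x p\<bar>)"
    using N by (simp add: G_def exp_of_nat_mult[symmetric])
  also have "\<dots> = (\<Prod>p<N. \<bar>x p\<bar>)"
    unfolding exp_sum[OF finite_lessThan] by (intro prod.cong refl) (simp add: nz)
  finally have GN: "G ^ N = (\<Prod>p<N. \<bar>x p\<bar>)" .
  have "(\<Prod>p<N. (x p / \<bar>x 0\<bar>)\<^sup>2) = (\<Prod>p<N. \<bar>x p\<bar> / \<bar>x 0\<bar>)\<^sup>2"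
    by (simp add: prod_power_distrib power_divide)
  also have "\<dots> = (G / \<bar>x 0\<bar>) ^ (2 * N)"
  proof -
    have "(\<Prod>p<N. \<bar>x p\<bar> / \<bar>x 0\<bar>) = (G / \<bar>x 0\<bar>) ^ N"
      by (simp add: prod_dividef GN power_divide)
    then show ?thesis by (simp add: power_mult[symmetric] mult.commute)
  qed
  finally have start: "(\<Prod>p<N. (x p / \<bar>x 0\<bar>)\<^sup>2) = (G / \<bar>x 0\<bar>) ^ (2 * N)" .
  have G: "0 < G" by (simp add: G_def)
  have "0 < \<bar>x 0\<bar>" using nz[OF N] by simp
  from scan_converges[OF a N G this range]
  show "0 < geometric_mean_scan a N x" "geometric_mean_scan a N x \<le> G" "G \<le> a * geometric_mean_scan a N x"
    unfolding geometric_mean_scan_def start by blast+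
qed

section \<open>From pieces to the common cells of all densities\<close>

definition cell_poly :: "family_input \<Rightarrow> nat \<Rightarrow> nat \<Rightarrow> real poly" where
  "cell_poly F j i = (\<Sum>l | l < npiece F \<and> lidx F j l \<le> i \<and> i < ridx F j l. \<Sum>u\<le>deg F. monom (coef F j l u) u)"

lemma degree_cell_poly: "degree (cell_poly F j i) \<le> deg F"
  unfolding cell_poly_def
  by (intro degree_sum_le order.trans[OF degree_monom_le]) auto

lemma pieces_ordered:
  assumes wf: "wf_input F" and j: "j < nfun F" and l: "l < l'" "l' < npiece F"
  shows "ridx F j l < lidx F j l'"
  using l
proof (induction l')
  case (Suc l')
  have step: "ridx F j l' < lidx F j (Suc l')" and wf': "lidx F j l' < ridx F j l'"
    using wf j Suc.prems unfolding wf_input_def by auto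
  show ?case
  proof (cases "l = l'")
    case False
    then have "ridx F j l < lidx F j l'" using Suc by simp
    with step wf' show ?thesis by simp
  qed (use step in simp)
qed simp

lemma cell_exists:
  fixes a :: "nat \<Rightarrow> real"
  assumes "a b \<le> x" "x < a c" "b \<le> c"
  shows "\<exists>i. b \<le> i \<and> i < c \<and> a i \<le> x \<and> x < a (Suc i)"
  using assms(3,2)
proof (induction c rule: dec_induct)
  case base
  then show ?case using assms(1) by simp
next
  case (step c)
  then show ?case by (cases "x < a c") (auto intro: less_SucI exI[of _ c])
qed

context
  fixes F f
  assumes rep: "represents F f"
begin

lemma represents_wf: "wf_input F"
  using rep by (simp add: represents_def)

lemma endp_less_iff: "i < nend F \<Longrightarrow> i' < nend F \<Longrightarrow> endp F i < endp F i' \<longleftrightarrow> i < i'"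
  using represents_wf unfolding wf_input_def by (metis lessThan_iff strict_mono_on_less)

lemma endp_le_iff: "i < nend F \<Longrightarrow> i' < nend F \<Longrightarrow> endp F i \<le> endp F i' \<longleftrightarrow> i \<le> i'"
  using endp_less_iff[of i' i] by (meson not_less)

lemma piece_index:
  assumes "j < nfun F" "l < npiece F"
  shows "lidx F j l < ridx F j l" "ridx F j l < nend F" "lidx F j l < nend F"
  using represents_wf assms unfolding wf_input_def by (meson less_trans)+

text \<open>Sortedness turns comparisons of endpoints into comparisons of indices, so that no cell
  straddles the boundary of a piece.\<close>

lemma cell_in_piece:
  assumes j: "j < nfun F" "l < npiece F" and i: "Suc i < nend F" and x: "endp F i \<le> x" "x < endp F (Suc i)"
  shows "x \<in> piece F j l \<longleftrightarrow> lidx F j l \<le> i \<and> i < ridx F j l"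
proof
  assume "x \<in> piece F j l"
  then have "endp F (lidx F j l) < endp F (Suc i)" "endp F i < endp F (ridx F j l)"
    using x by (auto simp: piece_def)
  then show "lidx F j l \<le> i \<and> i < ridx F j l"
    using endp_less_iff piece_index[OF j] i by auto
next
  assume "lidx F j l \<le> i \<and> i < ridx F j l"
  then have "endp F (lidx F j l) \<le> endp F i" "endp F (Suc i) \<le> endp F (ridx F j l)"
    using endp_le_iff piece_index[OF j] i by auto
  then show "x \<in> piece F j l" using x by (auto simp: piece_def)
qed

lemma density_on_cell:
  assumes j: "j < nfun F" and i: "Suc i < nend F" and x: "endp F i \<le> x" "x < endp F (Suc i)"
  shows "f j x = poly (cell_poly F j i) x"
proof (cases "\<exists>l<npiece F. x \<in> piece F j l")
  case True
  then obtain l where l: "l < npiece F" "x \<in> piece F j l" by blast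
  \<comment> \<open>Pieces of one function are disjoint, so the sum in \<open>cell_poly\<close> has
    a single term here and is empty in the other case: it acts as a case distinction.\<close>
  have "{l'. l' < npiece F \<and> lidx F j l' \<le> i \<and> i < ridx F j l'} = {l}"
  proof -
    have "l' = l" if l': "l' < npiece F" "lidx F j l' \<le> i" "i < ridx F j l'" for l'
    proof (rule ccontr)
      assume "l' \<noteq> l"
      then have "ridx F j l < lidx F j l' \<or> ridx F j l' < lidx F j l"
        using pieces_ordered[OF represents_wf j] l(1) l'(1) by (metis linorder_neqE_nat)
      with l l' cell_in_piece[OF j l(1) i x] show False by auto
    qed
    with l cell_in_piece[OF j l(1) i x] show ?thesis by blast
  qed
  then have "poly (cell_poly F j i) x = (\<Sum>u\<le>deg F. coef F j l u * x ^ u)"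
    by (simp add: cell_poly_def poly_sum poly_monom)
  also have "\<dots> = f j x" using rep j l unfolding represents_def by simp
  finally show ?thesis by simp
next
  case False
  then have "{l'. l' < npiece F \<and> lidx F j l' \<le> i \<and> i < ridx F j l'} = {}"
    using cell_in_piece[OF j _ i x] by blast
  then have "cell_poly F j i = 0" unfolding cell_poly_def by (simp only: sum.empty)
  moreover have "f j x = 0" using rep j False unfolding represents_def by blast
  ultimately show ?thesis by simp
qed

lemma density_outside:
  assumes j: "j < nfun F" and x: "\<And>i. Suc i < nend F \<Longrightarrow> \<not> (endp F i \<le> x \<and> x < endp F (Suc i))"
  shows "f j x = 0"
proof -
  have "x \<notin> piece F j l" if l: "l < npiece F" for l
  proof
    assume "x \<in> piece F j l"
    then have "endp F (lidx F j l) \<le> x" "x < endp F (ridx F j l)" by (auto simp: piece_def)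
    from cell_exists[where a = "endp F", OF this less_imp_le[OF piece_index(1)[OF j l]]]
    obtain i where i: "i < ridx F j l" "endp F i \<le> x" "x < endp F (Suc i)" by blast
    with x[of i] piece_index(2)[OF j l] show False by simp
  qed
  then show ?thesis using rep j unfolding represents_def by blast
qed

text \<open>Between consecutive endpoints both densities are polynomials, and elsewhere both vanish.
  Half-open cells differ from closed intervals by a null set, so the Lebesgue integral splits into
  the integrals for which Markov's inequality is stated.\<close>

lemma L1_dist_cells:
  assumes j: "j < nfun F" "k < nfun F"
  shows "L1_dist (f j) (f k) = (\<Sum>i<nend F - 1. integral {endp F i..endp F (Suc i)} (\<lambda>x. \<bar>poly (cell_poly F j i - cell_poly F k i) x\<bar>))"
proof -
  let ?p = "\<lambda>i. cell_poly F j i - cell_poly F k i"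
  let ?C = "\<lambda>i. {endp F i..<endp F (Suc i)}"
  let ?g = "\<lambda>i x. indicator (?C i) x * \<bar>poly (?p i) x\<bar>"
  let ?J = "\<lambda>i. integral {endp F i..endp F (Suc i)} (\<lambda>x. \<bar>poly (?p i) x\<bar>)"
  have pt: "\<bar>f j x - f k x\<bar> = (\<Sum>i<nend F - 1. ?g i x)" for x
  proof (cases "\<exists>i<nend F - 1. x \<in> ?C i")
    case True
    then obtain i where i: "i < nend F - 1" "x \<in> ?C i" by blast
    have "?g i' x = (if i' = i then \<bar>f j x - f k x\<bar> else 0)" if i': "i' < nend F - 1" for i'
    proof (cases "i' = i")
      case True
      then show ?thesis using i density_on_cell[of _ i x] j by auto
    next
      case False
      have "x \<notin> ?C i'"
      proof
        assume "x \<in> ?C i'"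
        with i have "endp F i < endp F (Suc i')" "endp F i' < endp F (Suc i)" by auto
        then have "i < Suc i'" "i' < Suc i" using i i' by (auto simp: endp_less_iff)
        with False show False by simp
      qed
      with False show ?thesis by simp
    qed
    then have "(\<Sum>i'<nend F - 1. ?g i' x) = (\<Sum>i'<nend F - 1. if i' = i then \<bar>f j x - f k x\<bar> else 0)"
      by (intro sum.cong) auto
    then show ?thesis using i by simp
  next
    case False
    then have "f j x = 0" "f k x = 0" using density_outside j by auto
    moreover have "(\<Sum>i<nend F - 1. ?g i x) = 0"
      by (rule sum.neutral) (use False in \<open>auto simp: indicator_def\<close>)
    ultimately show ?thesis by simp
  qed
  have [measurable]: "(\<lambda>x. poly p x) \<in> borel_measurable borel" for p :: "real poly"
    by (intro borel_measurable_continuous_onI continuous_intros)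
  have cell: "has_bochner_integral lborel (\<lambda>x. ?g i x) (?J i)" for i
  proof -
    have int: "set_integrable lborel {endp F i..endp F (Suc i)} (\<lambda>x. \<bar>poly (?p i) x\<bar>)"
      by (intro borel_integrable_compact[unfolded set_integrable_def[symmetric]])
        (auto simp: set_integrable_def intro!: continuous_intros borel_integrable_compact)
    have "has_bochner_integral lborel (\<lambda>x. indicator {endp F i..endp F (Suc i)} x * \<bar>poly (?p i) x\<bar>) (?J i)"
      using int set_borel_integral_eq_integral(2)[OF int]
      by (simp add: has_bochner_integral_iff set_integrable_def set_lebesgue_integral_def)
    then show ?thesis
    proof (rule has_bochner_integral_cong_AE[THEN iffD1, rotated 3])
      show "AE x in lborel. indicator {endp F i..endp F (Suc i)} x * \<bar>poly (?p i) x\<bar> = ?g i x"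
        using AE_lborel_singleton[of "endp F (Suc i)"] by eventually_elim (auto simp: indicator_def)
    qed auto
  qed
  have "has_bochner_integral lborel (\<lambda>x. \<bar>f j x - f k x\<bar>) (\<Sum>i<nend F - 1. ?J i)"
    unfolding pt by (intro has_bochner_integral_sum cell)
  then show ?thesis by (simp add: L1_dist_def has_bochner_integral_iff)
qed

text \<open>The difference of two prefix sums is the sum over the cells of a piece. Exchanging the
  summations over pieces and cells then recovers the polynomial of each cell.\<close>

lemma sketch_eq_cells:
  assumes j: "j < nfun F"
  shows "sketch F q \<omega> B j = (\<Sum>i<nend F - 1. \<Sum>r<q. \<omega> (B + i * q + r) * ((endp F (Suc i) - endp F i) / q) *
    poly (cell_poly F j i) (endp F i + real r * ((endp F (Suc i) - endp F i) / q)))"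
proof -
  define h where "h i = (endp F (Suc i) - endp F i) / q" for i
  let ?a = "table (nend F) (endp F)" and ?X = "\<lambda>i r. \<omega> (B + i * q + r) * h i" and ?y = "\<lambda>i r. endp F i + real r * h i"
  let ?M = "moment \<omega> ?a q B" and ?S = "\<lambda>i u. \<Sum>r<q. ?X i r * ?y i r ^ u"
  define V where "V l i = (\<Sum>r<q. ?X i r * (\<Sum>u\<le>deg F. coef F j l u * (?y i r) ^ u))" for l i
  let ?V = "\<lambda>l i. if lidx F j l \<le> i \<and> i < ridx F j l then V l i else 0"
  have "sketch F q \<omega> B j = (\<Sum>l<npiece F. \<Sum>i<nend F - 1. ?V l i)"
    unfolding sketch_def
  proof (rule sum.cong[OF refl])
    fix l assume "l \<in> {..<npiece F}"
    then have l: "lidx F j l < ridx F j l" "ridx F j l < nend F" using piece_index j by auto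
    let ?I = "{lidx F j l..<ridx F j l}"
    have "?M (ridx F j l) u - ?M (lidx F j l) u
        = (\<Sum>i\<in>?I. ?S i u)" for u
    proof -
      have "?M (ridx F j l) u - ?M (lidx F j l) u
        = (\<Sum>i\<in>{..<ridx F j l} - {..<lidx F j l}. cell \<omega> ((?a (i + 1) - ?a i) / real q) (?a i) q (B + i * q) u)"
        unfolding moment_def using l by (intro sum_diff[symmetric]) auto
      also have "{..<ridx F j l} - {..<lidx F j l} = ?I" by auto
      also have "(\<Sum>i\<in>?I. cell \<omega> ((?a (i + 1) - ?a i) / real q) (?a i) q (B + i * q) u)
        = (\<Sum>i\<in>?I. ?S i u)"
        \<comment> \<open>Here \<open>i + 1 \<le> ridx F j l < nend F\<close>, so the default value
          of \<open>table\<close> is never met.\<close>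
        using l by (intro sum.cong refl) (simp add: cell_def h_def table_def)
      finally show ?thesis .
    qed
    then have "(\<Sum>u<deg F + 1. coef F j l u * (?M (ridx F j l) u - ?M (lidx F j l) u))
      = (\<Sum>u<deg F + 1. \<Sum>i\<in>?I. coef F j l u * ?S i u)"
      by (simp add: sum_distrib_left)
    also have "\<dots> = (\<Sum>i\<in>?I. \<Sum>u<deg F + 1. coef F j l u * ?S i u)"
      by (rule sum.swap)
    also have "\<dots> = (\<Sum>i\<in>?I. V l i)"
    proof (rule sum.cong[OF refl])
      fix i
      have "(\<Sum>u<deg F + 1. coef F j l u * ?S i u)
        = (\<Sum>u<deg F + 1. \<Sum>r<q. ?X i r * (coef F j l u * (?y i r) ^ u))"
        by (simp add: sum_distrib_left mult_ac)
      also have "\<dots> = (\<Sum>r<q. \<Sum>u<deg F + 1. ?X i r * (coef F j l u * (?y i r) ^ u))"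
        by (rule sum.swap)
      also have "\<dots> = V l i"
        by (simp add: V_def sum_distrib_left lessThan_Suc_atMost)
      finally show "(\<Sum>u<deg F + 1. coef F j l u * ?S i u) = V l i" .
    qed
    also have "?I = {..<nend F - 1} \<inter> {i. lidx F j l \<le> i \<and> i < ridx F j l}" using l by auto
    also have "(\<Sum>i\<in>\<dots>. V l i) = (\<Sum>i<nend F - 1. ?V l i)"
      by (subst sum.inter_restrict) simp_all
    finally show "(\<Sum>u<deg F + 1. coef F j l u * (?M (ridx F j l) u - ?M (lidx F j l) u))
      = (\<Sum>i<nend F - 1. ?V l i)" .
  qed
  also have "\<dots> = (\<Sum>i<nend F - 1. \<Sum>l<npiece F. ?V l i)"
    by (rule sum.swap)
  also have "\<dots> = (\<Sum>i<nend F - 1. \<Sum>r<q. ?X i r * poly (cell_poly F j i) (?y i r))"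
  proof (rule sum.cong[OF refl])
    fix i
    let ?L = "{l. l < npiece F \<and> lidx F j l \<le> i \<and> i < ridx F j l}"
    have "(\<Sum>l<npiece F. ?V l i) = (\<Sum>l\<in>?L. V l i)"
    proof -
      have "?L = {..<npiece F} \<inter> {l. lidx F j l \<le> i \<and> i < ridx F j l}" by auto
      then show ?thesis by (simp only: sum.inter_restrict[OF finite_lessThan] mem_Collect_eq)
    qed
    also have "\<dots> = (\<Sum>r<q. \<Sum>l\<in>?L. ?X i r * (\<Sum>u\<le>deg F. coef F j l u * (?y i r) ^ u))"
      unfolding V_def by (rule sum.swap)
    finally show "(\<Sum>l<npiece F. ?V l i)
      = (\<Sum>r<q. ?X i r * poly (cell_poly F j i) (?y i r))"
      by (simp add: cell_poly_def poly_sum poly_monom sum_distrib_left)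
  qed
  finally show ?thesis unfolding h_def .
qed

end

lemma sum_blocks: "(\<Sum>i<K. \<Sum>r<q. g (i * q + r)) = (\<Sum>v<K * q. g v)" for g :: "nat \<Rightarrow> real"
proof (induction K)
  case (Suc K)
  have "{..<Suc K * q} = {..<K * q} \<union> {K * q..<K * q + q}" by auto
  have "(\<Sum>v<Suc K * q. g v) = (\<Sum>v<K * q. g v) + (\<Sum>v=K * q..<K * q + q. g v)"
    unfolding \<open>{..<Suc K * q} = _\<close> by (rule sum.union_disjoint) auto
  also have "(\<Sum>v=K * q..<K * q + q. g v) = (\<Sum>r<q. g (K * q + r))"
    using sum.shift_bounds_nat_ivl[of g 0 "K * q" q] by (simp add: lessThan_atLeast0 add.commute)
  finally show ?case using Suc by simp
qed simp

text \<open>The index \<open>v\<close> runs through the cells in the order in which samples are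
  drawn. The value is the coefficient of the sample \<open>v\<close> in the difference of two
  sketches, and its modulus is a term of the quadrature sum.\<close>

definition weight :: "family_input \<Rightarrow> nat \<Rightarrow> nat \<Rightarrow> nat \<Rightarrow> nat \<Rightarrow> real" where
  "weight F q j k v = (let i = v div q; h = (endp F (Suc i) - endp F i) / q in
     h * poly (cell_poly F j i - cell_poly F k i) (endp F i + real (v mod q) * h))"

lemma sketch_diff_eq:
  assumes rep: "represents F f" and jk: "j < nfun F" "k < nfun F"
  shows "sketch F q \<omega> B j - sketch F q \<omega> B k = (\<Sum>v<(nend F - 1) * q. weight F q j k v * \<omega> (B + v))"
proof -
  have "sketch F q \<omega> B j - sketch F q \<omega> B k = (\<Sum>i<nend F - 1. \<Sum>r<q. weight F q j k (i * q + r) * \<omega> (B + (i * q + r)))"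
    unfolding sketch_eq_cells[OF rep jk(1)] sketch_eq_cells[OF rep jk(2)] sum_subtractf[symmetric]
    by (intro sum.cong refl) (auto simp: weight_def Let_def algebra_simps)
  also have "\<dots> = (\<Sum>v<(nend F - 1) * q. weight F q j k v * \<omega> (B + v))"
    by (rule sum_blocks)
  finally show ?thesis .
qed

text \<open>The relative quadrature error is the same on every interval, so it survives summation.
  The left sum is the scale of the Cauchy variable that the two sketches produce.\<close>

lemma weight_sum_error:
  assumes rep: "represents F f" and jk: "j < nfun F" "k < nfun F" and q: "0 < q"
  shows "\<bar>(\<Sum>v<(nend F - 1) * q. \<bar>weight F q j k v\<bar>) - L1_dist (f j) (f k)\<bar> \<le> 384 * (real (deg F + 1))\<^sup>2 / q * L1_dist (f j) (f k)"
proof -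
  define h where "h i = (endp F (Suc i) - endp F i) / q" for i
  define p where "p i = cell_poly F j i - cell_poly F k i" for i
  define J where "J i = integral {endp F i..endp F (Suc i)} (\<lambda>x. \<bar>poly (p i) x\<bar>)" for i
  have less: "endp F i < endp F (Suc i)" if "i < nend F - 1" for i
    using that by (subst endp_less_iff[OF rep]) auto
  have "(\<Sum>v<(nend F - 1) * q. \<bar>weight F q j k v\<bar>) = (\<Sum>i<nend F - 1. h i * (\<Sum>r<q. \<bar>poly (p i) (endp F i + real r * h i)\<bar>))"
    unfolding sum_blocks[symmetric] sum_distrib_left
    using less by (intro sum.cong refl) (auto simp: weight_def Let_def h_def p_def abs_mult less_imp_le)
  moreover have "L1_dist (f j) (f k) = (\<Sum>i<nend F - 1. J i)"
    unfolding L1_dist_cells[OF rep jk] J_def p_def ..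
  ultimately have "\<bar>(\<Sum>v<(nend F - 1) * q. \<bar>weight F q j k v\<bar>) - L1_dist (f j) (f k)\<bar>
      = \<bar>\<Sum>i<nend F - 1. h i * (\<Sum>r<q. \<bar>poly (p i) (endp F i + real r * h i)\<bar>) - J i\<bar>"
    by (simp add: sum_subtractf)
  also have "\<dots> \<le> (\<Sum>i<nend F - 1. \<bar>h i * (\<Sum>r<q. \<bar>poly (p i) (endp F i + real r * h i)\<bar>) - J i\<bar>)"
    by (rule sum_abs)
  also have "\<dots> \<le> (\<Sum>i<nend F - 1. 384 * (real (deg F + 1))\<^sup>2 / q * J i)"
  proof (intro sum_mono)
    fix i assume "i \<in> {..<nend F - 1}"
    then have "endp F i < endp F (Suc i)" using less by simp
    \<comment> \<open>The degree bound is raised by 1 to be positive also for piecewise constant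
      densities.\<close>
    moreover have "degree (p i) \<le> deg F + 1"
      unfolding p_def by (intro degree_diff_le order.trans[OF degree_cell_poly]) auto
    ultimately show "\<bar>h i * (\<Sum>r<q. \<bar>poly (p i) (endp F i + real r * h i)\<bar>) - J i\<bar> \<le> 384 * (real (deg F + 1))\<^sup>2 / q * J i"
      unfolding h_def J_def using q by (intro quadrature_abs_poly) auto
  qed
  also have "\<dots> = 384 * (real (deg F + 1))\<^sup>2 / q * L1_dist (f j) (f k)"
    unfolding L1_dist_cells[OF rep jk] J_def p_def by (simp only: sum_distrib_left)
  finally show ?thesis .
qed

section \<open>The sample space and independent blocks of samples\<close>

interpretation samples: prob_space cauchy_samples
  unfolding cauchy_samples_def by (intro prob_space_PiM prob_space_cauchy)

lemma sets_cauchy_samples: "sets cauchy_samples = sets (\<Pi>\<^sub>M i\<in>UNIV. borel)"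
  unfolding cauchy_samples_def by (intro sets_PiM_cong) auto

lemma measurable_coordinate [measurable]: "(\<lambda>\<omega>. \<omega> i) \<in> borel_measurable cauchy_samples"
  using measurable_component_singleton[of i UNIV "\<lambda>_. borel"]
  by (simp cong: measurable_cong_sets add: sets_cauchy_samples)

lemma distr_coordinate: "distr cauchy_samples borel (\<lambda>\<omega>. \<omega> i) = cauchy"
proof -
  have "distr cauchy_samples borel (\<lambda>\<omega>. \<omega> i) = distr (\<Pi>\<^sub>M i\<in>UNIV. cauchy) cauchy (\<lambda>\<omega>. \<omega> i)"
    unfolding cauchy_samples_def by (intro distr_cong) auto
  also have "\<dots> = cauchy" by (intro distr_PiM_component prob_space_cauchy) auto
  finally show ?thesis .
qed

lemma indep_coordinates: "samples.indep_vars (\<lambda>_. borel) (\<lambda>i \<omega>. \<omega> i) UNIV"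
proof (subst samples.indep_vars_iff_distr_eq_PiM)
  have "distr cauchy_samples (\<Pi>\<^sub>M i\<in>UNIV. borel) (\<lambda>\<omega>. \<lambda>i\<in>UNIV. \<omega> i) = distr cauchy_samples cauchy_samples (\<lambda>\<omega>. \<omega>)"
    by (intro distr_cong) (auto simp: sets_cauchy_samples)
  also have "\<dots> = (\<Pi>\<^sub>M i\<in>UNIV. cauchy)" by (simp add: distr_id2 cauchy_samples_def)
  finally show "distr cauchy_samples (\<Pi>\<^sub>M i\<in>UNIV. borel) (\<lambda>\<omega>. \<lambda>i\<in>UNIV. \<omega> i)
      = (\<Pi>\<^sub>M i\<in>UNIV. distr cauchy_samples borel (\<lambda>\<omega>. \<omega> i))"
    by (simp add: distr_coordinate)
qed auto

text \<open>Disjoint blocks give independence, 1-stability gives the law. Only the first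
  \<open>K\<close> samples of a block of length \<open>L\<close> carry weight; the others belong to
  the interval beyond the last endpoint.\<close>

lemma block_combinations:
  fixes c :: "nat \<Rightarrow> real"
  assumes K: "K \<le> L" and \<gamma>: "\<gamma> = (\<Sum>v<K. \<bar>c v\<bar>)" "0 < \<gamma>"
  defines "Z \<equiv> \<lambda>p \<omega>. (\<Sum>v<K. c v * \<omega> (p * L + v)) / \<gamma>"
  shows "samples.indep_vars (\<lambda>_. borel) Z {..<N}" "distr cauchy_samples borel (Z p) = cauchy"
proof -
  define B where "B p = {p * L..<p * L + K}" for p
  have reindex: "(\<Sum>v<K. g v) = (\<Sum>i\<in>B p. g (i - p * L))" for g :: "nat \<Rightarrow> real" and p
    unfolding B_def using sum.shift_bounds_nat_ivl[of "\<lambda>i. g (i - p * L)" 0 "p * L" K]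
    by (simp add: lessThan_atLeast0 add.commute)
  have Z: "Z p \<omega> = (\<Sum>i\<in>B p. c (i - p * L) * \<omega> i) / \<gamma>" for p \<omega>
    unfolding Z_def reindex[of _ p] by (intro arg_cong2[where f = "(/)"] sum.cong) (auto simp: B_def)
  have disj: "disjoint_family_on B {..<N}"
  proof -
    have "B p \<inter> B p' = {}" if "p < p'" for p p'
    proof -
      have "Suc p * L \<le> p' * L" using that by (intro mult_right_mono) auto
      then show ?thesis using K by (auto simp: B_def)
    qed
    then show ?thesis unfolding disjoint_family_on_def by (metis inf_commute linorder_neqE_nat)
  qed
  have "samples.indep_vars (\<lambda>p. \<Pi>\<^sub>M i\<in>B p. borel) (\<lambda>p \<omega>. restrict (\<lambda>i. \<omega> i) (B p)) {..<N}"
    by (rule samples.indep_vars_restrict[OF indep_coordinates _ disj]) auto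
  then have "samples.indep_vars (\<lambda>_. borel) (\<lambda>p \<omega>. (\<Sum>i\<in>B p. c (i - p * L) * restrict (\<lambda>i. \<omega> i) (B p) i) / \<gamma>) {..<N}"
    by (rule samples.indep_vars_compose2[where Y = "\<lambda>p w. (\<Sum>i\<in>B p. c (i - p * L) * w i) / \<gamma>"]) measurable
  then show "samples.indep_vars (\<lambda>_. borel) Z {..<N}"
    by (simp add: Z[abs_def] cong: sum.cong)
  have "distr cauchy_samples borel (\<lambda>\<omega>. \<Sum>i\<in>B p. c (i - p * L) * \<omega> i)
      = distr cauchy borel (\<lambda>x. (\<Sum>i\<in>B p. \<bar>c (i - p * L)\<bar>) * x)"
    by (intro samples.distr_sum_cauchy samples.indep_vars_subset[OF indep_coordinates]) (auto simp: distr_coordinate)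
  also have "(\<Sum>i\<in>B p. \<bar>c (i - p * L)\<bar>) = \<gamma>" unfolding \<gamma>(1) by (rule reindex[symmetric])
  finally have X: "distr cauchy_samples borel (\<lambda>\<omega>. \<Sum>i\<in>B p. c (i - p * L) * \<omega> i) = distr cauchy borel (\<lambda>x. \<gamma> * x)" .
  have "distr cauchy_samples borel (Z p) = distr (distr cauchy_samples borel (\<lambda>\<omega>. \<Sum>i\<in>B p. c (i - p * L) * \<omega> i)) borel (\<lambda>x. x / \<gamma>)"
  proof -
    have "Z p = (\<lambda>\<omega>. (\<Sum>i\<in>B p. c (i - p * L) * \<omega> i) / \<gamma>)" by (rule ext) (rule Z)
    then show ?thesis by (subst distr_distr) (auto simp: comp_def)
  qed
  also have "\<dots> = distr cauchy borel (\<lambda>x. x)"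
    unfolding X using \<gamma>(2) by (subst distr_distr) (auto simp: comp_def)
  also have "\<dots> = cauchy" by (rule distr_id2) simp
  finally show "distr cauchy_samples borel (Z p) = cauchy" .
qed

lemma measurable_scan_step [measurable]:
  "scan_step a A \<in> borel \<Otimes>\<^sub>M borel \<rightarrow>\<^sub>M borel \<Otimes>\<^sub>M borel"
  unfolding scan_step_def case_prod_beta by measurable

lemma measurable_geometric_mean_scan:
  assumes [measurable]: "\<And>p. X p \<in> borel_measurable M"
  shows "(\<lambda>\<omega>. geometric_mean_scan a N (\<lambda>p. X p \<omega>)) \<in> borel_measurable M"
proof -
  have "(\<lambda>\<omega>. (scan_step a A ^^ n) (\<Prod>p<N. (X p \<omega> / \<bar>X 0 \<omega>\<bar>)\<^sup>2, \<bar>X 0 \<omega>\<bar>)) \<in> M \<rightarrow>\<^sub>M borel \<Otimes>\<^sub>M borel" for n A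
  proof (induction n)
    case 0
    show ?case by simp
  next
    case (Suc n)
    note Suc [measurable]
    show ?case by simp
  qed
  then show ?thesis unfolding geometric_mean_scan_def by (rule measurable_compose[OF _ measurable_snd])
qed

lemma measurable_estimate [measurable]: "(\<lambda>\<omega>. estimate F \<delta> \<epsilon> \<omega> j k) \<in> borel_measurable cauchy_samples"
  unfolding estimate_def sketch_def moment_def cell_def
  by (intro measurable_geometric_mean_scan) measurable

section \<open>Error budget and failure probability\<close>

lemma accuracy_le: "accuracy \<epsilon> \<le> 1 / 8" "8 * accuracy \<epsilon> \<le> \<epsilon>"
  by (auto simp: accuracy_def)

lemma exp_le_inverse:
  fixes e :: real
  assumes "0 \<le> e" "e < 1"
  shows "exp e \<le> 1 / (1 - e)"
proof -
  have "1 - e \<le> exp (- e)" using exp_ge_add_one_self[of "- e"] by simp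
  then have "exp e * (1 - e) \<le> exp e * exp (- e)" by (intro mult_left_mono) auto
  then show ?thesis using assms by (simp add: exp_minus field_simps)
qed

text \<open>Three errors are chained: the scan (from \<open>D\<close> to \<open>G\<close>), the
  geometric mean (from \<open>G\<close> to \<open>\<gamma>\<close>) and the quadrature (from
  \<open>\<gamma>\<close> to \<open>L\<close>). The estimates \<open>exp e * (1 - e) \<le> 1\<close>
  and \<open>1 - e \<le> exp (- e)\<close> keep every comparison polynomial in
  \<open>e\<close>.\<close>

lemma combine_errors:
  fixes e :: real
  assumes e: "0 < e" "e \<le> 1 / 8" and D: "0 < D" "D \<le> G" "G \<le> (1 + e) * D"
    and G: "exp (- e) * \<gamma> \<le> G" "G \<le> exp e * \<gamma>" and \<gamma>: "\<bar>\<gamma> - L\<bar> \<le> e * L"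
  shows "(1 - 8 * e) * D \<le> L" "L \<le> (1 + 8 * e) * D"
proof -
  have \<gamma>': "(1 - e) * L \<le> \<gamma>" "\<gamma> \<le> (1 + e) * L" using \<gamma> by (simp_all add: abs_le_iff algebra_simps)
  have exp: "exp e * (1 - e) \<le> 1" using exp_le_inverse[of e] e by (simp add: field_simps)
  have "0 < exp e * \<gamma>" using D G(2) by linarith
  then have "0 < \<gamma>" by (simp add: zero_less_mult_iff)
  have "0 < (1 + e) * L" using \<open>0 < \<gamma>\<close> \<gamma>'(2) by linarith
  then have L: "0 < L" using e by (simp add: zero_less_mult_iff)
  \<comment> \<open>Of the three factors \<open>1 - e\<close>, one absorbs \<open>exp e\<close> and
    the other two absorb the \<open>1 + e\<close> of the quadrature.\<close>
  have "(1 - 8 * e) * D \<le> ((1 - e) * (1 - e)\<^sup>2) * D"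
  proof (rule mult_right_mono)
    have "0 \<le> e * (5 + 3 * e - e * e)" using e mult_mono[of e 1 e 1] by (intro mult_nonneg_nonneg) auto
    then show "1 - 8 * e \<le> (1 - e) * (1 - e)\<^sup>2" by (simp add: power2_eq_square algebra_simps)
  qed (use D in simp)
  also have "\<dots> = (1 - e)\<^sup>2 * ((1 - e) * D)" by simp
  also have "(1 - e) * D \<le> (1 - e) * (exp e * \<gamma>)"
    using D(2) G(2) e by (intro mult_left_mono) auto
  then have "(1 - e)\<^sup>2 * ((1 - e) * D) \<le> (1 - e)\<^sup>2 * ((1 - e) * (exp e * \<gamma>))"
    by (rule mult_left_mono) simp
  also have "\<dots> = (1 - e)\<^sup>2 * ((exp e * (1 - e)) * \<gamma>)" by simp
  also have "\<dots> \<le> (1 - e)\<^sup>2 * (1 * \<gamma>)"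
    using exp \<open>0 < \<gamma>\<close> by (intro mult_left_mono mult_right_mono) auto
  also have "\<dots> \<le> (1 - e)\<^sup>2 * ((1 + e) * L)"
    using \<gamma>' by (intro mult_left_mono) auto
  also have "\<dots> = ((1 - e)\<^sup>2 * (1 + e)) * L" by simp
  also have "\<dots> \<le> 1 * L"
  proof (rule mult_right_mono)
    have "(1 - e) * (1 - e * e) \<le> 1 * 1" using e mult_mono[of e 1 e 1] by (intro mult_mono) auto
    then show "(1 - e)\<^sup>2 * (1 + e) \<le> 1" by (simp add: power2_eq_square algebra_simps)
  qed (use L in simp)
  finally show "(1 - 8 * e) * D \<le> L" by simp
  have "(1 - e)\<^sup>2 * L = (1 - e) * ((1 - e) * L)" by (simp add: power2_eq_square)
  also have "\<dots> \<le> (1 - e) * \<gamma>" using \<gamma>' e by (intro mult_left_mono) auto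
  also have "\<dots> \<le> exp (- e) * \<gamma>"
    using exp_ge_add_one_self[of "- e"] \<open>0 < \<gamma>\<close> by (intro mult_right_mono) auto
  also have "\<dots> \<le> (1 + e) * D" using G(1) D(3) by linarith
  also have "\<dots> \<le> ((1 - e)\<^sup>2 * (1 + 8 * e)) * D"
  proof (rule mult_right_mono)
    have "0 \<le> e * (5 - 15 * e + 8 * (e * e))" using e by (intro mult_nonneg_nonneg) auto
    then show "1 + e \<le> (1 - e)\<^sup>2 * (1 + 8 * e)" by (simp add: power2_eq_square algebra_simps)
  qed (use D in simp)
  finally have "(1 - e)\<^sup>2 * L \<le> (1 - e)\<^sup>2 * ((1 + 8 * e) * D)" by (simp add: mult.assoc)
  then show "L \<le> (1 + 8 * e) * D" using e by (simp add: mult_le_cancel_left_pos)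
qed

text \<open>The second bound makes the tail exponent \<open>e\<^sup>2 * N / 48\<close> at least
  \<open>8 * \<kappa>\<close>. The third says that \<open>N\<close> steps by the factor
  \<open>1 + e\<close> bridge a first sample off by \<open>exp (22 * \<kappa>)\<close> and a mean
  off by \<open>exp e\<close>; the 22 is chosen so that
  \<open>3 - 22 * \<kappa> / 2 \<le> - (8 * \<kappa>)\<close> for
  \<open>\<kappa> \<ge> 1\<close>.\<close>

lemma projections_bounds:
  fixes m :: nat and \<delta> \<epsilon> :: real
  assumes "0 < \<epsilon>"
  defines "e \<equiv> accuracy \<epsilon>" and "N \<equiv> projections m \<delta> \<epsilon>" and "\<kappa> \<equiv> real (doublings m \<delta>) + 1"
  shows "0 < N" "384 * \<kappa> \<le> e\<^sup>2 * N" "22 * \<kappa> + e \<le> N * ln (1 + e)"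
proof -
  have e: "0 < e" "e \<le> 1 / 8" using assms accuracy_pos accuracy_le by auto
  have \<kappa>: "1 \<le> \<kappa>" by (simp add: \<kappa>_def)
  show "0 < N" by (simp add: N_def projections_def)
  have "384 * \<kappa> / (e * e) \<le> real (nat \<lceil>384 * \<kappa> / (e * e)\<rceil>)" by (rule real_nat_ceiling_ge)
  also have "\<dots> \<le> N" by (simp add: N_def projections_def e_def \<kappa>_def add.commute)
  finally show 1: "384 * \<kappa> \<le> e\<^sup>2 * N" using e by (simp add: pos_divide_le_eq power2_eq_square mult.commute)
  have "22 * \<kappa> + e \<le> 8 * (192 * \<kappa>)" using \<kappa> e by simp
  also have "\<dots> \<le> (1 / e) * (192 * \<kappa>)" using e \<kappa> by (intro mult_right_mono) (auto simp: field_simps)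
  also have "\<dots> = (384 * \<kappa>) / (2 * e)" by simp
  also have "\<dots> \<le> (e\<^sup>2 * N) / (2 * e)" using 1 e by (intro divide_right_mono) auto
  also have "\<dots> = N * (e / 2)" using e by (simp add: power2_eq_square field_simps)
  also have "\<dots> \<le> N * ln (1 + e)"
  proof (rule mult_left_mono)
    have "e / 2 \<le> e - e\<^sup>2" using e by (simp add: power2_eq_square)
    also have "\<dots> \<le> ln (1 + e)" using e by (intro ln_one_plus_pos_lower_bound) auto
    finally show "e / 2 \<le> ln (1 + e)" .
  qed simp
  finally show "22 * \<kappa> + e \<le> N * ln (1 + e)" .
qed

text \<open>In logarithms, scaling by \<open>\<gamma>\<close> is a shift: the geometric mean is
  \<open>\<gamma> * exp \<mu>\<close> with \<open>\<bar>\<mu>\<bar> \<le> e\<close>. The first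
  sample differs from it by a factor of at most \<open>exp (t + e)\<close>, which
  \<open>(1 + e) ^ N\<close> covers.\<close>

lemma scan_of_scaled_samples:
  fixes z :: "nat \<Rightarrow> real"
  assumes \<gamma>: "0 < \<gamma>" and e: "0 < e" and N: "0 < N" and t: "t + e \<le> N * ln (1 + e)"
    and nz: "\<forall>p<N. z p \<noteq> 0" and mean: "\<bar>\<Sum>p<N. ln \<bar>z p\<bar>\<bar> \<le> e * N" and first: "\<bar>ln \<bar>z 0\<bar>\<bar> \<le> t"
  shows "\<exists>G. exp (- e) * \<gamma> \<le> G \<and> G \<le> exp e * \<gamma> \<and> 0 < geometric_mean_scan (1 + e) N (\<lambda>p. \<gamma> * z p) \<and>
    geometric_mean_scan (1 + e) N (\<lambda>p. \<gamma> * z p) \<le> G \<and> G \<le> (1 + e) * geometric_mean_scan (1 + e) N (\<lambda>p. \<gamma> * z p)"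
proof -
  define \<mu> where "\<mu> = (\<Sum>p<N. ln \<bar>z p\<bar>) / N"
  define G where "G = exp ((\<Sum>p<N. ln \<bar>\<gamma> * z p\<bar>) / N)"
  have "(\<Sum>p<N. ln \<bar>\<gamma> * z p\<bar>) = (\<Sum>p<N. ln \<gamma> + ln \<bar>z p\<bar>)"
    using \<gamma> nz by (intro sum.cong refl) (auto simp: abs_mult ln_mult)
  also have "\<dots> / N = ln \<gamma> + \<mu>"
    using N by (simp add: \<mu>_def sum.distrib add_divide_distrib)
  finally have G: "G = \<gamma> * exp \<mu>" using \<gamma> by (simp add: G_def exp_add)
  have \<mu>: "- e \<le> \<mu>" "\<mu> \<le> e" using mean N by (auto simp: \<mu>_def field_simps abs_le_iff)
  have aN: "(1 + e) ^ N = exp (N * ln (1 + e))" using e by (simp add: exp_of_nat_mult)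
  have z0: "\<bar>\<gamma> * z 0\<bar> = \<gamma> * exp (ln \<bar>z 0\<bar>)" using nz N \<gamma> by (simp add: abs_mult)
  have "exp (ln \<bar>z 0\<bar>) \<le> exp (\<mu> + N * ln (1 + e))" "exp \<mu> \<le> exp (N * ln (1 + e) + ln \<bar>z 0\<bar>)"
    using first \<mu> t unfolding exp_le_cancel_iff by linarith+
  then have "\<gamma> * exp (ln \<bar>z 0\<bar>) \<le> \<gamma> * exp (\<mu> + N * ln (1 + e))" "\<gamma> * exp \<mu> \<le> \<gamma> * exp (N * ln (1 + e) + ln \<bar>z 0\<bar>)"
    using \<gamma> by (intro mult_left_mono; simp)+
  then have "\<bar>\<gamma> * z 0\<bar> \<le> G * (1 + e) ^ N" "G \<le> (1 + e) ^ N * \<bar>\<gamma> * z 0\<bar>"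
    unfolding G aN z0 exp_add by (simp_all only: mult_ac)
  moreover have "(1 + e) ^ N * \<bar>\<gamma> * z 0\<bar> \<le> (1 + e) ^ (N + 1) * \<bar>\<gamma> * z 0\<bar>"
    using e by (intro mult_right_mono power_increasing) auto
  ultimately have range: "\<bar>\<gamma> * z 0\<bar> \<le> G * (1 + e) ^ N" "G \<le> (1 + e) ^ (N + 1) * \<bar>\<gamma> * z 0\<bar>" by linarith+
  have "1 < 1 + e" using e by simp
  note scan = geometric_mean_scan_bounds[of "1 + e" N "\<lambda>p. \<gamma> * z p", folded G_def, OF this N _ range]
  show ?thesis
    using \<gamma> nz \<mu> scan by (intro exI[of _ G] conjI) (auto simp: G)
qed

lemma pair_failure:
  fixes F f \<delta> \<epsilon> j k
  defines "D \<equiv> \<lambda>\<omega>. estimate F \<delta> \<epsilon> \<omega> j k" and "L \<equiv> L1_dist (f j) (f k)"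
  assumes rep: "represents F f" and jk: "j < nfun F" "k < nfun F" and \<delta>: "0 < \<delta>" "\<delta> \<le> 1" and \<epsilon>: "0 < \<epsilon>"
  shows "samples.prob {\<omega> \<in> space cauchy_samples. \<not> ((1 - \<epsilon>) * D \<omega> \<le> L \<and> L \<le> (1 + \<epsilon>) * D \<omega>)} \<le> \<delta> / (real (nfun F))\<^sup>2"
    (is "samples.prob ?bad \<le> _")
proof -
  define e N \<kappa> q where "e = accuracy \<epsilon>" and "N = projections (nfun F) \<delta> \<epsilon>"
    and "\<kappa> = real (doublings (nfun F) \<delta>) + 1" and "q = cells (deg F) \<epsilon>"
  define K where "K = (nend F - 1) * q"
  define w where "w = weight F q j k"
  define \<gamma> where "\<gamma> = (\<Sum>v<K. \<bar>w v\<bar>)"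
  define x where "x p \<omega> = (\<Sum>v<K. w v * \<omega> (p * (nend F * q) + v))" for p and \<omega> :: "nat \<Rightarrow> real"
  have e: "0 < e" "e \<le> 1 / 8" "8 * e \<le> \<epsilon>" using accuracy_pos[OF \<epsilon>] accuracy_le by (auto simp: e_def)
  have N: "0 < N" "384 * \<kappa> \<le> e\<^sup>2 * N" "22 * \<kappa> + e \<le> N * ln (1 + e)"
    using projections_bounds[OF \<epsilon>, where m = "nfun F" and \<delta> = \<delta>] unfolding e_def N_def \<kappa>_def by auto
  have q: "0 < q" by (simp add: q_def cells_def)
  have D: "D \<omega> = geometric_mean_scan (1 + e) N (\<lambda>p. x p \<omega>)" for \<omega>
    unfolding D_def estimate_def q_def[symmetric] N_def[symmetric] e_def[symmetric] sketch_diff_eq[OF rep jk]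
    by (simp add: x_def K_def w_def)
  have L: "0 \<le> L" unfolding L_def L1_dist_def by (intro Bochner_Integration.integral_nonneg) auto
  have \<gamma>L: "\<bar>\<gamma> - L\<bar> \<le> e * L"
  proof -
    have "384 * (real (deg F + 1))\<^sup>2 / e = real (384 * ((deg F + 1) * (deg F + 1))) / accuracy \<epsilon>"
      by (simp add: e_def power2_eq_square algebra_simps)
    also have "\<dots> \<le> real (nat \<lceil>real (384 * ((deg F + 1) * (deg F + 1))) / accuracy \<epsilon>\<rceil>)"
      by (rule real_nat_ceiling_ge)
    also have "\<dots> \<le> q" by (simp add: q_def cells_def)
    finally have "384 * (real (deg F + 1))\<^sup>2 / q \<le> e" using e q by (simp add: field_simps)
    then have "384 * (real (deg F + 1))\<^sup>2 / q * L \<le> e * L" using L by (rule mult_right_mono)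
    with weight_sum_error[OF rep jk q] show ?thesis by (simp add: \<gamma>_def K_def w_def L_def)
  qed
  have "0 \<le> \<gamma>" by (simp add: \<gamma>_def sum_nonneg)
  then consider "\<gamma> = 0" | "0 < \<gamma>" by linarith
  then show ?thesis
  proof cases
    \<comment> \<open>A scale of 0 means that all weights vanish, so the sketches agree for every
      sample sequence and the estimate is 0; the quadrature bound then forces
      \<open>L = 0\<close>.\<close>
    case 1
    then have "w v = 0" if "v < K" for v using that by (simp add: \<gamma>_def sum_nonneg_eq_0_iff)
    then have "D \<omega> = 0" for \<omega> unfolding D by (intro geometric_mean_scan_zero) (simp add: x_def)
    moreover have "L = 0"
    proof -
      have "(1 - e) * L \<le> 0" using \<gamma>L 1 by (simp add: algebra_simps)
      then show ?thesis using e L by (simp add: mult_le_0_iff)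
    qed
    ultimately show ?thesis using \<delta> by simp
  next
    case 2
    define Z where "Z p \<omega> = x p \<omega> / \<gamma>" for p \<omega>
    have KL: "K \<le> nend F * q" by (simp add: K_def)
    have ind: "samples.indep_vars (\<lambda>_. borel) Z {..<N}" and distr: "distr cauchy_samples borel (Z p) = cauchy" for p
      using block_combinations[OF KL \<gamma>_def 2] by (simp_all add: Z_def[abs_def] x_def)
    have xZ: "x p \<omega> = \<gamma> * Z p \<omega>" for p \<omega> using 2 by (simp add: Z_def)
    let ?good = "\<lambda>\<omega>. (\<forall>p<N. Z p \<omega> \<noteq> 0) \<and> \<bar>\<Sum>p<N. ln \<bar>Z p \<omega>\<bar>\<bar> \<le> e * N \<and> \<bar>ln \<bar>Z 0 \<omega>\<bar>\<bar> \<le> 22 * \<kappa>"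
    have good: "(1 - \<epsilon>) * D \<omega> \<le> L \<and> L \<le> (1 + \<epsilon>) * D \<omega>" if "?good \<omega>" for \<omega>
    proof -
      have D': "D \<omega> = geometric_mean_scan (1 + e) N (\<lambda>p. \<gamma> * Z p \<omega>)" by (simp only: D xZ)
      from that have "\<forall>p<N. Z p \<omega> \<noteq> 0" "\<bar>\<Sum>p<N. ln \<bar>Z p \<omega>\<bar>\<bar> \<le> e * N" "\<bar>ln \<bar>Z 0 \<omega>\<bar>\<bar> \<le> 22 * \<kappa>" by simp_all
      from scan_of_scaled_samples[OF 2 e(1) N(1,3) this]
      obtain G where G: "exp (- e) * \<gamma> \<le> G" "G \<le> exp e * \<gamma>" "0 < D \<omega>" "D \<omega> \<le> G" "G \<le> (1 + e) * D \<omega>"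
        unfolding D'[symmetric] by blast
      have "(1 - 8 * e) * D \<omega> \<le> L" "L \<le> (1 + 8 * e) * D \<omega>"
        using combine_errors[OF e(1,2) G(3,4,5,1,2) \<gamma>L] by auto
      moreover have "(1 - \<epsilon>) * D \<omega> \<le> (1 - 8 * e) * D \<omega>" "(1 + 8 * e) * D \<omega> \<le> (1 + \<epsilon>) * D \<omega>"
        using e(3) G(3) by (intro mult_right_mono; simp)+
      ultimately show ?thesis by linarith
    qed
    have [measurable]: "Z p \<in> borel_measurable cauchy_samples" for p
      unfolding Z_def[abs_def] x_def by measurable
    have "samples.prob ?bad
        \<le> samples.prob {\<omega> \<in> space cauchy_samples. \<not> ?good \<omega>}"
    proof (rule samples.finite_measure_mono)
      show "?bad \<subseteq> {\<omega> \<in> space cauchy_samples. \<not> ?good \<omega>}"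
        using good by blast
      show "{\<omega> \<in> space cauchy_samples. \<not> ?good \<omega>} \<in> sets cauchy_samples" by measurable
    qed
    also have "\<dots> \<le> 2 * exp (- (e\<^sup>2 * N / 48)) + 2 * exp (3 - 22 * \<kappa> / 2)"
      using e by (intro samples.cauchy_samples_tail[OF ind distr N(1)]) auto
    also have "\<dots> \<le> 2 * exp (- (8 * \<kappa>)) + 2 * exp (- (8 * \<kappa>))"
    proof -
      have "1 \<le> \<kappa>" by (simp add: \<kappa>_def)
      then have "- (e\<^sup>2 * N / 48) \<le> - (8 * \<kappa>)" "3 - 22 * \<kappa> / 2 \<le> - (8 * \<kappa>)" using N(2) by linarith+
      then show ?thesis by (intro add_mono mult_left_mono) simp_all
    qed
    \<comment> \<open>The 1 in \<open>\<kappa>\<close> pays for the leading factor 4; every doubling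
      contributes a factor of at most \<open>1 / 4\<close>.\<close>
    also have "\<dots> = 4 * exp (- 8) * exp (- 8) ^ doublings (nfun F) \<delta>"
      by (simp add: \<kappa>_def algebra_simps exp_of_nat_mult[symmetric] exp_add[symmetric])
    also have "\<dots> \<le> 4 * (1 / 4) * (1 / 4) ^ doublings (nfun F) \<delta>"
    proof -
      have "exp (- 8 :: real) \<le> 1 / 4"
        using exp_ge_add_one_self[of "8 :: real"] by (simp add: exp_minus field_simps)
      then show ?thesis by (intro mult_mono power_mono) auto
    qed
    also have "\<dots> = (1 / 2 ^ doublings (nfun F) \<delta>)\<^sup>2"
      by (simp add: power_divide power2_eq_square power_mult_distrib[symmetric])
    \<comment> \<open>By the choice of \<open>doublings\<close>, \<open>2 ^ doublings\<close> is at
      least \<open>m / \<delta>\<close>. The square leaves room for the \<open>m\<^sup>2\<close>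
      pairs.\<close>
    also have "\<dots> \<le> (\<delta> / nfun F)\<^sup>2"
    proof (rule power_mono)
      have m: "0 < real (nfun F)" using jk by simp
      have "nfun F / \<delta> = 2 powr (log 2 (nfun F / \<delta>))" using m \<delta> by simp
      also have "\<dots> \<le> 2 powr (doublings (nfun F) \<delta>)"
        unfolding doublings_def by (intro powr_mono real_nat_ceiling_ge) auto
      finally have "nfun F / \<delta> \<le> 2 ^ doublings (nfun F) \<delta>" by (simp add: powr_realpow)
      then show "1 / 2 ^ doublings (nfun F) \<delta> \<le> \<delta> / nfun F" using m \<delta> by (simp add: field_simps)
    qed simp
    also have "\<dots> \<le> \<delta> / (real (nfun F))\<^sup>2"
      using \<delta> mult_mono[of \<delta> 1 \<delta> \<delta>] by (simp add: power_divide power2_eq_square divide_right_mono)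
    finally show ?thesis .
  qed
qed

text \<open>Union bound over the \<open>m\<^sup>2\<close> ordered pairs. For
  \<open>\<delta> > 1\<close> the claim is void, which is why \<open>pair_failure\<close> may assume
  \<open>\<delta> \<le> 1\<close>.\<close>

lemma estimate_probability:
  assumes rep: "represents F f" and m: "1 \<le> nfun F" and \<delta>: "0 < \<delta>" and \<epsilon>: "0 < \<epsilon>"
  shows "1 - \<delta> \<le> \<P>(\<omega> in cauchy_samples. rel_error_approx \<epsilon> (nfun F) f (estimate F \<delta> \<epsilon> \<omega>))"
proof (cases "\<delta> \<le> 1")
  case True
  let ?m = "nfun F"
  let ?bad = "\<lambda>(j, k). {\<omega> \<in> space cauchy_samples. \<not> ((1 - \<epsilon>) * estimate F \<delta> \<epsilon> \<omega> j k \<le> L1_dist (f j) (f k) \<and>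
      L1_dist (f j) (f k) \<le> (1 + \<epsilon>) * estimate F \<delta> \<epsilon> \<omega> j k)}"
  have meas: "?bad jk \<in> sets cauchy_samples" for jk by (cases jk) simp
  have "samples.prob (\<Union>jk\<in>{..<?m} \<times> {..<?m}. ?bad jk) \<le> (\<Sum>jk\<in>{..<?m} \<times> {..<?m}. samples.prob (?bad jk))"
    by (intro samples.finite_measure_subadditive_finite) (use meas in auto)
  also have "\<dots> \<le> (\<Sum>jk\<in>{..<?m} \<times> {..<?m}. \<delta> / (real ?m)\<^sup>2)"
    by (intro sum_mono) (use pair_failure[OF rep _ _ \<delta> True \<epsilon>] in auto)
  also have "\<dots> = \<delta>" using m by (simp add: power2_eq_square)
  finally have "1 - \<delta> \<le> 1 - samples.prob (\<Union>jk\<in>{..<?m} \<times> {..<?m}. ?bad jk)" by simp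
  also have "\<dots> = samples.prob (space cauchy_samples - (\<Union>jk\<in>{..<?m} \<times> {..<?m}. ?bad jk))"
    by (intro samples.prob_compl[symmetric] sets.finite_UN) (use meas in auto)
  also have "space cauchy_samples - (\<Union>jk\<in>{..<?m} \<times> {..<?m}. ?bad jk)
      = {\<omega> \<in> space cauchy_samples. rel_error_approx \<epsilon> ?m f (estimate F \<delta> \<epsilon> \<omega>)}"
    unfolding rel_error_approx_def by auto
  finally show ?thesis .
next
  case False
  then have "1 - \<delta> \<le> 0" by simp
  then show ?thesis using measure_nonneg by (rule order.trans)
qed

section \<open>Counting operations\<close>

lemma nend_le:
  assumes "wf_input F"
  shows "nend F \<le> 2 * (nfun F * npiece F)"
proof -
  have "nend F = card (\<Union>j<nfun F. \<Union>l<npiece F. {lidx F j l, ridx F j l})"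
    using assms unfolding wf_input_def by (metis card_lessThan)
  also have "\<dots> \<le> (\<Sum>j<nfun F. card (\<Union>l<npiece F. {lidx F j l, ridx F j l}))"
    by (rule card_UN_le) simp
  also have "\<dots> \<le> (\<Sum>j<nfun F. \<Sum>l<npiece F. card {lidx F j l, ridx F j l})"
    by (intro sum_mono card_UN_le) simp
  also have "\<dots> \<le> (\<Sum>j<nfun F. \<Sum>l<npiece F. 2)"
    by (intro sum_mono) (simp add: card_insert_if)
  finally show ?thesis by (simp add: mult.commute)
qed

text \<open>Every summand is compared with \<open>W * P\<close>. Passing to \<open>d + 1\<close> and
  to the clamped quantities \<open>E\<close> and \<open>\<Lambda>\<close> makes all factors at least
  1, so that smaller powers may be raised to those in \<open>P\<close>.\<close>

lemma operation_count:
  fixes F \<delta> \<epsilon>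
  defines "m \<equiv> nfun F" and "n \<equiv> npiece F" and "d \<equiv> deg F"
  defines "q \<equiv> cells d \<epsilon>" and "N \<equiv> projections m \<delta> \<epsilon>"
  assumes wf: "wf_input F" and m: "1 \<le> m" and pos: "0 < \<delta>" "0 < \<epsilon>"
    and t: "t \<le> 200 * (doublings m \<delta> + q + N + 1)
        + (N * ((d + 1) * (200 * nend F * (q + 1) + 200 * m * (n + 1) + 100)) + 10)
        + (m * (m * (200 * (N + 1) + 40) + 40) + 10)"
  shows "real t \<le> 10 ^ 13 * op_bound m n d \<delta> \<epsilon>"
proof -
  define W x E \<Lambda> where "W = real m * (real m + real n)" and "x = real d + 1"
    and "E = max 1 (1 / \<epsilon>)" and "\<Lambda> = max 1 (ln (real m / \<delta>))"
  define e where "e = accuracy \<epsilon>"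
  define P where "P = x ^ 3 * E ^ 3 * \<Lambda>"
  have ge1: "1 \<le> W" "1 \<le> x" "1 \<le> E" "1 \<le> \<Lambda>"
    using m mult_mono[of 1 "real m" 1 "real m + real n"] by (auto simp: W_def x_def E_def \<Lambda>_def)
  have e: "0 < e" "1 / e \<le> 8 * E"
    using accuracy_pos[OF pos(2)] pos(2) by (auto simp: e_def accuracy_def E_def max_def)
  \<comment> \<open>\<open>2 * ln 2 \<ge> 1\<close> converts the binary logarithm, and the 1 added
    by the ceiling is absorbed by \<open>\<Lambda> \<ge> 1\<close>.\<close>
  have k: "real (doublings m \<delta>) \<le> 3 * \<Lambda>"
  proof -
    have "real (doublings m \<delta>) \<le> max 0 (log 2 (m / \<delta>)) + 1"
      unfolding doublings_def by linarith
    also have "log 2 (m / \<delta>) \<le> 2 * \<Lambda>"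
    proof -
      have "ln (m / \<delta>) \<le> \<Lambda> * 1" by (simp add: \<Lambda>_def)
      also have "\<dots> \<le> \<Lambda> * (2 * ln 2)" using ge1 ln2_ge_two_thirds by (intro mult_left_mono) auto
      finally show ?thesis by (simp add: log_def field_simps)
    qed
    then have "max 0 (log 2 (m / \<delta>)) + 1 \<le> 3 * \<Lambda>" using ge1 by simp
    finally show ?thesis .
  qed
  have ceil: "real (max 1 (nat \<lceil>y\<rceil>)) \<le> y + 1" if "0 \<le> y" for y :: real
    using that by linarith
  have q: "real q + 1 \<le> 3074 * (x\<^sup>2 * E)"
  proof -
    have "real q \<le> 384 * x\<^sup>2 * (1 / e) + 1"
      unfolding q_def cells_def using ceil[of "real (384 * ((d + 1) * (d + 1))) / accuracy \<epsilon>"] e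
      by (simp add: e_def x_def power2_eq_square algebra_simps add_divide_distrib)
    also have "384 * x\<^sup>2 * (1 / e) \<le> 384 * x\<^sup>2 * (8 * E)"
      using e by (intro mult_left_mono) auto
    finally have "real q \<le> 3072 * (x\<^sup>2 * E) + 1" by simp
    moreover have "1 * 1 \<le> x\<^sup>2 * E" using ge1 by (intro mult_mono one_le_power) auto
    ultimately show ?thesis by simp
  qed
  have N: "real N \<le> 100000 * (\<Lambda> * E\<^sup>2)"
  proof -
    have "real N \<le> 384 * (real (doublings m \<delta>) + 1) * (1 / e)\<^sup>2 + 1"
      unfolding N_def projections_def
      using ceil[of "real (384 * (doublings m \<delta> + 1)) / (accuracy \<epsilon> * accuracy \<epsilon>)"] e
      by (simp add: e_def power2_eq_square algebra_simps add_divide_distrib)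
    also have "384 * (real (doublings m \<delta>) + 1) * (1 / e)\<^sup>2 \<le> 384 * (4 * \<Lambda>) * (8 * E)\<^sup>2"
      using e k ge1 by (intro mult_mono power_mono) auto
    finally have "real N \<le> 98304 * (\<Lambda> * E\<^sup>2) + 1" by (simp add: power_mult_distrib)
    moreover have "1 * 1 \<le> \<Lambda> * E\<^sup>2" using ge1 by (intro mult_mono one_le_power) auto
    ultimately show ?thesis by simp
  qed
  have mono: "\<Lambda> ^ a * (x ^ b * E ^ c) \<le> P" if "a \<le> 1" "b \<le> 3" "c \<le> 3" for a b c
  proof -
    have "\<Lambda> ^ a * (x ^ b * E ^ c) \<le> \<Lambda> ^ 1 * (x ^ 3 * E ^ 3)"
      using ge1 that by (intro mult_mono power_increasing mult_nonneg_nonneg) auto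
    then show ?thesis by (simp add: P_def mult_ac)
  qed
  have P: "1 \<le> P" "\<Lambda> \<le> P" "x\<^sup>2 * E \<le> P" "\<Lambda> * E\<^sup>2 \<le> P" "\<Lambda> * E\<^sup>2 * x \<le> P"
    using mono[of 0 0 0] mono[of 1 0 0] mono[of 0 2 1] mono[of 1 0 2] mono[of 1 1 2] by (simp_all add: mult_ac)
  have Nx: "real N * x \<le> 100000 * P"
  proof -
    have "real N * x \<le> 100000 * (\<Lambda> * E\<^sup>2) * x" using N ge1 by (intro mult_right_mono) auto
    also have "\<dots> = 100000 * (\<Lambda> * E\<^sup>2 * x)" by simp
    also have "\<dots> \<le> 100000 * P" using P(5) by (intro mult_left_mono) auto
    finally show ?thesis .
  qed
  \<comment> \<open>The dominant product, which exhausts \<open>P\<close>: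
    \<open>\<Lambda> * E\<^sup>2\<close> projections, \<open>x\<close> moments, and
    \<open>x\<^sup>2 * E\<close> cells per interval.\<close>
  have Nxq: "real N * x * (real q + 1) \<le> 3074 * 100000 * P"
  proof -
    have "real N * x * (real q + 1) \<le> (100000 * (\<Lambda> * E\<^sup>2)) * x * (3074 * (x\<^sup>2 * E))"
      using N q ge1 by (intro mult_mono) auto
    also have "\<dots> = 3074 * 100000 * P" by (simp add: P_def power2_eq_square power3_eq_cube)
    finally show ?thesis .
  qed
  have s: "real (nend F) \<le> 2 * W"
  proof -
    have "real (nend F) \<le> real (2 * (m * n))" using nend_le[OF wf] by (simp only: of_nat_le_iff m_def n_def)
    then have "real (nend F) \<le> 2 * (real m * real n)" by simp
    also have "\<dots> \<le> 2 * W" by (simp add: W_def algebra_simps)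
    finally show ?thesis .
  qed
  have mn: "real m * (real n + 1) \<le> W" "real m * real m \<le> W" "real m \<le> W"
    using m mult_left_mono[of 1 "real m + real n" "real m"] by (auto simp: W_def intro: mult_left_mono)
  have kP: "real (doublings m \<delta>) \<le> 3 * P"
    using order_trans[OF k mult_left_mono[OF P(2), of 3]] by simp
  have qP: "real q + 1 \<le> 3074 * P"
    using order_trans[OF q mult_left_mono[OF P(3), of 3074]] by simp
  have NP: "real N \<le> 100000 * P"
    using order_trans[OF N mult_left_mono[OF P(4), of 100000]] by simp
  have "200 * (real (doublings m \<delta>) + real q + real N + 1) \<le> 200 * (3 * P + 3074 * P + 100000 * P + P)"
    using kP qP NP P(1) by simp
  also have "\<dots> \<le> 10 ^ 8 * (W * P)"
    using mult_right_mono[OF ge1(1), of P] P by simp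
  finally have T1: "200 * (real (doublings m \<delta>) + real q + real N + 1) \<le> 10 ^ 8 * (W * P)" .
  let ?Z = "200 * real (nend F) * (real q + 1) + 200 * (real m * (real n + 1)) + 100"
  let ?Y = "real m * (real m * (200 * (real N + 1) + 40) + 40)"
  have T2: "real N * (x * (?Z)) \<le> 2 * 10 ^ 11 * (W * P)"
  proof -
    have "real N * (x * (?Z))
      = 200 * (real (nend F) * (real N * x * (real q + 1))) + 200 * ((real m * (real n + 1)) * (real N * x)) + 100 * (1 * (real N * x))"
      by (simp add: algebra_simps)
    also have "\<dots> \<le> 200 * ((2 * W) * (3074 * 100000 * P)) + 200 * (W * (100000 * P)) + 100 * (W * (100000 * P))"
    proof -
      have f1: "real (nend F) * (real N * x * (real q + 1)) \<le> (2 * W) * (3074 * 100000 * P)"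
        by (rule mult_mono[OF s Nxq]) (use ge1 in simp_all)
      have f2: "(real m * (real n + 1)) * (real N * x) \<le> W * (100000 * P)"
        by (rule mult_mono[OF mn(1) Nx]) (use ge1 in simp_all)
      have f3: "1 * (real N * x) \<le> W * (100000 * P)"
        by (rule mult_mono[OF ge1(1) Nx]) (use ge1 in simp_all)
      show ?thesis by (intro add_mono mult_left_mono f1 f2 f3) simp_all
    qed
    also have "\<dots> \<le> 2 * 10 ^ 11 * (W * P)"
      using ge1 P mult_nonneg_nonneg[of W P] by simp
    finally show ?thesis .
  qed
  have T3: "?Y \<le> 10 ^ 8 * (W * P)"
  proof -
    have "?Y = (real m * real m) * (200 * real N + 240) + 40 * (real m * 1)"
      by (simp add: algebra_simps)
    also have "\<dots> \<le> W * (200 * (100000 * P) + 240 * P) + 40 * (W * P)"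
    proof -
      have h: "200 * real N + 240 \<le> 200 * (100000 * P) + 240 * P" using NP P(1) by simp
      have "(real m * real m) * (200 * real N + 240) \<le> W * (200 * (100000 * P) + 240 * P)"
        by (rule mult_mono[OF mn(2) h]) (use ge1 in simp_all)
      moreover have "real m * 1 \<le> W * P"
        by (rule mult_mono[OF mn(3) P(1)]) (use ge1 in simp_all)
      ultimately show ?thesis by (intro add_mono mult_left_mono) simp_all
    qed
    also have "\<dots> \<le> 10 ^ 8 * (W * P)"
      using ge1 P mult_nonneg_nonneg[of W P] by (simp add: algebra_simps)
    finally show ?thesis .
  qed
  have WP: "1 \<le> W * P" using mult_mono[of 1 W 1 P] ge1 P by simp
  have "real t \<le> real (200 * (doublings m \<delta> + q + N + 1)
        + (N * ((d + 1) * (200 * nend F * (q + 1) + 200 * m * (n + 1) + 100)) + 10)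
        + (m * (m * (200 * (N + 1) + 40) + 40) + 10))"
    using t by (simp only: of_nat_le_iff)
  also have "\<dots> = 200 * (real (doublings m \<delta>) + real q + real N + 1)
      + (real N * (x * (?Z)) + 10)
      + (?Y + 10)"
    by (simp add: x_def algebra_simps)
  also have "\<dots> \<le> 10 ^ 12 * (W * P)"
  proof -
    have "a + (b + 10) + (c + 10) \<le> 10 ^ 12 * B"
      if "a \<le> 10 ^ 8 * B" "b \<le> 2 * 10 ^ 11 * B" "c \<le> 10 ^ 8 * B" "1 \<le> B" for a b c B :: real
      using that by simp
    from this[OF T1 T2 T3 WP] show ?thesis .
  qed
  also have "\<dots> \<le> 10 ^ 12 * (W * (8 * max 1 (real d ^ 3) * max 1 (1 / \<epsilon> ^ 3) * \<Lambda>))"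
  proof -
    \<comment> \<open>\<open>d + 1 \<le> 2 * d\<close> for \<open>d \<ge> 1\<close>; the resulting
      factor 8 turns \<open>10 ^ 12\<close> into less than \<open>10 ^ 13\<close>.\<close>
    have "x ^ 3 \<le> 8 * max 1 (real d ^ 3)"
    proof (cases "d = 0")
      case False
      then have "x ^ 3 \<le> (2 * real d) ^ 3" by (intro power_mono) (auto simp: x_def)
      then show ?thesis by (simp add: power_mult_distrib)
    qed (simp add: x_def)
    moreover have E3: "E ^ 3 = max 1 (1 / \<epsilon> ^ 3)"
    proof (cases "\<epsilon> \<le> 1")
      case True
      then have "E = 1 / \<epsilon>" "1 \<le> 1 / \<epsilon> ^ 3" using pos(2) by (auto simp: E_def max_def field_simps power_le_one)
      then show ?thesis by (simp add: power_divide max_def)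
    next
      case False
      then have "E = 1" "1 / \<epsilon> ^ 3 \<le> 1" using one_le_power[of \<epsilon> 3] by (auto simp: E_def max_def field_simps)
      then show ?thesis by (simp add: max_def)
    qed
    ultimately have "P \<le> 8 * max 1 (real d ^ 3) * max 1 (1 / \<epsilon> ^ 3) * \<Lambda>"
      unfolding P_def E3 using ge1 by (intro mult_right_mono) auto
    then show ?thesis using ge1 by (intro mult_left_mono) auto
  qed
  also have "\<dots> = 8 * 10 ^ 12 * op_bound m n d \<delta> \<epsilon>"
    by (simp add: op_bound_def W_def \<Lambda>_def)
  also have "\<dots> \<le> 10 ^ 13 * op_bound m n d \<delta> \<epsilon>"
    by (intro mult_right_mono) (auto simp: op_bound_def intro!: mult_nonneg_nonneg)
  finally show ?thesis .
qed

theorem theorem5p1: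
  shows "\<exists>(P :: com) (C :: real).
    \<forall>(F :: family_input) (f :: nat \<Rightarrow> real \<Rightarrow> real) (\<delta> :: real) (\<epsilon> :: real).
      1 \<le> nfun F \<and> represents F f \<and> (\<forall>j<nfun F. prob_density (f j)) \<and> 0 < \<delta> \<and> 0 < \<epsilon> \<longrightarrow>
      (\<forall>\<omega>. \<exists>t s. exec \<omega> P (init_state F \<delta> \<epsilon>) t s \<and>
                 real t \<le> C * op_bound (nfun F) (npiece F) (deg F) \<delta> \<epsilon>) \<and>
      \<P>(\<omega> in cauchy_samples.
          \<exists>t s. exec \<omega> P (init_state F \<delta> \<epsilon>) t s \<and>
                rel_error_approx \<epsilon> (nfun F) f (dist_estimate (nfun F) s)) \<ge> 1 - \<delta>"
proof (intro exI[of _ estimate_distances] exI[of _ "10 ^ 13"] allI impI, elim conjE)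
  fix F :: family_input and f :: "nat \<Rightarrow> real \<Rightarrow> real" and \<delta> \<epsilon> :: real
  assume m: "1 \<le> nfun F" and rep: "represents F f" and pos: "0 < \<delta>" "0 < \<epsilon>"
  let ?run = "\<lambda>\<omega>. exec \<omega> estimate_distances (init_state F \<delta> \<epsilon>)"
  have wf: "wf_input F" using rep by (simp add: represents_def)
  have "0 < nfun F" using m by simp
  note run = wp_estimate_distances[OF wf pos this, unfolded wp_def]
  have "\<exists>t s. ?run \<omega> t s \<and>
      real t \<le> 10 ^ 13 * op_bound (nfun F) (npiece F) (deg F) \<delta> \<epsilon>" for \<omega>
    using run[of \<omega>] operation_count[OF wf m pos] by blast
  \<comment> \<open>Determinism makes the existential harmless: no other run could satisfy it, so
    the event is the one for \<open>estimate\<close>.\<close>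
  moreover have "(\<exists>t s. ?run \<omega> t s \<and>
        rel_error_approx \<epsilon> (nfun F) f (dist_estimate (nfun F) s))
      \<longleftrightarrow> rel_error_approx \<epsilon> (nfun F) f (estimate F \<delta> \<epsilon> \<omega>)" for \<omega>
  proof -
    obtain t s where ts: "?run \<omega> t s"
      "\<forall>j<nfun F. \<forall>k<nfun F. dist_estimate (nfun F) s j k = estimate F \<delta> \<epsilon> \<omega> j k"
      using run[of \<omega>] by blast
    have "rel_error_approx \<epsilon> (nfun F) f (dist_estimate (nfun F) s) \<longleftrightarrow> rel_error_approx \<epsilon> (nfun F) f (estimate F \<delta> \<epsilon> \<omega>)"
      using ts(2) unfolding rel_error_approx_def by simp
    then show ?thesis using ts(1) exec_deterministic[OF ts(1)] by blast
  qed
  ultimately show "(\<forall>\<omega>. \<exists>t s. ?run \<omega> t s \<and>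
      real t \<le> 10 ^ 13 * op_bound (nfun F) (npiece F) (deg F) \<delta> \<epsilon>) \<and>
    \<P>(\<omega> in cauchy_samples. \<exists>t s. ?run \<omega> t s \<and>
      rel_error_approx \<epsilon> (nfun F) f (dist_estimate (nfun F) s)) \<ge> 1 - \<delta>"
    using estimate_probability[OF rep m pos] by simp
qed

end
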